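(* Let $f(\tau)=\sum_{n\ge1}a_f(n)e^{2\pi in\tau}$ be a holomorphic cusp form of weight $k$ for the full modular group $\mathrm{SL}(2,\mathbb{Z})$ with real Fourier coefficients $a_{f}(n)$. Let $p,q$ be integers with $p^{2}\equiv1\pmod q$, and let \[ L_{f}(s,p/q)=\sum_{n=1}^{\infty}\frac{a_{f}(n)e^{2\pi ipn/q}}{n^{s}},\qquad \mathrm{Re}(s)>\tfrac{k+1}{2}, \] extended to an entire function. Let $(c_{j})_{j\in\mathbb{N}}$ be non-zero real numbers with $\sum_{j}|c_{j}|<\infty$, let $(\lambda_{j})_{j\in\mathbb{N}}$ be a bounded sequence of distinct real numbers attaining its bounds, and let $z$ belong to \[ \mathscr{D}_{q}:=\left\{ z\in\mathbb{C}\,:\,|\mathrm{Re}(z)|<2\sqrt{\tfrac{\pi}{q}},\ |\mathrm{Im}(z)|<2\sqrt{\tfrac{\pi}{q}}\right\}. \] Then the function \[ \sum_{j=1}^{\infty}c_{j}\left(\frac{2\pi}{q}\right)^{-s-i\lambda_{j}}\Gamma(s+i\lambda_{j})\,L_{f}\!\left(s+i\lambda_{j},\tfrac{p}{q}\right)\left\{ {}_{1}F_{1}\!\left(k-s-i\lambda_{j};k;\tfrac{z^{2}}{4}\right)+{}_{1}F_{1}\!\left(k-\overline{s}+i\lambda_{j};k;\tfrac{\overline{z}^{2}}{4}\right)\right\} \] has infinitely many zeros on the line $\mathrm{Re}(s)=\frac{k}{2}$.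
   Context: It is known (Wilton) that for $(p,q)=1$, $L_f(s,p/q)$ extends to an entire function satisfying $(2\pi/q)^{-s}\Gamma(s)L_f(s,p/q)=(-1)^{k/2}(2\pi/q)^{-(k-s)}\Gamma(k-s)L_f(k-s,-\overline{p}/q)$ where $p\overline p\equiv1\pmod q$. A bounded real sequence "attains its bounds" if its supremum and infimum are attained. ${}_{1}F_{1}$ is Kummer's confluent hypergeometric function. *)

theory Defs
  imports "HOL-Complex_Analysis.Complex_Analysis" "HOL-Number_Theory.Cong"
begin

definition cusp_form_SL2Z :: "nat \<Rightarrow> (complex \<Rightarrow> complex) \<Rightarrow> bool" where
  "cusp_form_SL2Z k f \<longleftrightarrow>
     f holomorphic_on {\<tau>. Im \<tau> > 0} \<and>
     (\<forall>a b c d :: int. a * d - b * c = 1 \<longrightarrow>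
        (\<forall>\<tau>. Im \<tau> > 0 \<longrightarrow>
           f ((of_int a * \<tau> + of_int b) / (of_int c * \<tau> + of_int d)) =
             (of_int c * \<tau> + of_int d) ^ k * f \<tau>)) \<and>
     (f \<longlongrightarrow> 0) (filtercomap Im at_top)"

definition has_fourier_coeffs :: "(complex \<Rightarrow> complex) \<Rightarrow> (nat \<Rightarrow> real) \<Rightarrow> bool" where
  "has_fourier_coeffs f a \<longleftrightarrow>
     (\<forall>\<tau>. Im \<tau> > 0 \<longrightarrow>
        (\<lambda>n. of_real (a (Suc n)) * exp (2 * of_real pi * \<i> * of_nat (Suc n) * \<tau>)) sums f \<tau>)"

definition entire_ext_twisted_L ::
    "nat \<Rightarrow> (nat \<Rightarrow> real) \<Rightarrow> real \<Rightarrow> (complex \<Rightarrow> complex) \<Rightarrow> bool" where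
  "entire_ext_twisted_L k a x g \<longleftrightarrow>
     g holomorphic_on UNIV \<and>
     (\<forall>s. Re s > (real k + 1) / 2 \<longrightarrow>
        (\<lambda>n. of_real (a (Suc n)) * exp (2 * of_real pi * \<i> * of_nat (Suc n) * of_real x)
               / of_nat (Suc n) powr s) sums g s)"

lemma entire_ext_twisted_L_unique:
  assumes "entire_ext_twisted_L k a x g" "entire_ext_twisted_L k a x h"
  shows "g = h"
proof
  fix w :: complex
  define S where "S = {s :: complex. (real k + 1) / 2 < Re s}"
  have hol: "g holomorphic_on UNIV" "h holomorphic_on UNIV"
    using assms by (simp_all only: entire_ext_twisted_L_def)
  have eq: "g s = h s" if "s \<in> S" for s
  proof (rule sums_unique2)
    have Re_s: "(real k + 1) / 2 < Re s"
      using that by (simp only: S_def mem_Collect_eq)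
    show "(\<lambda>n. of_real (a (Suc n)) * exp (2 * of_real pi * \<i> * of_nat (Suc n) * of_real x)
             / of_nat (Suc n) powr s) sums g s"
      using assms(1) Re_s unfolding entire_ext_twisted_L_def by iprover
    show "(\<lambda>n. of_real (a (Suc n)) * exp (2 * of_real pi * \<i> * of_nat (Suc n) * of_real x)
             / of_nat (Suc n) powr s) sums h s"
      using assms(2) Re_s unfolding entire_ext_twisted_L_def by iprover
  qed
  have "open S" unfolding S_def by (rule open_halfspace_Re_gt)
  moreover have "S \<noteq> {}"
  proof -
    have "of_real ((real k + 1) / 2 + 1) \<in> S"
      unfolding S_def mem_Collect_eq Re_complex_of_real by linarith
    then show ?thesis by blast
  qed
  ultimately show "g w = h w"
    by (rule analytic_continuation_open[OF _ open_UNIV _ connected_UNIV subset_UNIV hol eq UNIV_I])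
qed

(* L_f(s, x), with f given by its Fourier coefficients; the description is unique by
   the preceding lemma, and the extension exists for cusp forms and rational x (Wilton). *)
definition twisted_L :: "nat \<Rightarrow> (nat \<Rightarrow> real) \<Rightarrow> complex \<Rightarrow> real \<Rightarrow> complex" where
  "twisted_L k a s x = (THE g. entire_ext_twisted_L k a x g) s"

definition kummer_1F1 :: "complex \<Rightarrow> complex \<Rightarrow> complex \<Rightarrow> complex" where
  "kummer_1F1 a b z = (\<Sum>n. pochhammer a n / pochhammer b n * z ^ n / fact n)"

definition domain_D :: "int \<Rightarrow> complex set" where
  "domain_D q = {z. \<bar>Re z\<bar> < 2 * sqrt (pi / of_int q) \<and> \<bar>Im z\<bar> < 2 * sqrt (pi / of_int q)}"

end

theory Submission
  imports Defs "HOL-Probability.Characteristic_Functions"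
begin

text \<open>
  Put $F(x) = f(p/q + ix/q)$. Its Mellin transform \<open>Lam\<close> is entire and equals
  $(2\pi/q)^{-s}\Gamma(s)L_f(s,p/q)$, and because $p^2 \equiv 1$ modulo $q$ the modular relation
  $x \mapsto 1/x$ makes \<open>Lam\<close> real up to a constant on the critical line. With $w = z^2/4$, multiplying
  by ${}_1F_1(k-s;k;w)$ amounts to averaging $F$ over a contour, so the two-sided Laplace transform of
  the product along the line is the contour integral of
  $e^u (u-w)^{-k} F(e^{i\xi} u/(u-w))$. As $\xi$ tends to $\pm\pi/2$ the argument of $F$ tends to
  $\pm i$, that is, to a rational cusp of $f$; the contour can be chosen through the saddle point, and
  for $|w| + |\mathrm{Re}\, w| < 2\pi/q$, which is what the domain of $z$ says, the decay of $f$ wins, so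
  the transform is exponentially flat at both ends. Bounded vertical shifts multiply the transform by
  a bounded factor, so the flatness passes to the whole series.

  Hence all moments of the series against $e^{\pm(\pi/2-\epsilon)t}$ tend to 0. If the series had only
  finitely many zeros, it would have constant sign on each of two half-lines; choosing the parity of $n$
  so that both tails of the series times $t^n \cosh((\pi/2-\epsilon)t)$ have the same sign, the tails
  contribute at least $c(2T)^n$ while the middle contributes at most $CT^n$, a contradiction.
\<close>

section \<open>Integrals over the real line\<close>

text \<open>\<open>twisted_L\<close> is specified by its Dirichlet series on all of Re s > (k+1)/2,
  so convergence there has to be proved. The pointwise bound a(n) = O(n^(k/2)) reaches only Re s >
  k/2 + 1; hence the mean-square estimate for the coefficients.

  On the critical line the second Kummer function is the conjugate of the first, so that, up to a
  constant, every term is a real coefficient times a shift of one real function; only then is there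
  a sign to speak of.

  Flatness is asked for in a complex cone at the edge, not just along the real axis, because moments
  are read off circles of radius proportional to e; the resulting loss e^(-m) is harmless against
  exp(-c/e).

  The contour must grow as the edge is approached. Write the factor exp(i xi) as iota + delta with
  iota = i or -i, and v = delta u + iota w; the circle |v| = rho is fixed while u has size
  1/|delta|. Growth of e^u and decay of F then both have exponents of order 1/delta, and everything
  reduces to the sign of Re(v - iota w - N + N iota w / v) on that circle, where 2 pi / q is the
  smallest possible N.\<close>

lemma power_le_fact_mult_exp:
  fixes x :: real
  assumes "x \<ge> 0" shows "x ^ n \<le> fact n * exp x"
proof -
  have "(\<Sum>i\<in>{n}. x ^ i /\<^sub>R fact i) \<le> exp x"
    unfolding exp_def using assms by (intro sum_le_suminf summable_exp_generic) auto
  then show ?thesis by (simp add: field_simps)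
qed

lemma continuous_on_Times_slice:
  assumes "continuous_on (S \<times> T) (\<lambda>(z, v). g z v)"
  shows "z \<in> S \<Longrightarrow> continuous_on T (g z)" "v \<in> T \<Longrightarrow> continuous_on S (\<lambda>z. g z v)"
proof -
  show "continuous_on T (g z)" if "z \<in> S"
    using continuous_on_compose2[OF assms, of T "Pair z"] that
      continuous_on_Pair[OF continuous_on_const continuous_on_id, of T z] by auto
  show "continuous_on S (\<lambda>z. g z v)" if "v \<in> T"
    using continuous_on_compose2[OF assms, of S "\<lambda>z. (z, v)"] that
      continuous_on_Pair[OF continuous_on_id continuous_on_const, of S v] by auto
qed

text \<open>Integrals over the compact intervals [-n, n] are holomorphic by the Leibniz rule, and
  the tails of the majorant make them converge locally uniformly. A majorant of \<open>g\<close>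
  suffices, since locally uniform limits of holomorphic functions are holomorphic.\<close>

lemma holomorphic_on_lborel_integral:
  fixes g g' :: "complex \<Rightarrow> real \<Rightarrow> complex"
  assumes S: "open S" "convex S"
    and cont: "continuous_on (S \<times> UNIV) (\<lambda>(z, v). g z v)"
    and cont': "continuous_on (S \<times> UNIV) (\<lambda>(z, v). g' z v)"
    and der: "\<And>z v. z \<in> S \<Longrightarrow> ((\<lambda>z. g z v) has_field_derivative g' z v) (at z)"
    and dom: "\<And>z0. z0 \<in> S \<Longrightarrow> \<exists>d>0. cball z0 d \<subseteq> S \<and>
      (\<exists>M. integrable lborel M \<and> (\<forall>z\<in>cball z0 d. \<forall>v. norm (g z v) \<le> M v))"
  shows "(\<lambda>z. LBINT v. g z v) holomorphic_on S"
proof (rule holomorphic_uniform_sequence[OF S(1)])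
  have slice: "continuous_on UNIV (g z)" if "z \<in> S" for z
    using continuous_on_Times_slice(1)[OF cont that] .
  fix n :: nat
  show "(\<lambda>z. integral (cbox (- real n) (real n)) (g z)) holomorphic_on S"
  proof (rule leibniz_rule_holomorphic[where fx = g'])
    show "continuous_on (S \<times> cbox (- real n) (real n)) (\<lambda>(x, t). g' x t)"
      by (rule continuous_on_subset[OF cont']) auto
    show "g z integrable_on cbox (- real n) (real n)" if "z \<in> S" for z
      using slice[OF that] continuous_on_subset by (blast intro: integrable_continuous)
    show "((\<lambda>z. g z v) has_field_derivative g' z v) (at z within S)" if "z \<in> S" for z v
      using der[OF that] by (rule has_field_derivative_at_within)
  qed (rule S)
next
  have slice: "continuous_on UNIV (g z)" if "z \<in> S" for z
    using continuous_on_Times_slice(1)[OF cont that] .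
  fix z0 assume "z0 \<in> S"
  then obtain d M where d: "d > 0" "cball z0 d \<subseteq> S" and M: "integrable lborel M"
    "\<And>z v. z \<in> cball z0 d \<Longrightarrow> norm (g z v) \<le> M v"
    using dom by meson
  have M0: "M v \<ge> 0" for v
    using order_trans[OF norm_ge_zero M(2)[of z0 v]] d(1) by simp
  \<comment> \<open>The tail of the majorant: it bounds the truncation error for all
    \<open>z\<close> in the ball at once and tends to 0 by dominated convergence.\<close>
  define R where "R n = (LBINT v. indicator (- {- real n..real n}) v * M v)" for n :: nat
  have R: "R \<longlonglongrightarrow> (LBINT v::real. 0)" unfolding R_def
  proof (rule integral_dominated_convergence[where w = M])
    show "AE v in lborel. (\<lambda>n. indicat_real (- {- real n..real n}) v * M v) \<longlonglongrightarrow> 0"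
    proof (rule AE_I2)
      fix v :: real
      have "eventually (\<lambda>n. indicat_real (- {- real n..real n}) v * M v = 0) sequentially"
        using eventually_ge_at_top[of "nat \<lceil>\<bar>v\<bar>\<rceil>"]
      proof eventually_elim
        case (elim n)
        then have "\<bar>v\<bar> \<le> real n" by linarith
        then show ?case by (auto simp: indicator_def)
      qed
      then show "(\<lambda>n. indicat_real (- {- real n..real n}) v * M v) \<longlonglongrightarrow> 0"
        by (rule tendsto_eventually)
    qed
  qed (use M M0 in \<open>auto simp: indicator_def\<close>)
  have gint: "integrable lborel (g z)" if "z \<in> cball z0 d" for z
    by (rule Bochner_Integration.integrable_bound[OF M(1)])
       (use M(2)[OF that] slice[of z] that d M0 in \<open>auto intro!: borel_measurable_continuous_onI\<close>)
  have le: "dist (integral (cbox (- real n) (real n)) (g z)) (LBINT v. g z v) \<le> R n"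
    if z: "z \<in> cball z0 d" for z n
  proof -
    have "integral (cbox (- real n) (real n)) (g z) = (LBINT v:{- real n..real n}. g z v)"
      by (subst set_borel_integral_eq_integral)
         (simp_all add: set_integrable_def integrable_mult_indicator gint[OF z])
    also have "\<dots> = (LBINT v. g z v) - (LBINT v. indicator (- {- real n..real n}) v *\<^sub>R g z v)"
    proof -
      have "(LBINT v. g z v) = (LBINT v. indicator {- real n..real n} v *\<^sub>R g z v + indicator (- {- real n..real n}) v *\<^sub>R g z v)"
        by (rule Bochner_Integration.integral_cong) (auto simp: indicator_def)
      also have "\<dots> = (LBINT v. indicator {- real n..real n} v *\<^sub>R g z v) + (LBINT v. indicator (- {- real n..real n}) v *\<^sub>R g z v)"
        by (rule Bochner_Integration.integral_add) (auto intro!: integrable_mult_indicator gint z)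
      finally show ?thesis by (simp add: set_lebesgue_integral_def)
    qed
    finally have "dist (integral (cbox (- real n) (real n)) (g z)) (LBINT v. g z v)
        = norm (LBINT v. indicator (- {- real n..real n}) v *\<^sub>R g z v)"
      by (simp add: dist_norm)
    also have "\<dots> \<le> (LBINT v. norm (indicator (- {- real n..real n}) v *\<^sub>R g z v))"
      by (rule integral_norm_bound)
    also have "\<dots> \<le> R n" unfolding R_def
    proof (rule integral_mono)
      show "integrable lborel (\<lambda>v. norm (indicator (- {- real n..real n}) v *\<^sub>R g z v))"
        by (intro integrable_norm integrable_mult_indicator gint z) simp
      show "integrable lborel (\<lambda>v. indicator (- {- real n..real n}) v * M v)"
        using integrable_mult_indicator[OF _ M(1), of "- {- real n..real n}"] by simp
      show "norm (indicator (- {- real n..real n}) v *\<^sub>R g z v) \<le> indicator (- {- real n..real n}) v * M v" for v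
        using M(2)[OF z, of v] by (simp add: indicator_def)
    qed
    finally show ?thesis .
  qed
  have "R \<longlonglongrightarrow> 0" using R by simp
  then have "uniform_limit (cball z0 d) (\<lambda>n z. integral (cbox (- real n) (real n)) (g z)) (\<lambda>z. LBINT v. g z v) sequentially"
    unfolding uniform_limit_iff
  proof (intro allI impI)
    fix e :: real assume "e > 0"
    then have "eventually (\<lambda>n. R n < e) sequentially"
      using \<open>R \<longlonglongrightarrow> 0\<close> order_tendstoD(2) by blast
    then show "\<forall>\<^sub>F n in sequentially. \<forall>z\<in>cball z0 d. dist (integral (cbox (- real n) (real n)) (g z)) (LBINT v. g z v) < e"
      by eventually_elim (use le in \<open>blast intro: order_le_less_trans\<close>)
  qed
  then show "\<exists>d>0. cball z0 d \<subseteq> S \<and> uniform_limit (cball z0 d) (\<lambda>n z. integral (cbox (- real n) (real n)) (g z)) (\<lambda>z. LBINT v. g z v) sequentially"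
    using d by blast
qed

text \<open>Interchanges a contour parameter, integrated in the gauge sense over the unit interval,
  with a Lebesgue integral over the line. Cutting \<open>g\<close> off outside the interval turns
  both into integrals for \<open>lborel\<close>, where Fubini applies.\<close>

lemma lborel_integral_swap_unit_interval:
  fixes g :: "real \<Rightarrow> real \<Rightarrow> complex"
  assumes cont: "continuous_on ({0..1} \<times> UNIV) (\<lambda>(u, t). g u t)"
    and bound: "\<And>u t. u \<in> {0..1} \<Longrightarrow> norm (g u t) \<le> M t"
    and M: "integrable lborel M"
  shows "(LBINT t. integral {0..1} (\<lambda>u. g u t)) = integral {0..1} (\<lambda>u. LBINT t. g u t)"
proof -
  define h where "h u t = indicator {0..1} u *\<^sub>R g u t" for u t :: real
  have M0: "M t \<ge> 0" for t using order_trans[OF norm_ge_zero bound[of 0 t]] by simp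
  have meas: "(\<lambda>(u, t). h u t) \<in> borel_measurable (lborel \<Otimes>\<^sub>M lborel)"
  proof -
    have "(\<lambda>x. indicator ({0..1} \<times> UNIV) x *\<^sub>R (case x of (u, t) \<Rightarrow> g u t)) \<in> borel_measurable borel"
      by (rule borel_measurable_continuous_on_indicator[OF _ cont]) (auto intro!: closed_Times borel_closed)
    also have "(\<lambda>x. indicator ({0..1} \<times> UNIV) x *\<^sub>R (case x of (u, t) \<Rightarrow> g u t)) = (\<lambda>(u, t). h u t)"
      by (auto simp: h_def indicator_def fun_eq_iff)
    finally show ?thesis by (simp add: lborel_prod)
  qed
  have hint: "integrable lborel (\<lambda>t. h u t)" for u
  proof (cases "u \<in> {0..1}")
    case True
    have "continuous_on UNIV (g u)"
      by (rule continuous_on_Times_slice(1)[OF cont True])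
    then show ?thesis using True
      by (intro Bochner_Integration.integrable_bound[OF M])
         (auto simp: h_def M0 bound intro!: borel_measurable_continuous_onI)
  qed (auto simp: h_def)
  have "integrable (lborel \<Otimes>\<^sub>M lborel) (\<lambda>(u, t). h u t)"
  proof (rule lborel_pair.Fubini_integrable[OF meas])
    have "(\<lambda>x. LBINT y. norm (case (x, y) of (u, t) \<Rightarrow> h u t)) \<in> borel_measurable lborel"
      using meas by measurable
    then show "integrable lborel (\<lambda>x. LBINT y. norm (case (x, y) of (u, t) \<Rightarrow> h u t))"
    proof (rule Bochner_Integration.integrable_bound[rotated])
      show "integrable lborel (\<lambda>u. indicator {0..1::real} u *\<^sub>R (LBINT t. M t))"
        by simp
      show "AE x in lborel. norm (LBINT y. norm (case (x, y) of (u, t) \<Rightarrow> h u t))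
              \<le> norm (indicat_real {0..1} x *\<^sub>R integral\<^sup>L lborel M)"
      proof (rule AE_I2)
        fix x :: real
        have "(LBINT y. norm (h x y)) \<le> indicat_real {0..1} x * integral\<^sup>L lborel M"
        proof (cases "x \<in> {0..1}")
          case True
          then show ?thesis using hint[of x] M bound
            by (auto simp: h_def intro!: integral_mono)
        qed (auto simp: h_def)
        moreover have "0 \<le> (LBINT y. norm (h x y))" by simp
        ultimately show "norm (LBINT y. norm (case (x, y) of (u, t) \<Rightarrow> h u t))
              \<le> norm (indicat_real {0..1} x *\<^sub>R integral\<^sup>L lborel M)" by simp
      qed
    qed
  qed (auto intro: hint)
  from lborel_pair.Fubini_integral[OF this]
  have eq: "(LBINT t. LBINT u. h u t) = (LBINT u. LBINT t. h u t)" .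
  have "(LBINT u. h u t) = integral {0..1} (\<lambda>u. g u t)" for t
  proof -
    have "continuous_on {0..1} (\<lambda>u. g u t)"
      by (rule continuous_on_Times_slice(2)[OF cont]) simp
    then have "set_integrable lborel {0..1} (\<lambda>u. g u t)"
      by (rule borel_integrable_atLeastAtMost')
    from set_borel_integral_eq_integral(2)[OF this] show ?thesis
      by (simp add: h_def set_lebesgue_integral_def)
  qed
  moreover have "(LBINT u. LBINT t. h u t) = integral {0..1} (\<lambda>u. LBINT t. g u t)"
  proof -
    \<comment> \<open>Continuity in the parameter, from dominated convergence, allows the outer
      Lebesgue integral to be read as a gauge integral again.\<close>
    have "continuous_on {0..1} (\<lambda>u. LBINT t. g u t)"
      unfolding continuous_on_sequentially o_def
    proof (intro allI ballI impI)
      fix x a assume a: "a \<in> {0..1::real}" and x: "(\<forall>n::nat. x n \<in> {0..1}) \<and> x \<longlonglongrightarrow> a"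
      have m: "g u \<in> borel_measurable borel" if "u \<in> {0..1}" for u
        by (intro borel_measurable_continuous_onI continuous_on_Times_slice(1)[OF cont] that)
      show "(\<lambda>n. LBINT t. g (x n) t) \<longlonglongrightarrow> (LBINT t. g a t)"
      proof (rule integral_dominated_convergence[where w = M])
        show "AE t in lborel. (\<lambda>i. g (x i) t) \<longlonglongrightarrow> g a t"
        proof (rule AE_I2)
          fix t :: real
          have "continuous_on {0..1} (\<lambda>u. g u t)"
            by (rule continuous_on_Times_slice(2)[OF cont]) simp
          then show "(\<lambda>i. g (x i) t) \<longlonglongrightarrow> g a t"
            using a x unfolding continuous_on_sequentially o_def by blast
        qed
      qed (use m a x M bound in auto)
    qed
    then have "set_integrable lborel {0..1} (\<lambda>u. LBINT t. g u t)"
      by (rule borel_integrable_atLeastAtMost')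
    from set_borel_integral_eq_integral(2)[OF this] show ?thesis
      by (simp add: h_def set_lebesgue_integral_def)
  qed
  ultimately show ?thesis using eq by simp
qed

text \<open>Gauss summation: \<open>H\<close> is damped by exp(-(e t)^2/2), the integrals are
  swapped, and since the Gaussian is its own Fourier transform the result is an average of
  \<open>h\<close> against a normal density of width e. Both sides converge as e tends to 0.\<close>

lemma fourier_inversion_at_zero:
  fixes h H :: "real \<Rightarrow> complex"
  assumes cont: "continuous_on UNIV h" and h: "integrable lborel h"
    and bdd: "\<And>v. norm (h v) \<le> C"
    and H_def: "\<And>t. H t = (LBINT v. h v * exp (\<i> * of_real (t * v)))"
    and H: "integrable lborel H"
  shows "(LBINT t. H t) = of_real (2 * pi) * h 0"
proof -
  let ?\<phi> = std_normal_density
  have gauss: "(LBINT u. of_real (?\<phi> u) * exp (\<i> * of_real (t * u))) = of_real (exp (- t\<^sup>2 / 2))" for t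
  proof -
    have "(LBINT u. of_real (?\<phi> u) * exp (\<i> * of_real (t * u))) = char std_normal_distribution t"
      unfolding char_def by (subst integral_density) (auto simp: scaleR_conv_of_real)
    then show ?thesis by (simp add: char_std_normal_distribution)
  qed
  have hm: "h \<in> borel_measurable borel" using cont by (rule borel_measurable_continuous_onI)
  have phi_int: "integrable lborel ?\<phi>" using integrable_normal_density[of 1 0] by simp
  have exp1: "norm (exp (\<i> * of_real x)) = 1" for x :: real by simp
  have step: "(LBINT t. H t * of_real (exp (- (e * t)\<^sup>2 / 2))) = of_real (2 * pi) * (LBINT u. h (e * u) * of_real (?\<phi> u))"
    if e: "e > 0" for e :: real
  proof -
    \<comment> \<open>One factor \<open>c\<close> turns the Gaussian weight into the normal density,
      and a second appears when its transform is again written as a density; together they are the 2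
      pi of the inversion formula.\<close>
    define c where "c = sqrt (2 * pi)"
    have c: "c > 0" "c * c = 2 * pi" by (auto simp: c_def)
    have exp_phi: "exp (- x\<^sup>2 / 2) = c * ?\<phi> x" for x
      by (simp add: normal_density_def c_def)
    have "(LBINT t. H t * of_real (exp (- (e * t)\<^sup>2 / 2)))
        = (LBINT t. LBINT v. h v * exp (\<i> * of_real (t * v)) * of_real (c * ?\<phi> (e * t)))"
      unfolding H_def exp_phi by simp
    also have "\<dots> = (LBINT v. LBINT t. h v * exp (\<i> * of_real (t * v)) * of_real (c * ?\<phi> (e * t)))"
    proof (rule lborel_pair.Fubini_integral)
      show "complex_integrable (lborel \<Otimes>\<^sub>M lborel) (\<lambda>(x, y). h x * exp (\<i> * complex_of_real (y * x)) * complex_of_real (c * ?\<phi> (e * y)))"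
      proof (rule lborel_pair.Fubini_integrable)
        have n: "norm (h x * exp (\<i> * complex_of_real (y * x)) * complex_of_real (c * ?\<phi> (e * y)))
            = norm (h x) * (c * ?\<phi> (e * y))" for x y
          using c(1) exp1[of "y * x"] by (simp add: norm_mult)
        show "(\<lambda>(x, y). h x * exp (\<i> * complex_of_real (y * x)) * complex_of_real (c * ?\<phi> (e * y))) \<in> borel_measurable (lborel \<Otimes>\<^sub>M lborel)"
          using hm by measurable
        show "integrable lborel (\<lambda>x. LBINT y. norm (case (x, y) of (x, y) \<Rightarrow> h x * exp (\<i> * complex_of_real (y * x)) * complex_of_real (c * ?\<phi> (e * y))))"
          using h by (simp only: prod.case n) simp
        have "integrable lborel (\<lambda>y. ?\<phi> (e * y))"
          using lborel_integrable_real_affine[OF phi_int, of e 0] e by simp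
        then have b: "integrable lborel (\<lambda>y. norm (h x) * (c * ?\<phi> (e * y)))" for x
          by (intro integrable_mult_right)
        show "AE x in lborel. complex_integrable lborel (\<lambda>y. case (x, y) of (x, y) \<Rightarrow> h x * exp (\<i> * complex_of_real (y * x)) * complex_of_real (c * ?\<phi> (e * y)))"
          unfolding prod.case
        proof (intro AE_I2 Bochner_Integration.integrable_bound[OF b])
          fix x y
          show "norm (h x * exp (\<i> * complex_of_real (y * x)) * complex_of_real (c * ?\<phi> (e * y))) \<le> norm (norm (h x) * (c * ?\<phi> (e * y)))"
            unfolding n by simp
        qed measurable
      qed
    qed
    also have "\<dots> = (LBINT v. h v * of_real (c / e * exp (- (v / e)\<^sup>2 / 2)))"
    proof (rule Bochner_Integration.integral_cong)
      fix v :: real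
      have "(LBINT t. h v * exp (\<i> * of_real (t * v)) * of_real (c * ?\<phi> (e * t)))
          = (LBINT t. (h v * of_real c) * (of_real (?\<phi> (e * t)) * exp (\<i> * of_real (v / e * (e * t)))))"
      proof (rule Bochner_Integration.integral_cong)
        fix t
        have "v / e * (e * t) = t * v" using e by simp
        then show "h v * exp (\<i> * of_real (t * v)) * of_real (c * ?\<phi> (e * t))
          = (h v * of_real c) * (of_real (?\<phi> (e * t)) * exp (\<i> * of_real (v / e * (e * t))))"
          by (simp only: of_real_mult mult_ac)
      qed simp
      also have "\<dots> = h v * of_real c * (LBINT t. of_real (?\<phi> (e * t)) * exp (\<i> * of_real (v / e * (e * t))))"
        by (rule integral_mult_right_zero)
      also have "(LBINT t. of_real (?\<phi> (e * t)) * exp (\<i> * of_real (v / e * (e * t))))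
          = of_real (1 / e) * (LBINT u. of_real (?\<phi> u) * exp (\<i> * of_real (v / e * u)))"
        using e lborel_integral_real_affine[of e "\<lambda>u. of_real (?\<phi> u) * exp (\<i> * of_real (v / e * u)) :: complex" 0]
        by (simp only: add_0) (simp add: scaleR_conv_of_real)
      finally show "(LBINT t. h v * exp (\<i> * of_real (t * v)) * of_real (c * ?\<phi> (e * t)))
          = h v * of_real (c / e * exp (- (v / e)\<^sup>2 / 2))"
        unfolding gauss by simp
    qed simp
    also have "\<dots> = \<bar>e\<bar> *\<^sub>R (LBINT u. h (0 + e * u) * of_real (c / e * exp (- ((0 + e * u) / e)\<^sup>2 / 2)))"
      using e by (intro lborel_integral_real_affine) simp
    also have "\<dots> = (LBINT u. of_real (2 * pi) * (h (e * u) * of_real (?\<phi> u)))"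
    proof -
      have "e * (c / e * exp (- ((0 + e * u) / e)\<^sup>2 / 2)) = 2 * pi * ?\<phi> u" for u
      proof -
        have "(0 + e * u) / e = u" "e * (c / e * x) = c * x" for x using e by simp_all
        then show ?thesis unfolding exp_phi using c(2) e by (simp flip: mult.assoc)
      qed
      then have *: "of_real e * of_real (c / e * exp (- ((0 + e * u) / e)\<^sup>2 / 2)) = of_real (2 * pi) * (of_real (?\<phi> u) :: complex)" for u
        unfolding of_real_mult[symmetric] by (rule arg_cong)
      have "\<bar>e\<bar> *\<^sub>R (h (0 + e * u) * of_real (c / e * exp (- ((0 + e * u) / e)\<^sup>2 / 2))) = of_real (2 * pi) * (h (e * u) * of_real (?\<phi> u))" for u
      proof -
        have "\<bar>e\<bar> *\<^sub>R (h (0 + e * u) * of_real (c / e * exp (- ((0 + e * u) / e)\<^sup>2 / 2)))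
            = h (e * u) * (of_real e * of_real (c / e * exp (- ((0 + e * u) / e)\<^sup>2 / 2)))"
          using e by (simp add: scaleR_conv_of_real del: times_divide_eq_left times_divide_eq_right)
        then show ?thesis unfolding * by (simp only: mult_ac)
      qed
      then show ?thesis by (simp only: flip: integral_scaleR_right)
    qed
    also have "\<dots> = of_real (2 * pi) * (LBINT u. h (e * u) * of_real (?\<phi> u))"
      by simp
    finally show ?thesis .
  qed
  define e where "e n = 1 / (real (Suc n))" for n
  have e0: "e \<longlonglongrightarrow> 0" unfolding e_def using LIMSEQ_inverse_real_of_nat by (simp add: inverse_eq_divide)
  have lim1: "(\<lambda>n. LBINT t. H t * of_real (exp (- (e n * t)\<^sup>2 / 2))) \<longlonglongrightarrow> (LBINT t. H t)"
  proof (rule integral_dominated_convergence[where w = "\<lambda>t. norm (H t)"])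
    have "(\<lambda>n. H t * of_real (exp (- (e n * t)\<^sup>2 / 2))) \<longlonglongrightarrow> H t * of_real (exp (- (0 * t)\<^sup>2 / 2))" for t
      by (intro tendsto_intros e0) simp_all
    then show "AE t in lborel. (\<lambda>n. H t * of_real (exp (- (e n * t)\<^sup>2 / 2))) \<longlonglongrightarrow> H t" by simp
    show "AE t in lborel. norm (H t * of_real (exp (- (e n * t)\<^sup>2 / 2))) \<le> norm (H t)" for n
      by (auto simp: norm_mult intro!: AE_I2 mult_right_le_one_le)
  qed (use H in auto)
  have lim2: "(\<lambda>n. of_real (2 * pi) * (LBINT u. h (e n * u) * of_real (?\<phi> u))) \<longlonglongrightarrow> of_real (2 * pi) * (LBINT u. h 0 * of_real (?\<phi> u))"
  proof (intro tendsto_intros integral_dominated_convergence[where w = "\<lambda>u. C * ?\<phi> u"])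
    show "AE u in lborel. (\<lambda>n. h (e n * u) * of_real (?\<phi> u)) \<longlonglongrightarrow> h 0 * of_real (?\<phi> u)"
    proof (rule AE_I2)
      fix u :: real
      have "(\<lambda>n. e n * u) \<longlonglongrightarrow> 0 * u" by (intro tendsto_intros e0)
      then have "(\<lambda>n. h (e n * u)) \<longlonglongrightarrow> h 0"
        using continuous_on_tendsto_compose[OF cont, of "\<lambda>n. e n * u" 0 sequentially] by simp
      then show "(\<lambda>n. h (e n * u) * of_real (?\<phi> u)) \<longlonglongrightarrow> h 0 * of_real (?\<phi> u)"
        by (intro tendsto_intros)
    qed
    show "AE u in lborel. norm (h (e n * u) * of_real (?\<phi> u)) \<le> C * ?\<phi> u" for n
      using bdd by (intro AE_I2) (simp add: norm_mult mult_right_mono)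
  qed (use hm phi_int in simp_all)
  have "(LBINT u. h 0 * of_real (?\<phi> u)) = h 0"
    using gauss[of 0] by simp
  with lim2 have "(\<lambda>n. of_real (2 * pi) * (LBINT u. h (e n * u) * of_real (?\<phi> u))) \<longlonglongrightarrow> of_real (2 * pi) * h 0" by simp
  moreover have "(\<lambda>n. of_real (2 * pi) * (LBINT u. h (e n * u) * of_real (?\<phi> u))) \<longlonglongrightarrow> (LBINT t. H t)"
    using lim1 step[of "e _"] by (simp add: e_def)
  ultimately show ?thesis using LIMSEQ_unique by blast
qed

section \<open>Zeros of functions with exponentially flat Laplace transform\<close>

text \<open>Adding the two moments gives the even weight 2 cosh(x t). It is at least 2 on the tails
  and at most 2 cosh(pi T/2) on [-T, T], both uniformly in e, so the limit e to 0 can be taken in an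
  inequality whose bounds do not depend on e.\<close>

lemma infinitely_many_zeros_if_moments_vanish:
  fixes A :: "real \<Rightarrow> real"
  assumes cont: "continuous_on UNIV A"
    and int: "\<And>m x. \<bar>x\<bar> < pi / 2 \<Longrightarrow> integrable lborel (\<lambda>t. A t * t ^ m * exp (x * t))"
    and lim: "\<And>m. ((\<lambda>e. LBINT t. A t * t ^ m * exp ((pi / 2 - e) * t)) \<longlongrightarrow> 0) (at_right 0)"
    and lim': "\<And>m. ((\<lambda>e. LBINT t. A t * t ^ m * exp (- (pi / 2 - e) * t)) \<longlongrightarrow> 0) (at_right 0)"
  shows "infinite {t. A t = 0}"
proof
  assume "finite {t. A t = 0}"
  then have "bounded {t. A t = 0}" by (rule finite_imp_bounded)
  then obtain T0 where T0: "\<And>t. A t = 0 \<Longrightarrow> \<bar>t\<bar> \<le> T0" by (auto simp: bounded_iff)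
  define T where "T = \<bar>T0\<bar> + 1"
  have T: "T > 0" "\<And>t. \<bar>t\<bar> \<ge> T \<Longrightarrow> A t \<noteq> 0"
    using T0 unfolding T_def by fastforce+
  have no_change: "A x * A y > 0" if "{x..y} \<inter> {t. A t = 0} = {}" and xy: "x \<le> y" for x y
  proof (rule ccontr)
    assume "\<not> A x * A y > 0"
    then have "A x \<le> 0 \<and> 0 \<le> A y \<or> A y \<le> 0 \<and> 0 \<le> A x"
      by (simp add: not_less mult_le_0_iff) argo
    moreover have "continuous_on {x..y} A" using cont continuous_on_subset by blast
    ultimately obtain t where "t \<in> {x..y}" "A t = 0"
      using IVT'[of A x 0 y] IVT2'[of A y 0 x] xy by auto
    with that show False by blast
  qed
  have right: "A T * A t > 0" if "t \<ge> T" for t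
    by (rule no_change) (use T that in \<open>auto dest: T(2)\<close>)
  have left: "A (- T) * A t > 0" if "t \<le> - T" for t
    proof -
    have "0 < A t * A (- T)" using T that by (intro no_change) (auto dest: T(2))
    then show ?thesis by (simp only: mult.commute)
  qed
  define s where "s = sgn (A T)"
  \<comment> \<open>Equal signs at both ends call for an even power of t, opposite signs for an odd
    one; with the sign \<open>s\<close> the integrand is then nonnegative on both tails.\<close>
  define j :: nat where "j = (if A T * A (- T) > 0 then 0 else 1)"
  have nz: "A T \<noteq> 0" "A (- T) \<noteq> 0" using T by auto
  have s1: "\<bar>s\<bar> = 1" using nz by (simp add: s_def sgn_if)
  have sA: "s * A t * t ^ (2 * m + j) = \<bar>A t\<bar> * \<bar>t\<bar> ^ (2 * m + j)" if t: "\<bar>t\<bar> \<ge> T" for t m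
  proof (cases "t \<ge> T")
    case True
    then show ?thesis using right[OF True] T(1)
      by (auto simp: s_def sgn_if zero_less_mult_iff abs_if)
  next
    case False
    with t have "t \<le> - T" by linarith
    from left[OF this] nz T(1) this show ?thesis
      by (auto simp: s_def j_def sgn_if zero_less_mult_iff abs_if power_mult)
  qed
  obtain t1 where t1: "t1 \<in> {2 * T..3 * T}" "\<And>t. t \<in> {2 * T..3 * T} \<Longrightarrow> \<bar>A t1\<bar> \<le> \<bar>A t\<bar>"
  proof -
    have "continuous_on {2 * T..3 * T} (\<lambda>t. \<bar>A t\<bar>)"
      by (intro continuous_intros continuous_on_subset[OF cont]) auto
    from continuous_attains_inf[OF compact_Icc _ this] show ?thesis using T(1) that by auto
  qed
  obtain t2 where t2: "\<And>t. t \<in> {-T..T} \<Longrightarrow> \<bar>A t\<bar> \<le> \<bar>A t2\<bar>"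
  proof -
    have "continuous_on {-T..T} (\<lambda>t. \<bar>A t\<bar>)"
      by (intro continuous_intros continuous_on_subset[OF cont]) auto
    from continuous_attains_sup[OF compact_Icc _ this] obtain t2 where "\<forall>t\<in>{-T..T}. \<bar>A t\<bar> \<le> \<bar>A t2\<bar>"
      using T(1) by auto
    then show ?thesis using that by blast
  qed
  define \<mu> where "\<mu> = \<bar>A t1\<bar>"
  have mu: "\<mu> > 0" using t1(1) T by (auto simp: \<mu>_def)
  define K where "K = \<bar>A t2\<bar> * cosh (pi / 2 * T)"
  \<comment> \<open>The interval [2T, 3T] of length T contributes at least 2 (2T)^n mu T, and
    [-T, T] of length 2T costs at most 2 T^n K 2T. The difference is at most the limit 0; dividing
    by 2 T T^n leaves the stated inequality.\<close>
  have key: "2 ^ (2 * m + j) * \<mu> \<le> 2 * K" for m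
  proof -
    define n where "n = 2 * m + j"
    define W where "W e = (LBINT t. A t * t ^ n * exp ((pi / 2 - e) * t)) + (LBINT t. A t * t ^ n * exp (- (pi / 2 - e) * t))" for e
    have "((\<lambda>e. s * W e) \<longlongrightarrow> s * (0 + 0)) (at_right 0)"
      unfolding W_def by (intro tendsto_intros lim lim')
    moreover have "eventually (\<lambda>e. 2 * (2 * T) ^ n * \<mu> * T - 2 * T ^ n * K * (2 * T) \<le> s * W e) (at_right 0)"
    proof -
      have "eventually (\<lambda>e::real. 0 < e \<and> e < pi / 2) (at_right 0)"
        using eventually_at_right_less[of 0] eventually_at_right_real[of 0 "pi/2"] by (auto elim: eventually_mono)
      then show ?thesis
      proof eventually_elim
        case (elim e)
        define x where "x = pi / 2 - e"
        have x: "\<bar>x\<bar> < pi / 2" "\<bar>- x\<bar> < pi / 2" "x \<ge> 0" using elim by (auto simp: x_def)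
        have "2 * (2 * T) ^ n * \<mu> * T - 2 * T ^ n * K * (2 * T)
           = (LBINT t. indicator {2 * T..3 * T} t * (2 * (2 * T) ^ n * \<mu>) - indicator {-T..T} t * (2 * T ^ n * K))"
          using T(1) by (subst Bochner_Integration.integral_diff) auto
        also have "\<dots> \<le> (LBINT t. s * (A t * t ^ n * exp (x * t) + A t * t ^ n * exp (- x * t)))"
        proof (rule integral_mono)
          fix t :: real
          have eq: "s * (A t * t ^ n * exp (x * t) + A t * t ^ n * exp (- x * t)) = s * A t * t ^ n * (2 * cosh (x * t))"
            by (simp add: cosh_def algebra_simps)
          have c1: "cosh (x * t) \<ge> 1" by (rule cosh_real_ge_1)
          show "indicator {2 * T..3 * T} t * (2 * (2 * T) ^ n * \<mu>) - indicator {-T..T} t * (2 * T ^ n * K)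
              \<le> s * (A t * t ^ n * exp (x * t) + A t * t ^ n * exp (- x * t))"
          proof (cases "t \<in> {-T..T}")
            case True
            have "\<bar>s * A t * t ^ n * (2 * cosh (x * t))\<bar> \<le> 1 * \<bar>A t2\<bar> * T ^ n * (2 * cosh (pi / 2 * T))"
              unfolding abs_mult power_abs s1
            proof (intro mult_mono)
              have "\<bar>x * t\<bar> \<le> pi / 2 * T"
                unfolding abs_mult using x(1) True by (intro mult_mono) auto
              then have "cosh \<bar>x * t\<bar> \<le> cosh (pi / 2 * T)"
                by (subst cosh_real_nonneg_le_iff) auto
              then show "\<bar>cosh (x * t)\<bar> \<le> cosh (pi / 2 * T)" by simp
              show "\<bar>t\<bar> ^ n \<le> T ^ n" using True by (intro power_mono) auto
            qed (use t2[OF True] T(1) in auto)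
            then show ?thesis unfolding eq using True T(1) by (auto simp: K_def indicator_def)
          next
            case False
            then have tT: "\<bar>t\<bar> \<ge> T" by auto
            have e2: "s * A t * t ^ n = \<bar>A t\<bar> * \<bar>t\<bar> ^ n" unfolding n_def by (rule sA[OF tT])
            show ?thesis
            proof (cases "t \<in> {2 * T..3 * T}")
              case True
              have "\<mu> * (2 * T) ^ n * (2 * 1) \<le> \<bar>A t\<bar> * \<bar>t\<bar> ^ n * (2 * cosh (x * t))"
                using True T(1) c1 mu t1(2)[OF True] unfolding \<mu>_def
                by (intro mult_mono power_mono) auto
              then show ?thesis unfolding eq e2 using True False by (simp add: mult_ac)
            next
              case F2: False
              have "0 \<le> \<bar>A t\<bar> * \<bar>t\<bar> ^ n * (2 * cosh (x * t))" using c1 by auto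
              then show ?thesis unfolding eq e2 using F2 False by simp
            qed
          qed
        next
          show "integrable lborel (\<lambda>t. indicator {2 * T..3 * T} t * (2 * (2 * T) ^ n * \<mu>) - indicator {-T..T} t * (2 * T ^ n * K))"
            by (intro Bochner_Integration.integrable_diff integrable_mult_left integrable_real_indicator) (auto simp: emeasure_lborel_Icc_eq)
          show "integrable lborel (\<lambda>t. s * (A t * t ^ n * exp (x * t) + A t * t ^ n * exp (- x * t)))"
            by (intro integrable_mult_right Bochner_Integration.integrable_add int x)
        qed
        also have "\<dots> = s * W e"
          unfolding W_def x_def[symmetric]
          by (subst Bochner_Integration.integral_add[symmetric]) (intro int x, intro int x, rule integral_mult_right_zero)
        finally show ?case .
      qed
    qed
    ultimately have "2 * (2 * T) ^ n * \<mu> * T - 2 * T ^ n * K * (2 * T) \<le> s * (0 + 0)"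
      by (rule tendsto_lowerbound) simp
    then have "(2 * T * T ^ n) * (2 ^ n * \<mu>) \<le> (2 * T * T ^ n) * (2 * K)"
      by (simp add: power_mult_distrib algebra_simps)
    moreover have "2 * T * T ^ n > 0" using T(1) by simp
    ultimately show ?thesis unfolding n_def by (simp only: mult_le_cancel_left_pos)
  qed
  obtain m :: nat where m: "2 * K / \<mu> < 2 ^ m"
    using real_arch_pow[of 2 "2 * K / \<mu>"] by auto
  have "2 ^ m * \<mu> \<le> 2 ^ (2 * m + j) * \<mu>" using mu by (intro mult_right_mono power_increasing) auto
  also have "\<dots> \<le> 2 * K" by (rule key)
  finally show False using m mu by (simp add: field_simps)
qed

section \<open>Laplace transforms of functions decaying at every rate below pi/2\<close>

definition exp_decay :: "(real \<Rightarrow> complex) \<Rightarrow> bool" where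
  "exp_decay A \<longleftrightarrow> continuous_on UNIV A \<and> (\<forall>\<theta><pi/2. \<exists>C. \<forall>t. norm (A t) \<le> C * exp (- \<theta> * \<bar>t\<bar>))"

definition laplace :: "(real \<Rightarrow> complex) \<Rightarrow> complex \<Rightarrow> complex" where
  "laplace A \<xi> = (LBINT t. A t * exp (\<xi> * of_real t))"

text \<open>The sign \<open>\<sigma>\<close> selects the edge of the strip |Re xi| < pi/2 on which
  the transform lives. The bound is required in a cone of slope \<open>\<kappa>\<close> so that it
  holds on small circles around real points near the edge, which is what Cauchy's formula
  uses.\<close>

definition flat_at_edge :: "(real \<Rightarrow> complex) \<Rightarrow> complex \<Rightarrow> bool" where
  "flat_at_edge A \<sigma> \<longleftrightarrow> (\<exists>\<kappa>>0. \<exists>\<epsilon>>0. \<exists>c>0. \<exists>C. \<forall>e. 0 < Re e \<and> \<bar>Im e\<bar> \<le> \<kappa> * Re e \<and> norm e < \<epsilon>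
     \<longrightarrow> norm (laplace A (\<sigma> * (of_real (pi / 2) - e))) \<le> C * exp (- c / norm e))"

lemma integrable_exp_neg_abs:
  assumes "c > 0" shows "integrable lborel (\<lambda>t::real. exp (- c * \<bar>t\<bar>))"
proof -
  have "set_integrable lebesgue {0..} (\<lambda>t::real. exp (- c * t))"
    using assms by (intro nonnegative_absolutely_integrable_1 integrable_on_exp_minus_to_infinity) auto
  then have 1: "integrable lborel (\<lambda>t::real. indicator {0..} t *\<^sub>R exp (- c * t))"
    unfolding set_integrable_def by (subst (asm) integrable_completion) measurable
  from lborel_integrable_real_affine[OF this, of "-1" 0]
  have 2: "integrable lborel (\<lambda>t::real. indicator {0..} (- t) *\<^sub>R exp (c * t))" by simp
  show ?thesis
    by (rule Bochner_Integration.integrable_bound[OF Bochner_Integration.integrable_add[OF 1 2]])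
       (auto simp: indicator_def)
qed

lemma exp_decay_integrable_norm:
  assumes "exp_decay A" "\<theta> < pi / 2"
  shows "integrable lborel (\<lambda>t. norm (A t) * \<bar>t\<bar> ^ m * exp (\<theta> * \<bar>t\<bar>))"
proof -
  \<comment> \<open>A third of the gap up to pi/2: \<open>A\<close> is taken to decay at rate theta
    + 2d, one d is spent on the power of |t|, and the other keeps the majorant integrable.\<close>
  define d where "d = (pi / 2 - \<theta>) / 3"
  have d: "d > 0" using assms(2) by (simp add: d_def)
  have "\<theta> + 2 * d < pi / 2" using d by (simp add: d_def field_simps)
  then obtain C where C: "\<And>t. norm (A t) \<le> C * exp (- (\<theta> + 2 * d) * \<bar>t\<bar>)"
    using assms(1) unfolding exp_decay_def by blast
  have "C \<ge> 0" using order_trans[OF norm_ge_zero C[of 0]] by simp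
  show ?thesis
  proof (rule Bochner_Integration.integrable_bound)
    show "integrable lborel (\<lambda>t. C * fact m / d ^ m * exp (- d * \<bar>t\<bar>))"
      by (intro integrable_mult_right integrable_exp_neg_abs d)
    show "(\<lambda>t. norm (A t) * \<bar>t\<bar> ^ m * exp (\<theta> * \<bar>t\<bar>)) \<in> borel_measurable lborel"
      using assms(1) unfolding exp_decay_def
      by (auto intro!: borel_measurable_continuous_onI continuous_intros)
    show "AE t in lborel. norm (norm (A t) * \<bar>t\<bar> ^ m * exp (\<theta> * \<bar>t\<bar>)) \<le> norm (C * fact m / d ^ m * exp (- d * \<bar>t\<bar>))"
    proof (rule AE_I2)
      fix t :: real
      have tm: "\<bar>t\<bar> ^ m \<le> fact m / d ^ m * exp (d * \<bar>t\<bar>)"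
        using power_le_fact_mult_exp[of "d * \<bar>t\<bar>" m] d by (simp add: power_mult_distrib field_simps)
      have "norm (norm (A t) * \<bar>t\<bar> ^ m * exp (\<theta> * \<bar>t\<bar>)) = norm (A t) * \<bar>t\<bar> ^ m * exp (\<theta> * \<bar>t\<bar>)"
        by simp
      also have "\<dots> \<le> (C * exp (- (\<theta> + 2 * d) * \<bar>t\<bar>)) * (fact m / d ^ m * exp (d * \<bar>t\<bar>)) * exp (\<theta> * \<bar>t\<bar>)"
        using C[of t] tm \<open>C \<ge> 0\<close> d by (intro mult_mono) auto
      also have "\<dots> = C * fact m / d ^ m * exp (- (\<theta> + 2 * d) * \<bar>t\<bar> + d * \<bar>t\<bar> + \<theta> * \<bar>t\<bar>)"
        by (simp add: exp_add)
      also have "- (\<theta> + 2 * d) * \<bar>t\<bar> + d * \<bar>t\<bar> + \<theta> * \<bar>t\<bar> = - d * \<bar>t\<bar>" by (simp add: algebra_simps)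
      finally show "norm (norm (A t) * \<bar>t\<bar> ^ m * exp (\<theta> * \<bar>t\<bar>)) \<le> norm (C * fact m / d ^ m * exp (- d * \<bar>t\<bar>))"
        using d \<open>C \<ge> 0\<close> by (simp add: abs_mult)
    qed
  qed
qed

lemma norm_exp_mult_of_real_le: "norm (exp (\<xi> * of_real t)) \<le> exp (\<bar>Re \<xi>\<bar> * \<bar>t\<bar>)"
proof -
  have "Re \<xi> * t \<le> \<bar>Re \<xi>\<bar> * \<bar>t\<bar>" by (metis abs_ge_self abs_mult)
  then show ?thesis by simp
qed

lemma exp_decay_integrable:
  assumes "exp_decay A" "\<bar>Re \<xi>\<bar> < pi / 2"
  shows "integrable lborel (\<lambda>t. A t * of_real t ^ m * exp (\<xi> * of_real t))"
proof (rule Bochner_Integration.integrable_bound[OF exp_decay_integrable_norm[OF assms]])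
  show "(\<lambda>t. A t * of_real t ^ m * exp (\<xi> * of_real t)) \<in> borel_measurable lborel"
    using assms(1) unfolding exp_decay_def
    by (auto intro!: borel_measurable_continuous_onI continuous_intros)
  show "AE t in lborel. norm (A t * of_real t ^ m * exp (\<xi> * of_real t)) \<le> norm (norm (A t) * \<bar>t\<bar> ^ m * exp (\<bar>Re \<xi>\<bar> * \<bar>t\<bar>))"
    using norm_exp_mult_of_real_le[of \<xi>]
    by (intro AE_I2) (auto simp: norm_mult norm_power intro!: mult_left_mono)
qed

lemma higher_deriv_exp_linear: "(deriv ^^ m) (\<lambda>z::complex. exp (z * c)) = (\<lambda>z. c ^ m * exp (z * c))"
proof (induction m)
  case (Suc m)
  have "deriv (\<lambda>z. c ^ m * exp (z * c)) z = c ^ Suc m * exp (z * c)" for z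
    by (rule DERIV_imp_deriv) (auto intro!: derivative_eq_intros)
  then show ?case by (auto simp: Suc)
qed simp

text \<open>A parametrized circle about 0 whose derivative is 2 pi i times itself; this is why
  \<open>circ r u\<close> occurs as a factor in all contour integrals written over the unit
  interval.\<close>

definition circ :: "real \<Rightarrow> real \<Rightarrow> complex" where
  "circ r u = of_real r * exp (2 * of_real pi * \<i> * of_real u)"

lemma norm_circ: "r \<ge> 0 \<Longrightarrow> norm (circ r u) = r"
  by (simp add: circ_def norm_mult)

lemma continuous_on_circ [continuous_intros]: "continuous_on S (circ r)"
  unfolding circ_def by (intro continuous_intros)

lemma has_integral_circ_iff:
  "((\<lambda>u. 2 * of_real pi * \<i> * (f (z + circ r u) * circ r u)) has_integral I) {0..1} \<longleftrightarrow>
    (f has_contour_integral I) (circlepath z r)"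
proof -
  have "f (circlepath z r u) * vector_derivative (circlepath z r) (at u within {0..1})
      = 2 * of_real pi * \<i> * (f (z + circ r u) * circ r u)" if "u \<in> {0..1}" for u
    using that vector_derivative_circlepath01[of u z r] by (simp add: circlepath circ_def)
  then show ?thesis unfolding has_contour_integral_def by (intro has_integral_cong) simp
qed

lemma contour_integral_circ:
  "contour_integral (circlepath z r) f = integral {0..1} (\<lambda>u. 2 * of_real pi * \<i> * (f (z + circ r u) * circ r u))"
proof -
  have "f (circlepath z r u) * vector_derivative (circlepath z r) (at u) = 2 * of_real pi * \<i> * (f (z + circ r u) * circ r u)" for u
    unfolding vector_derivative_circlepath by (simp only: circlepath circ_def mult_ac of_real_mult of_real_numeral)
  then show ?thesis unfolding contour_integral_integral by (simp only:)
qed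

text \<open>Cauchy's integral formula turns the moment into an average of the Laplace transform over a
  circle, so that no differentiation under the integral is needed.\<close>

lemma moment_eq_circle_average:
  assumes A: "exp_decay A" and r: "r > 0" "\<bar>Re \<alpha>\<bar> + r < pi / 2"
  shows "(LBINT t. A t * of_real t ^ m * exp (\<alpha> * of_real t))
    = fact m * integral {0..1} (\<lambda>u. laplace A (\<alpha> + circ r u) / circ r u ^ m)"
proof -
  have zr: "norm (circ r u) = r" for u using r by (simp add: norm_circ)
  then have z0: "circ r u \<noteq> 0" for u using r by (metis norm_zero less_irrefl)
  have pt: "of_real t ^ m * exp (\<alpha> * of_real t) = fact m * integral {0..1} (\<lambda>u. exp ((\<alpha> + circ r u) * of_real t) / circ r u ^ m)" for t :: real
  proof -
    have "((\<lambda>u. exp (u * of_real t) / (u - \<alpha>) ^ Suc m) has_contour_integral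
        (2 * pi * \<i>) / fact m * (deriv ^^ m) (\<lambda>z. exp (z * of_real t)) \<alpha>) (circlepath \<alpha> r)"
      using r by (intro Cauchy_has_contour_integral_higher_derivative_circlepath continuous_intros holomorphic_intros) auto
    then have "((\<lambda>x. 2 * pi * \<i> * (exp ((\<alpha> + circ r x) * of_real t) / circ r x ^ Suc m * circ r x))
       has_integral ((2 * pi * \<i>) / fact m * (of_real t ^ m * exp (\<alpha> * of_real t)))) {0..1}"
      unfolding has_integral_circ_iff[symmetric] higher_deriv_exp_linear by simp
    note has_integral_mult_right[OF this, of "fact m / (2 * pi * \<i>)"]
    also have "fact m / (2 * pi * \<i>) * ((2 * pi * \<i>) / fact m * (of_real t ^ m * exp (\<alpha> * of_real t))) = of_real t ^ m * exp (\<alpha> * of_real t)"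
      by simp
    finally have "((\<lambda>x. fact m * (exp ((\<alpha> + circ r x) * of_real t) / circ r x ^ m))
       has_integral of_real t ^ m * exp (\<alpha> * of_real t)) {0..1}"
    proof (rule has_integral_eq[rotated])
      show "fact m / (2 * pi * \<i>) * (2 * pi * \<i> * (exp ((\<alpha> + circ r x) * of_real t) / circ r x ^ Suc m * circ r x))
          = fact m * (exp ((\<alpha> + circ r x) * of_real t) / circ r x ^ m)" for x
        using z0[of x] by (simp add: divide_simps) (simp add: algebra_simps)
    qed
    then show ?thesis by (simp add: integral_unique flip: integral_mult_right)
  qed
  have Ac: "continuous_on UNIV A" using A by (simp add: exp_decay_def)
  have "(LBINT t. A t * of_real t ^ m * exp (\<alpha> * of_real t))
      = (LBINT t. fact m * integral {0..1} (\<lambda>u. A t * (exp ((\<alpha> + circ r u) * of_real t) / circ r u ^ m)))"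
  proof (rule Bochner_Integration.integral_cong)
    fix t :: real
    show "A t * of_real t ^ m * exp (\<alpha> * of_real t) = fact m * integral {0..1} (\<lambda>u. A t * (exp ((\<alpha> + circ r u) * of_real t) / circ r u ^ m))"
      unfolding Henstock_Kurzweil_Integration.integral_mult_right mult.assoc pt by (simp only: mult.left_commute)
  qed simp
  also have "\<dots> = fact m * (LBINT t. integral {0..1} (\<lambda>u. A t * (exp ((\<alpha> + circ r u) * of_real t) / circ r u ^ m)))"
    by simp
  also have "(LBINT t. integral {0..1} (\<lambda>u. A t * (exp ((\<alpha> + circ r u) * of_real t) / circ r u ^ m)))
      = integral {0..1} (\<lambda>u. LBINT t. A t * (exp ((\<alpha> + circ r u) * of_real t) / circ r u ^ m))"
  proof (rule lborel_integral_swap_unit_interval)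
    show "continuous_on ({0..1} \<times> UNIV) (\<lambda>(u, t). A t * (exp ((\<alpha> + circ r u) * of_real t) / circ r u ^ m))"
      unfolding case_prod_beta
      by (intro continuous_intros continuous_on_compose2[OF Ac]
           continuous_on_compose2[OF continuous_on_circ[of UNIV]]) (auto simp: z0)
    show "integrable lborel (\<lambda>t. norm (A t) * \<bar>t\<bar> ^ 0 * exp ((\<bar>Re \<alpha>\<bar> + r) * \<bar>t\<bar>) * (1 / r ^ m))"
      using exp_decay_integrable_norm[OF A r(2), of 0] by (rule integrable_mult_left)
    fix u t :: real
    have "\<bar>Re (\<alpha> + circ r u)\<bar> \<le> \<bar>Re \<alpha>\<bar> + r"
      using abs_Re_le_cmod[of "circ r u"] zr[of u] by simp
    then have "exp (\<bar>Re (\<alpha> + circ r u)\<bar> * \<bar>t\<bar>) \<le> exp ((\<bar>Re \<alpha>\<bar> + r) * \<bar>t\<bar>)"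
      by (simp add: mult_right_mono)
    with norm_exp_mult_of_real_le[of "\<alpha> + circ r u" t]
    have "norm (exp ((\<alpha> + circ r u) * of_real t)) \<le> exp ((\<bar>Re \<alpha>\<bar> + r) * \<bar>t\<bar>)" by linarith
    then show "norm (A t * (exp ((\<alpha> + circ r u) * of_real t) / circ r u ^ m))
        \<le> norm (A t) * \<bar>t\<bar> ^ 0 * exp ((\<bar>Re \<alpha>\<bar> + r) * \<bar>t\<bar>) * (1 / r ^ m)"
      using r(1) by (auto simp: norm_mult norm_divide norm_power zr intro!: mult_left_mono divide_right_mono
         simp del: norm_exp_eq_Re)
  qed
  also have "\<dots> = integral {0..1} (\<lambda>u. laplace A (\<alpha> + circ r u) / circ r u ^ m)"
    unfolding laplace_def by simp
  finally show ?thesis .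
qed

text \<open>Around pi/2 - e a circle of radius proportional to e is used. On it the transform is at
  most C exp(-c/(2e)), while the division by the m-th power of the radius costs only e^(-m).\<close>

lemma moments_vanish_at_edge:
  assumes A: "exp_decay A" and flat: "flat_at_edge A (of_real \<sigma>)" and \<sigma>: "\<bar>\<sigma>\<bar> = 1"
  shows "((\<lambda>e. LBINT t. A t * of_real t ^ m * exp (of_real (\<sigma> * (pi / 2 - e)) * of_real t)) \<longlongrightarrow> 0) (at_right 0)"
proof -
  obtain \<kappa> \<epsilon> c C where "\<kappa> > 0" "\<epsilon> > 0" "c > 0" and
    bd: "\<And>e. 0 < Re e \<Longrightarrow> \<bar>Im e\<bar> \<le> \<kappa> * Re e \<Longrightarrow> norm e < \<epsilon> \<Longrightarrow>
       norm (laplace A (of_real \<sigma> * (of_real (pi / 2) - e))) \<le> C * exp (- c / norm e)"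
    using flat unfolding flat_at_edge_def by blast
  \<comment> \<open>Radius q e: the bound 1/2 keeps the circle at distance at least e/2 from the
    edge, and the bound \<open>\<kappa>\<close>/2 then keeps it inside the cone.\<close>
  define q where "q = min (1/2) (\<kappa> / 2)"
  have q: "0 < q" "q \<le> 1/2" "q \<le> \<kappa> / 2" using \<open>\<kappa> > 0\<close> by (auto simp: q_def)
  have C0: "C \<ge> 0"
  proof -
    have "0 \<le> C * exp (- c / norm (of_real (\<epsilon> / 2) :: complex))"
      using \<open>\<epsilon> > 0\<close> \<open>\<kappa> > 0\<close> by (intro order_trans[OF norm_ge_zero bd]) auto
    then show ?thesis by (simp add: zero_le_mult_iff)
  qed
  have "eventually (\<lambda>e::real. 0 < e \<and> e < min \<epsilon> 1 / 2) (at_right 0)"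
    using \<open>\<epsilon> > 0\<close> eventually_at_right_real[of 0 "min \<epsilon> 1 / 2"] by (auto elim: eventually_mono)
  then have "eventually (\<lambda>e. norm (LBINT t. A t * of_real t ^ m * exp (of_real (\<sigma> * (pi / 2 - e)) * of_real t))
      \<le> fact m * C / q ^ m * (2 / c) ^ m * ((c / 2 * inverse e) ^ m / exp (c / 2 * inverse e))) (at_right 0)"
  proof eventually_elim
    case (elim e)
    then have e: "e > 0" "e < \<epsilon> / 2" "e < 1/2" by auto
    define r where "r = q * e"
    have r: "r > 0" "r \<le> e / 2" "r \<le> \<kappa> * e / 2" using q e(1) by (auto simp: r_def)
    have eq: "(LBINT t. A t * of_real t ^ m * exp (of_real (\<sigma> * (pi / 2 - e)) * of_real t))
       = fact m * integral {0..1} (\<lambda>u. laplace A (of_real (\<sigma> * (pi / 2 - e)) + circ r u) / circ r u ^ m)"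
    proof (rule moment_eq_circle_average[OF A])
      show "\<bar>Re (complex_of_real (\<sigma> * (pi / 2 - e)))\<bar> + r < pi / 2"
        using \<sigma> e r(2) pi_gt3 by (simp add: abs_mult)
    qed (use r in auto)
    have b: "norm (laplace A (of_real (\<sigma> * (pi / 2 - e)) + circ r u) / circ r u ^ m)
        \<le> C * exp (- c / (2 * e)) / r ^ m" for u
    proof -
      define w where "w = of_real e - of_real \<sigma> * circ r u"
      have nr: "norm (of_real \<sigma> * circ r u) = r" using \<sigma> r(1) by (simp add: norm_mult norm_circ)
      have ss: "\<sigma> * \<sigma> = 1" using \<sigma> by (metis abs_mult_self_eq mult_1)
      have 1: "\<bar>Re w - e\<bar> \<le> r" "\<bar>Im w\<bar> \<le> r"
        using abs_Re_le_cmod[of "of_real \<sigma> * circ r u"] abs_Im_le_cmod[of "of_real \<sigma> * circ r u"]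
        unfolding nr by (auto simp: w_def)
      have 2: "Re w \<ge> e / 2" using 1(1) r(2) by linarith
      have 3: "norm w \<le> 2 * e"
        using norm_triangle_ineq4[of "of_real e" "of_real \<sigma> * circ r u"] nr r(2) e(1) by (simp add: w_def)
      have "r \<le> \<kappa> * Re w"
        using r(3) 2 \<open>\<kappa> > 0\<close> mult_left_mono[OF 2, of \<kappa>] by linarith
      then have "norm (laplace A (of_real \<sigma> * (of_real (pi / 2) - w))) \<le> C * exp (- c / norm w)"
        using 1 2 3 e by (intro bd) auto
      also have "\<dots> \<le> C * exp (- c / (2 * e))"
        using 2 3 e C0 \<open>c > 0\<close> complex_Re_le_cmod[of w]
        by (intro mult_left_mono) (auto intro!: divide_left_mono mult_pos_pos)
      also have "of_real \<sigma> * (of_real (pi / 2) - w) = of_real (\<sigma> * (pi / 2 - e)) + circ r u"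
        using ss by (simp add: w_def algebra_simps flip: of_real_mult mult.assoc)
      finally show ?thesis using r(1) by (simp add: norm_divide norm_power norm_circ divide_right_mono)
    qed
    \<comment> \<open>A non-integrable integrand would have integral 0 by convention, so the bound
      holds in that case too and continuity on the circle need not be argued.\<close>
    have "norm (integral {0..1} (\<lambda>u. laplace A (of_real (\<sigma> * (pi / 2 - e)) + circ r u) / circ r u ^ m))
        \<le> C * exp (- c / (2 * e)) / r ^ m"
    proof (cases "(\<lambda>u. laplace A (of_real (\<sigma> * (pi / 2 - e)) + circ r u) / circ r u ^ m) integrable_on {0..1}")
      case True
      from integral_norm_bound_integral[OF this, of "\<lambda>_. C * exp (- c / (2 * e)) / r ^ m"] b
      show ?thesis by (auto simp: integrable_const_ivl)
    qed (use C0 r(1) in \<open>auto simp: not_integrable_integral\<close>)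
    then have "norm (LBINT t. A t * of_real t ^ m * exp (of_real (\<sigma> * (pi / 2 - e)) * of_real t))
        \<le> fact m * (C * exp (- c / (2 * e)) / r ^ m)"
      unfolding eq norm_mult norm_fact by (intro mult_left_mono) auto
    also have "\<dots> = fact m * C / q ^ m * (2 / c) ^ m * ((c / 2 * inverse e) ^ m / exp (c / 2 * inverse e))"
      using \<open>c > 0\<close> e(1) q(1) by (simp add: r_def power_mult_distrib exp_minus field_simps)
    finally show ?case .
  qed
  moreover have "((\<lambda>e. fact m * C / q ^ m * (2 / c) ^ m * ((c / 2 * inverse e) ^ m / exp (c / 2 * inverse e))) \<longlongrightarrow> fact m * C / q ^ m * (2 / c) ^ m * 0) (at_right 0)"
  proof (intro tendsto_mult_left filterlim_compose[OF tendsto_power_div_exp_0])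
    show "LIM e at_right (0::real). c / 2 * inverse e :> at_top"
      using \<open>c > 0\<close> by (intro filterlim_tendsto_pos_mult_at_top[OF tendsto_const] filterlim_inverse_at_top_right) auto
  qed
  ultimately show ?thesis
    unfolding mult_zero_right by (rule Lim_null_comparison)
qed

theorem infinitely_many_zeros_if_flat:
  fixes A :: "real \<Rightarrow> real"
  assumes A: "exp_decay (\<lambda>t. of_real (A t))"
    and flat: "flat_at_edge (\<lambda>t. of_real (A t)) 1" "flat_at_edge (\<lambda>t. of_real (A t)) (-1)"
  shows "infinite {t. A t = 0}"
proof (rule infinitely_many_zeros_if_moments_vanish)
  have pw: "of_real (A t) * of_real t ^ m * exp (of_real x * of_real t) = complex_of_real (A t * t ^ m * exp (x * t))" for x t m
    by (simp add: exp_of_real[symmetric])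
  have ex: "(LBINT t. of_real (A t) * of_real t ^ m * exp (of_real x * of_real t)) = complex_of_real (LBINT t. A t * t ^ m * exp (x * t))" for x m
    unfolding pw by (rule integral_complex_of_real)
  have "continuous_on UNIV (\<lambda>t. Re (of_real (A t)))"
    using A unfolding exp_decay_def by (intro continuous_on_Re) simp
  then show "continuous_on UNIV A" by simp
  show "integrable lborel (\<lambda>t. A t * t ^ m * exp (x * t))" if "\<bar>x\<bar> < pi / 2" for x m
    using exp_decay_integrable[OF A, of "of_real x" m] that
    unfolding pw complex_of_real_integrable_eq by simp
  show "((\<lambda>e. LBINT t. A t * t ^ m * exp ((pi / 2 - e) * t)) \<longlongrightarrow> 0) (at_right 0)" for m
    using tendsto_Re[OF moments_vanish_at_edge[OF A, of 1 m]] flat(1) unfolding ex by simp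
  show "((\<lambda>e. LBINT t. A t * t ^ m * exp (- (pi / 2 - e) * t)) \<longlongrightarrow> 0) (at_right 0)" for m
    using tendsto_Re[OF moments_vanish_at_edge[OF A, of "-1" m]] flat(2) unfolding ex by simp
qed

section \<open>Cusp forms\<close>

locale cusp_form =
  fixes k :: nat and f :: "complex \<Rightarrow> complex" and a :: "nat \<Rightarrow> real"
  assumes cusp: "cusp_form_SL2Z k f" and fourier: "has_fourier_coeffs f a"
begin

lemma f_holomorphic: "f holomorphic_on {\<tau>. Im \<tau> > 0}"
  using cusp unfolding cusp_form_SL2Z_def by (rule conjunct1)

lemma modular:
  fixes u v c d :: int
  assumes "u * d - v * c = 1" "Im \<tau> > 0"
  shows "f ((of_int u * \<tau> + of_int v) / (of_int c * \<tau> + of_int d)) = (of_int c * \<tau> + of_int d) ^ k * f \<tau>"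
proof -
  have "\<forall>a b c d :: int. a * d - b * c = 1 \<longrightarrow> (\<forall>\<tau>. Im \<tau> > 0 \<longrightarrow>
           f ((of_int a * \<tau> + of_int b) / (of_int c * \<tau> + of_int d)) = (of_int c * \<tau> + of_int d) ^ k * f \<tau>)"
    using cusp unfolding cusp_form_SL2Z_def by (elim conjE)
  from this[rule_format, OF assms] show ?thesis .
qed

lemma f_translate: "Im \<tau> > 0 \<Longrightarrow> f (\<tau> + of_int n) = f \<tau>"
  using modular[of 1 1 n 0 \<tau>] by simp

text \<open>Writing b h = -1 + r m, the matrix with rows (b, -m) and (r, -h) has determinant 1 and
  carries the cusp h/r to infinity. The variable \<open>y\<close> is complex, so approach to the
  cusp within a sector is covered.\<close>

lemma modular_at_cusp:
  fixes b h r :: int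
  assumes "r > 0" "[b * h = - 1] (mod r)" "Re y > 0"
  shows "f (of_int b / of_int r + \<i> / (of_int r ^ 2 * y)) = (\<i> * of_int r * y) ^ k * f (of_int h / of_int r + \<i> * y)"
proof -
  obtain m where m: "b * h = - 1 + r * m"
    using assms(2) by (metis cong_iff_lin cong_sym)
  define \<tau> where "\<tau> = of_int h / of_int r + \<i> * y"
  have r: "of_int r \<noteq> (0 :: complex)" using assms(1) by simp
  have y: "y \<noteq> 0" using assms(3) by auto
  have den: "of_int r * \<tau> + of_int (- h) = \<i> * of_int r * y"
    using r by (simp add: \<tau>_def field_simps)
  have bh: "of_int b * of_int h = (- 1 + of_int r * of_int m :: complex)"
    using m by (metis of_int_1 of_int_add of_int_minus of_int_mult)
  have num: "(of_int b * \<tau> + of_int (- m)) / (\<i> * of_int r * y) = of_int b / of_int r + \<i> / (of_int r ^ 2 * y)"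
  proof -
    have "of_int b * \<tau> + of_int (- m) = - 1 / of_int r + \<i> * of_int b * y"
      using r bh by (simp add: \<tau>_def field_simps)
    then show ?thesis using r y by (simp add: divide_simps power2_eq_square) (simp add: algebra_simps)
  qed
  have "Im \<tau> > 0" using assms(3) r by (simp add: \<tau>_def)
  moreover have "b * (- h) - (- m) * r = 1" using m by (simp add: algebra_simps)
  ultimately have "f ((of_int b * \<tau> + of_int (- m)) / (of_int r * \<tau> + of_int (- h))) = (of_int r * \<tau> + of_int (- h)) ^ k * f \<tau>"
    by (intro modular)
  then show ?thesis unfolding den num unfolding \<tau>_def .
qed

lemma fourier_sums:
  "Im \<tau> > 0 \<Longrightarrow> (\<lambda>n. of_real (a (Suc n)) * exp (2 * of_real pi * \<i> * of_nat (Suc n) * \<tau>)) sums f \<tau>"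
  using fourier by (simp add: has_fourier_coeffs_def)

lemma norm_fourier_term:
  "norm (of_real x * exp (2 * of_real pi * \<i> * of_nat m * \<tau>)) = \<bar>x\<bar> * exp (- 2 * pi * real m * Im \<tau>)"
  by (simp add: norm_mult)

text \<open>Only convergence of the Fourier series is given. Its terms at height y/2 are therefore
  bounded, and passing to height y multiplies the n-th term by exp(-pi n y), a geometric
  majorant.\<close>

lemma summable_fourier_abs:
  assumes "y > 0" shows "summable (\<lambda>n. \<bar>a (Suc n)\<bar> * exp (- 2 * pi * real (Suc n) * y))"
proof -
  have "(\<lambda>n. of_real (a (Suc n)) * exp (2 * of_real pi * \<i> * of_nat (Suc n) * (\<i> * of_real (y / 2)))) sums f (\<i> * of_real (y / 2))"
    using assms by (intro fourier_sums) simp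
  then have "Bseq (\<lambda>n. of_real (a (Suc n)) * exp (2 * of_real pi * \<i> * of_nat (Suc n) * (\<i> * of_real (y / 2))) :: complex)"
    by (intro convergent_imp_Bseq summable_imp_convergent sums_summable)
  then obtain B where B: "\<And>n. norm (of_real (a (Suc n)) * exp (2 * of_real pi * \<i> * of_nat (Suc n) * (\<i> * of_real (y / 2))) :: complex) \<le> B"
    unfolding Bseq_def by blast
  have le: "norm (\<bar>a (Suc n)\<bar> * exp (- 2 * pi * real (Suc n) * y)) \<le> B * exp (- pi * y) ^ Suc n" for n
  proof -
    have "\<bar>a (Suc n)\<bar> * exp (- 2 * pi * real (Suc n) * y) = (\<bar>a (Suc n)\<bar> * exp (- 2 * pi * real (Suc n) * (y / 2))) * exp (- pi * y) ^ Suc n"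
      by (simp only: mult.assoc flip: exp_of_nat_mult exp_add) (simp add: algebra_simps)
    also have "\<dots> \<le> B * exp (- pi * y) ^ Suc n"
      using B[of n] unfolding norm_fourier_term by (intro mult_right_mono) auto
    finally show ?thesis by simp
  qed
  have "summable (\<lambda>n. B * exp (- pi * y) ^ Suc n)"
    using assms by (intro summable_mult summable_Suc_iff[THEN iffD2] summable_geometric) auto
  then show ?thesis by (rule summable_comparison_test'[where N = 0]) (rule le)
qed

text \<open>Every frequency is at least 1, so raising the height from y0 to Im tau gains at least
  exp(-2 pi (Im tau - y0)) in each term. The 1 added to \<open>S\<close> only makes the constant
  positive when all coefficients vanish.\<close>

lemma f_exp_bound:
  assumes "y0 > 0"
  obtains C where "C > 0" "\<And>\<tau>. Im \<tau> \<ge> y0 \<Longrightarrow> norm (f \<tau>) \<le> C * exp (- 2 * pi * Im \<tau>)"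
proof -
  define S where "S = (\<Sum>n. \<bar>a (Suc n)\<bar> * exp (- 2 * pi * real (Suc n) * y0))"
  have S: "S \<ge> 0" unfolding S_def by (intro suminf_nonneg summable_fourier_abs assms) auto
  have pos: "(S + 1) * exp (2 * pi * y0) > 0" using S by (intro mult_pos_pos) auto
  have "norm (f \<tau>) \<le> (S + 1) * exp (2 * pi * y0) * exp (- 2 * pi * Im \<tau>)" if \<tau>: "Im \<tau> \<ge> y0" for \<tau>
  proof -
  have "Im \<tau> > 0" using assms \<tau> by linarith
  from fourier_sums[OF this] have "f \<tau> = (\<Sum>n. of_real (a (Suc n)) * exp (2 * of_real pi * \<i> * of_nat (Suc n) * \<tau>))"
    by (rule sums_unique)
  also have "norm \<dots> \<le> (\<Sum>n. \<bar>a (Suc n)\<bar> * exp (- 2 * pi * real (Suc n) * y0) * exp (- 2 * pi * (Im \<tau> - y0)))"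
  proof (rule norm_suminf_le)
    show "norm (of_real (a (Suc n)) * exp (2 * of_real pi * \<i> * of_nat (Suc n) * \<tau>))
      \<le> \<bar>a (Suc n)\<bar> * exp (- 2 * pi * real (Suc n) * y0) * exp (- 2 * pi * (Im \<tau> - y0))" for n
    proof -
      have "0 \<le> pi * (real n * (Im \<tau> - y0))" using \<tau> by simp
      then have "- 2 * pi * real (Suc n) * Im \<tau> \<le> - 2 * pi * real (Suc n) * y0 + - 2 * pi * (Im \<tau> - y0)"
        by (simp add: algebra_simps)
      then show ?thesis unfolding norm_fourier_term mult.assoc[of "\<bar>a (Suc n)\<bar>"] exp_add[symmetric]
        by (intro mult_left_mono) auto
    qed
    show "summable (\<lambda>n. \<bar>a (Suc n)\<bar> * exp (- 2 * pi * real (Suc n) * y0) * exp (- 2 * pi * (Im \<tau> - y0)))"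
      by (intro summable_mult2 summable_fourier_abs assms)
  qed
  also have "\<dots> = S * exp (- 2 * pi * (Im \<tau> - y0))"
    unfolding S_def by (rule suminf_mult2[symmetric]) (intro summable_fourier_abs assms)
  also have "\<dots> \<le> (S + 1) * exp (- 2 * pi * (Im \<tau> - y0))" by (intro mult_right_mono) auto
  also have "exp (- 2 * pi * (Im \<tau> - y0)) = exp (2 * pi * y0) * exp (- 2 * pi * Im \<tau>)"
    by (simp add: algebra_simps flip: exp_add)
  finally show ?thesis by (simp only: mult.assoc)
  qed
  with pos that show ?thesis by blast
qed

text \<open>A point of height at most 1 is moved up by the matrix whose lower row is a Dirichlet
  approximation of its real part; this replaces the reduction to the fundamental domain.\<close>

lemma reduce_to_height:
  assumes "Im \<tau> > 0"
  obtains \<tau>' where "Im \<tau>' \<ge> 1/5" "\<bar>Re \<tau>'\<bar> \<le> 1/2" "norm (f \<tau>') ^ 2 * Im \<tau>' ^ k = norm (f \<tau>) ^ 2 * Im \<tau> ^ k"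
proof -
  have "\<exists>\<tau>'. Im \<tau>' \<ge> 1/5 \<and> norm (f \<tau>') ^ 2 * Im \<tau>' ^ k = norm (f \<tau>) ^ 2 * Im \<tau> ^ k"
  proof (cases "Im \<tau> \<ge> 1")
    case True
    then show ?thesis by (intro exI[of _ \<tau>]) auto
  next
    case False
    define y where "y = Im \<tau>"
    have y: "0 < y" "y < 1" using assms False by (auto simp: y_def)
    \<comment> \<open>This N balances the two parts of |c tau - h|^2: the real part contributes at
      most 1/N^2, hence at most y, and the imaginary part at most (N y)^2, hence at most 4y. Their
      sum 5y is the origin of the height 1/5.\<close>
    define N where "N = nat \<lceil>1 / sqrt y\<rceil>"
    have s: "0 < sqrt y" "sqrt y < 1" "sqrt y * sqrt y = y" using y by auto
    have N1: "real N \<ge> 1 / sqrt y" unfolding N_def using s by linarith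
    have "0 < 1 / sqrt y" using s by simp
    then have "real N \<le> 1 / sqrt y + 1" unfolding N_def by linarith
    moreover have "1 \<le> 1 / sqrt y" using s by simp
    ultimately have N2: "real N \<le> 2 / sqrt y" by simp
    have "N > 0" using N1 s by (metis divide_pos_pos of_nat_0_less_iff order_less_le_trans zero_less_one)
    then obtain h c where hc: "coprime h c" "0 < c" "c \<le> int N" "\<bar>of_int c * Re \<tau> - of_int h\<bar> < 1 / N"
      by (rule Dirichlet_approx_coprime)
    \<comment> \<open>Bezout completes the lower row (c, -h) by (-u, -v) to a matrix of determinant
      1.\<close>
    obtain u v where uv: "u * h + v * c = 1"
      using bezout_int[of h c] hc(1) by (auto simp: coprime_iff_gcd_eq_1)
    define j where "j = of_int c * \<tau> + of_int (- h)"
    define \<tau>' where "\<tau>' = (of_int (- u) * \<tau> + of_int (- v)) / (of_int c * \<tau> + of_int (- h))"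
    have Imj: "Im j = of_int c * y" by (simp add: j_def y_def)
    have j0: "j \<noteq> 0" using Imj hc(2) y by (metis mult_eq_0_iff of_int_0_eq_iff less_irrefl zero_complex.simps(2))
    have det: "(- u) * (- h) - (- v) * c = 1" using uv by simp
    have fj: "f \<tau>' = j ^ k * f \<tau>" unfolding \<tau>'_def j_def by (rule modular[OF det assms])
    have uvr: "of_int u * of_int h + of_int v * of_int c = (1 :: real)"
      using uv by (metis of_int_1 of_int_add of_int_mult)
    have Im': "Im \<tau>' = y / norm j ^ 2"
    proof -
      have "Im \<tau>' = (Im (of_int (- u) * \<tau> + of_int (- v)) * Re j - Re (of_int (- u) * \<tau> + of_int (- v)) * Im j) / norm j ^ 2"
        unfolding \<tau>'_def j_def[symmetric] Im_divide cmod_power2 by simp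
      also have "Im (of_int (- u) * \<tau> + of_int (- v)) * Re j - Re (of_int (- u) * \<tau> + of_int (- v)) * Im j
          = (of_int u * of_int h + of_int v * of_int c) * y"
        unfolding Imj by (simp add: j_def y_def algebra_simps)
      finally show ?thesis unfolding uvr by simp
    qed
    have "norm j ^ 2 \<le> 5 * y"
    proof -
      have "norm j ^ 2 = (of_int c * Re \<tau> - of_int h) ^ 2 + (of_int c * y) ^ 2"
        by (simp add: cmod_power2 Imj) (simp add: j_def)
      also have "(of_int c * Re \<tau> - of_int h) ^ 2 \<le> (1 / real N) ^ 2"
        using hc(4) by (subst abs_le_square_iff[symmetric]) auto
      also have "(1 / real N) ^ 2 \<le> (sqrt y) ^ 2"
        using N1 s \<open>N > 0\<close> by (intro power_mono) (auto simp: field_simps)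
      also have "(of_int c * y) ^ 2 \<le> (2 / sqrt y * y) ^ 2"
        using hc y N2 by (intro power_mono mult_right_mono) (auto intro: order_trans[of _ "real N"])
      also have "(2 / sqrt y * y) ^ 2 = 4 * y" using y by (simp add: power_mult_distrib power_divide power2_eq_square)
      also have "(sqrt y) ^ 2 = y" using y by simp
      finally show ?thesis by simp
    qed
    then have "Im \<tau>' \<ge> 1/5" unfolding Im' using y j0 by (simp add: field_simps)
    moreover have "norm (f \<tau>') ^ 2 * Im \<tau>' ^ k = norm (f \<tau>) ^ 2 * Im \<tau> ^ k"
      unfolding fj Im' y_def[symmetric] using j0
      by (simp add: norm_mult norm_power power_mult_distrib power_divide field_simps flip: power_mult)
    ultimately show ?thesis by blast
  qed
  then obtain \<tau>' where \<tau>': "Im \<tau>' \<ge> 1/5" "norm (f \<tau>') ^ 2 * Im \<tau>' ^ k = norm (f \<tau>) ^ 2 * Im \<tau> ^ k" by blast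
  show ?thesis
  proof (rule that)
    show "\<bar>Re (\<tau>' + of_int (- round (Re \<tau>')))\<bar> \<le> 1/2"
      using of_int_round_abs_le[of "Re \<tau>'"] by (simp add: abs_minus_commute)
    show "norm (f (\<tau>' + of_int (- round (Re \<tau>')))) ^ 2 * Im (\<tau>' + of_int (- round (Re \<tau>'))) ^ k = norm (f \<tau>) ^ 2 * Im \<tau> ^ k"
      using \<tau>' by (subst f_translate) auto
  qed (use \<tau>' in auto)
qed

text \<open>The quantity |f|^2 y^k is invariant under the reduction to height at least 1/5, where
  the exponential decay of f controls the power of y.\<close>

lemma f_growth:
  obtains C where "C > 0" "\<And>\<tau>. Im \<tau> > 0 \<Longrightarrow> norm (f \<tau>) ^ 2 * Im \<tau> ^ k \<le> C"
proof -
  obtain C where C: "C > 0" "\<And>\<tau>. Im \<tau> \<ge> 1/5 \<Longrightarrow> norm (f \<tau>) \<le> C * exp (- 2 * pi * Im \<tau>)"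
    using f_exp_bound[of "1/5"] by auto
  have high: "norm (f \<tau>) ^ 2 * Im \<tau> ^ k \<le> C ^ 2 * fact k" if "Im \<tau> \<ge> 1/5" for \<tau>
  proof -
    have "Im \<tau> ^ k \<le> fact k * exp (Im \<tau>)" by (rule power_le_fact_mult_exp) (use that in linarith)
    then have "norm (f \<tau>) ^ 2 * Im \<tau> ^ k \<le> (C * exp (- 2 * pi * Im \<tau>)) ^ 2 * (fact k * exp (Im \<tau>))"
      using C that by (intro mult_mono power_mono) auto
    also have "\<dots> = C ^ 2 * fact k * exp (- 4 * pi * Im \<tau> + Im \<tau>)"
    proof -
      have "exp (- 2 * pi * Im \<tau>) ^ 2 * exp (Im \<tau>) = exp (- 4 * pi * Im \<tau> + Im \<tau>)"
        by (simp add: power2_eq_square flip: exp_add)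
      then show ?thesis by (simp only: power_mult_distrib mult_ac)
    qed
    also have "\<dots> \<le> C ^ 2 * fact k * 1"
    proof (intro mult_left_mono)
      have "1 * Im \<tau> \<le> 4 * pi * Im \<tau>" using that pi_gt3 by (intro mult_right_mono) auto
      then show "exp (- 4 * pi * Im \<tau> + Im \<tau>) \<le> 1" by simp
    qed auto
    finally show ?thesis by simp
  qed
  show ?thesis
  proof (rule that)
    show "C ^ 2 * fact k > 0" using C by simp
    fix \<tau> assume "Im \<tau> > 0"
    then obtain \<tau>' where "Im \<tau>' \<ge> 1/5" "norm (f \<tau>') ^ 2 * Im \<tau>' ^ k = norm (f \<tau>) ^ 2 * Im \<tau> ^ k"
      by (rule reduce_to_height)
    with high[of \<tau>'] show "norm (f \<tau>) ^ 2 * Im \<tau> ^ k \<le> C ^ 2 * fact k" by simp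
  qed
qed

text \<open>In odd weight the matrix -1 forces f = -f. In weight 0 the modulus |f| is itself
  invariant under reduction, so it attains a maximum; the maximum principle makes f constant and
  decay makes the constant 0. The remaining weights are positive and even, as needed for the Gamma
  factor and for realness on the critical line.\<close>

lemma f_eq_0_of_weight_0_or_odd:
  assumes "k = 0 \<or> odd k" "Im \<tau> > 0"
  shows "f \<tau> = 0"
proof (cases "k = 0")
  case False
  with assms(1) have "odd k" by simp
  have "f ((of_int (- 1) * \<tau> + of_int 0) / (of_int 0 * \<tau> + of_int (- 1))) = (of_int 0 * \<tau> + of_int (- 1)) ^ k * f \<tau>"
    by (rule modular) (use assms in auto)
  also have "(of_int (- 1) * \<tau> + of_int 0) / (of_int 0 * \<tau> + of_int (- 1)) = \<tau>" by simp
  also have "(of_int 0 * \<tau> + of_int (- 1)) ^ k = (- 1 :: complex)" using \<open>odd k\<close> by simp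
  finally have "f \<tau> + f \<tau> = 0" by (simp only: eq_neg_iff_add_eq_0 mult_minus1)
  then show ?thesis by simp
next
  case True
  obtain C where C: "C > 0" "\<And>\<tau>. Im \<tau> \<ge> 1/5 \<Longrightarrow> norm (f \<tau>) \<le> C * exp (- 2 * pi * Im \<tau>)"
    using f_exp_bound[of "1/5"] by auto
  have lim: "((\<lambda>y. C * exp (- 2 * pi * y)) \<longlongrightarrow> 0) at_top"
    by (intro tendsto_mult_right_zero filterlim_compose[OF exp_at_bot]
          filterlim_tendsto_neg_mult_at_bot[OF tendsto_const _ filterlim_ident]) simp
  show ?thesis
  proof (rule ccontr)
    assume nz: "f \<tau> \<noteq> 0"
    then have "eventually (\<lambda>y. C * exp (- 2 * pi * y) < norm (f \<tau>)) at_top"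
      using order_tendstoD(2)[OF lim] by simp
    then obtain Y where Y: "\<And>y. y \<ge> Y \<Longrightarrow> C * exp (- 2 * pi * y) < norm (f \<tau>)"
      unfolding eventually_at_top_linorder by blast
    have red: "\<exists>\<tau>'. Im \<tau>' \<ge> 1/5 \<and> \<bar>Re \<tau>'\<bar> \<le> 1/2 \<and> norm (f \<tau>') = norm (f w)" if "Im w > 0" for w
      using reduce_to_height[OF that] True by (metis mult.right_neutral norm_ge_zero power_0 power2_eq_imp_eq)
    \<comment> \<open>A rectangle containing every reduced point at which |f| is at least |f tau|:
      above height \<open>Y\<close> the exponential bound has dropped below that value.\<close>
    define K where "K = cbox (Complex (-1/2) (1/5)) (Complex (1/2) Y)"
    have inK: "w \<in> K" if "Im w \<ge> 1/5" "\<bar>Re w\<bar> \<le> 1/2" "norm (f w) \<ge> norm (f \<tau>)" for w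
    proof -
      have "Im w < Y" using that(3) C(2)[OF that(1)] Y[of "Im w"] by linarith
      then show ?thesis using that unfolding K_def by (auto simp: in_cbox_complex_iff abs_le_iff)
    qed
    obtain \<tau>0 where \<tau>0: "\<tau>0 \<in> K" "norm (f \<tau>0) = norm (f \<tau>)"
      using red[OF assms(2)] inK by (metis order_refl)
    have Kpos: "Im w > 0" if "w \<in> K" for w
      using that unfolding K_def by (auto simp: in_cbox_complex_iff)
    have "continuous_on K (\<lambda>w. norm (f w))"
      using Kpos by (intro continuous_on_norm holomorphic_on_imp_continuous_on holomorphic_on_subset[OF f_holomorphic]) auto
    moreover have "compact K" unfolding K_def by (rule compact_cbox)
    ultimately have "\<exists>x\<in>K. \<forall>w\<in>K. norm (f w) \<le> norm (f x)"
      using \<tau>0(1) by (intro continuous_attains_sup) auto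
    then obtain \<tau>1 where \<tau>1: "\<tau>1 \<in> K" "\<And>w. w \<in> K \<Longrightarrow> norm (f w) \<le> norm (f \<tau>1)"
      by blast
    have max: "norm (f w) \<le> norm (f \<tau>1)" if w: "Im w > 0" for w
    proof -
      obtain w' where w': "Im w' \<ge> 1/5" "\<bar>Re w'\<bar> \<le> 1/2" "norm (f w') = norm (f w)"
        using red[OF w] by blast
      show ?thesis
      proof (cases "norm (f w') \<ge> norm (f \<tau>)")
        case True
        from \<tau>1(2)[OF inK[OF w'(1,2) True]] w'(3) show ?thesis by simp
      next
        case False
        with w'(3) \<tau>1(2)[OF \<tau>0(1)] \<tau>0(2) show ?thesis by simp
      qed
    qed
    have "f constant_on {\<tau>. Im \<tau> > 0}"
    proof (rule maximum_modulus_principle[OF f_holomorphic])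
      show "open {\<tau>. 0 < Im \<tau>}" "open {\<tau>. 0 < Im \<tau>}" by (rule open_halfspace_Im_gt)+
      show "connected {\<tau>. 0 < Im \<tau>}" by (intro convex_connected convex_halfspace_Im_gt)
      show "\<tau>1 \<in> {\<tau>. 0 < Im \<tau>}" using Kpos[OF \<tau>1(1)] by simp
      show "norm (f w) \<le> norm (f \<tau>1)" if "w \<in> {\<tau>. 0 < Im \<tau>}" for w using max that by simp
    qed simp
    then obtain c where c: "\<And>w. Im w > 0 \<Longrightarrow> f w = c" unfolding constant_on_def by auto
    have "norm c \<le> C * exp (- 2 * pi * y)" if "y \<ge> 1" for y
      using C(2)[of "\<i> * of_real y"] c[of "\<i> * of_real y"] that by simp
    then have "norm c \<le> 0"
      by (intro tendsto_lowerbound[OF lim] eventually_at_top_linorderI[of 1]) auto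
    with c assms(2) nz show False by auto
  qed
qed

end

section \<open>Mean-square bounds for the Fourier coefficients\<close>

lemma has_integral_cos_int_period:
  "((\<lambda>x. cos (2 * pi * real_of_int j * x)) has_integral (if j = 0 then 1 else 0)) {0..1}"
proof (cases "j = 0")
  case True
  then show ?thesis using has_integral_const_real[of "1::real" 0 1] by simp
next
  case False
  have "((\<lambda>x. cos (2 * pi * real_of_int j * x)) has_integral
      sin (2 * pi * real_of_int j * 1) / (2 * pi * real_of_int j) - sin (2 * pi * real_of_int j * 0) / (2 * pi * real_of_int j)) {0..1}"
    by (rule fundamental_theorem_of_calculus)
       (use False in \<open>auto intro!: derivative_eq_intros simp flip: has_real_derivative_iff_has_vector_derivative\<close>)
  moreover have "sin (2 * pi * real_of_int j) = 0"
    using sin_integer_2pi[of "real_of_int j"] by simp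
  ultimately show ?thesis using False by simp
qed

lemma has_integral_norm_trig_poly_squared:
  fixes c :: "nat \<Rightarrow> real"
  shows "((\<lambda>x. norm (\<Sum>n<N. of_real (c n) * exp (2 * of_real pi * \<i> * of_nat (Suc n) * of_real x)) ^ 2)
    has_integral (\<Sum>n<N. c n ^ 2)) {0..1}"
proof -
  have eq: "norm (\<Sum>n<N. of_real (c n) * exp (2 * of_real pi * \<i> * of_nat (Suc n) * of_real x)) ^ 2
      = (\<Sum>m<N. \<Sum>n<N. c m * c n * cos (2 * pi * real_of_int (int m - int n) * x))" for x :: real
  proof -
    have e: "exp (2 * of_real pi * \<i> * of_nat (Suc n) * of_real x) = cis (2 * pi * real (Suc n) * x)" for n
      by (simp add: cis_conv_exp mult_ac)
    have "norm (\<Sum>n<N. of_real (c n) * exp (2 * of_real pi * \<i> * of_nat (Suc n) * of_real x)) ^ 2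
      = (\<Sum>n<N. c n * cos (2 * pi * real (Suc n) * x)) ^ 2 + (\<Sum>n<N. c n * sin (2 * pi * real (Suc n) * x)) ^ 2"
      unfolding e cmod_power2 by (simp add: Re_sum Im_sum)
    also have "\<dots> = (\<Sum>m<N. \<Sum>n<N. c m * c n * (cos (2 * pi * real (Suc m) * x) * cos (2 * pi * real (Suc n) * x)
        + sin (2 * pi * real (Suc m) * x) * sin (2 * pi * real (Suc n) * x)))"
      unfolding power2_eq_square sum_product by (simp add: algebra_simps sum.distrib)
    also have "\<dots> = (\<Sum>m<N. \<Sum>n<N. c m * c n * cos (2 * pi * real_of_int (int m - int n) * x))"
      unfolding cos_diff[symmetric] by (simp add: algebra_simps)
    finally show ?thesis .
  qed
  have "((\<lambda>x. \<Sum>m<N. \<Sum>n<N. c m * c n * cos (2 * pi * real_of_int (int m - int n) * x))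
      has_integral (\<Sum>m<N. \<Sum>n<N. c m * c n * (if int m - int n = 0 then 1 else 0))) {0..1}"
    by (intro has_integral_sum has_integral_mult_right has_integral_cos_int_period) auto
  also have "(\<Sum>m<N. \<Sum>n<N. c m * c n * (if int m - int n = 0 then 1 else 0)) = (\<Sum>m<N. \<Sum>n<N. if m = n then c m * c n else 0)"
    by (intro sum.cong) auto
  also have "\<dots> = (\<Sum>n<N. c n ^ 2)" by (simp add: power2_eq_square)
  finally show ?thesis unfolding eq .
qed

text \<open>In place of partial summation: the block from 2^j to 2^(j+1) contributes at most a
  constant times 2^(j(k - beta)), and these bounds form a convergent geometric series.\<close>

lemma summable_of_dyadic_growth:
  fixes f :: "nat \<Rightarrow> real"
  assumes pos: "\<And>n. f n \<ge> 0" and growth: "\<And>N. N > 0 \<Longrightarrow> (\<Sum>n<N. f n) \<le> C * real N ^ k" and \<beta>: "\<beta> > real k"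
  shows "summable (\<lambda>n. f n * real (Suc n) powr (- \<beta>))"
proof (rule summableI_nonneg_bounded)
  define \<rho> where "\<rho> = 2 powr (real k - \<beta>)"
  have \<rho>: "0 < \<rho>" "\<rho> < 1" using \<beta> by (auto simp: \<rho>_def powr_less_one)
  have C0: "C \<ge> 0" using growth[of 1] pos[of 0] by simp
  have block: "(\<Sum>n\<in>{2^j..<2^Suc j}. f n * real (Suc n) powr (- \<beta>)) \<le> C * 2 ^ k * \<rho> ^ j" for j
  proof -
    have "(\<Sum>n\<in>{2^j..<2^Suc j}. f n * real (Suc n) powr (- \<beta>)) \<le> (\<Sum>n\<in>{2^j..<2^Suc j}. f n * (2 ^ j) powr (- \<beta>))"
    proof (intro sum_mono mult_left_mono pos powr_mono2')
      fix n :: nat assume "n \<in> {2^j..<2^Suc j}"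
      then have "real (2 ^ j) \<le> real (Suc n)" by (intro of_nat_mono) auto
      then show "2 ^ j \<le> real (Suc n)" by simp
    qed (use \<beta> in auto)
    also have "\<dots> = (\<Sum>n\<in>{2^j..<2^Suc j}. f n) * (2 ^ j) powr (- \<beta>)" by (rule sum_distrib_right[symmetric])
    also have "(\<Sum>n\<in>{2^j..<2^Suc j}. f n) \<le> (\<Sum>n<2^Suc j. f n)"
      by (rule sum_mono2) (auto intro: pos)
    also have "\<dots> \<le> C * real (2 ^ Suc j) ^ k" by (rule growth) simp
    also have "C * real (2 ^ Suc j) ^ k * (2 ^ j) powr (- \<beta>) = C * 2 ^ k * \<rho> ^ j"
    proof -
      have "(2 ^ j) powr (- \<beta>) = 2 powr (- \<beta> * real j)" "real (2 ^ Suc j) ^ k = 2 ^ k * 2 powr (real k * real j)"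
        by (simp_all add: powr_realpow[symmetric] powr_powr mult_ac power_mult_distrib flip: power_mult)
      moreover have "\<rho> ^ j = 2 powr ((real k - \<beta>) * real j)"
        unfolding \<rho>_def by (simp add: powr_powr flip: powr_realpow)
      ultimately show ?thesis by (simp add: algebra_simps powr_diff powr_minus divide_inverse)
    qed
    finally show ?thesis by (simp add: mult_right_mono)
  qed
  \<comment> \<open>The dyadic blocks start at index 1, so index 0 is counted separately; its weight
    is 1.\<close>
  have dy: "(\<Sum>n<2^J. f n * real (Suc n) powr (- \<beta>)) \<le> f 0 + (\<Sum>j<J. C * 2 ^ k * \<rho> ^ j)" for J
  proof (induction J)
    case (Suc J)
    have "{..<2 ^ Suc J} = {..<2 ^ J} \<union> {2 ^ J..<2 ^ Suc J :: nat}" by auto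
    moreover have "{..<2 ^ J} \<inter> {2 ^ J..<2 ^ Suc J :: nat} = {}" by auto
    ultimately have "(\<Sum>n<2^Suc J. f n * real (Suc n) powr (- \<beta>)) = (\<Sum>n<2^J. f n * real (Suc n) powr (- \<beta>)) + (\<Sum>n\<in>{2^J..<2^Suc J}. f n * real (Suc n) powr (- \<beta>))"
      by (simp only: sum.union_disjoint finite_lessThan finite_atLeastLessThan)
    with Suc block[of J] show ?case by simp
  qed simp
  fix N
  have "(\<Sum>n<N. f n * real (Suc n) powr (- \<beta>)) \<le> (\<Sum>n<2^N. f n * real (Suc n) powr (- \<beta>))"
    by (rule sum_mono2) (auto intro!: mult_nonneg_nonneg pos intro: less_trans[OF _ less_exp])
  also have "\<dots> \<le> f 0 + (\<Sum>j<N. C * 2 ^ k * \<rho> ^ j)" by (rule dy)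
  also have "(\<Sum>j<N. C * 2 ^ k * \<rho> ^ j) \<le> (\<Sum>j. C * 2 ^ k * \<rho> ^ j)"
    using \<rho> C0 by (intro sum_le_suminf summable_mult summable_geometric) auto
  finally show "(\<Sum>n<N. f n * real (Suc n) powr (- \<beta>)) \<le> f 0 + (\<Sum>j. C * 2 ^ k * \<rho> ^ j)" by simp
qed (simp add: pos)

context cusp_form begin

text \<open>Parseval on a horizontal line, applied to partial sums only: such a sum is bounded by
  \<open>S\<close> plus an absolutely convergent tail, and the tail disappears as its length grows
  while \<open>N\<close> stays fixed.\<close>

lemma coeff_square_sum_bound:
  assumes S: "\<And>x. norm (f (Complex x y)) \<le> S" and y: "y > 0"
  shows "(\<Sum>n<N. (a (Suc n) * exp (- 2 * pi * real (Suc n) * y)) ^ 2) \<le> S ^ 2"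
proof -
  define c where "c n = a (Suc n) * exp (- 2 * pi * real (Suc n) * y)" for n
  define g where "g N x = (\<Sum>n<N. of_real (c n) * exp (2 * of_real pi * \<i> * of_nat (Suc n) * of_real x))" for N and x :: real
  have S0: "S \<ge> 0" using order_trans[OF norm_ge_zero S] .
  have sm: "summable (\<lambda>n. \<bar>c n\<bar>)" using summable_fourier_abs[OF y] by (simp add: c_def abs_mult)
  have term_eq: "of_real (c n) * exp (2 * of_real pi * \<i> * of_nat (Suc n) * of_real x)
      = of_real (a (Suc n)) * exp (2 * of_real pi * \<i> * of_nat (Suc n) * Complex x y)" for n x
  proof -
    have "2 * of_real pi * \<i> * of_nat (Suc n) * Complex x y = of_real (- 2 * pi * real (Suc n) * y) + 2 * of_real pi * \<i> * of_nat (Suc n) * of_real x"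
      by (simp add: complex_eq_iff)
    then have "exp (2 * of_real pi * \<i> * of_nat (Suc n) * Complex x y) = of_real (exp (- 2 * pi * real (Suc n) * y)) * exp (2 * of_real pi * \<i> * of_nat (Suc n) * of_real x)"
      by (simp only: exp_add exp_of_real)
    then show ?thesis unfolding c_def by simp
  qed
  have le: "norm (g N x) \<le> S + (\<Sum>n. \<bar>c (n + N)\<bar>)" for N x
  proof -
    have fs: "(\<lambda>n. of_real (c n) * exp (2 * of_real pi * \<i> * of_nat (Suc n) * of_real x)) sums f (Complex x y)"
      unfolding term_eq using y by (intro fourier_sums) simp
    have "f (Complex x y) - g N x = (\<Sum>n. of_real (c (n + N)) * exp (2 * of_real pi * \<i> * of_nat (Suc (n + N)) * of_real x))"
      unfolding g_def using sums_unique[OF sums_split_initial_segment[OF fs, of N]] by simp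
    also have "norm \<dots> \<le> (\<Sum>n. \<bar>c (n + N)\<bar>)"
    proof (rule norm_suminf_le)
      show "norm (of_real (c (n + N)) * exp (2 * of_real pi * \<i> * of_nat (Suc (n + N)) * of_real x)) \<le> \<bar>c (n + N)\<bar>" for n
        unfolding norm_fourier_term by simp
      show "summable (\<lambda>n. \<bar>c (n + N)\<bar>)" using sm by (rule summable_ignore_initial_segment)
    qed
    finally have "norm (f (Complex x y) - g N x) \<le> (\<Sum>n. \<bar>c (n + N)\<bar>)" .
    moreover have "norm (g N x) \<le> norm (f (Complex x y)) + norm (f (Complex x y) - g N x)"
      by (metis norm_triangle_sub norm_minus_commute)
    ultimately show ?thesis using S[of x] by linarith
  qed
  have bd: "(\<Sum>n<N. c n ^ 2) \<le> (S + (\<Sum>n. \<bar>c (n + N)\<bar>)) ^ 2" for N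
  proof (rule has_integral_le)
    show "((\<lambda>x. norm (g N x) ^ 2) has_integral (\<Sum>n<N. c n ^ 2)) {0..1}"
      unfolding g_def by (rule has_integral_norm_trig_poly_squared)
    show "((\<lambda>x. (S + (\<Sum>n. \<bar>c (n + N)\<bar>)) ^ 2) has_integral (S + (\<Sum>n. \<bar>c (n + N)\<bar>)) ^ 2) {0..1::real}"
      using has_integral_const_real[of "(S + (\<Sum>n. \<bar>c (n + N)\<bar>)) ^ 2" 0 1] by simp
  qed (intro power_mono le norm_ge_zero)
  have "(\<lambda>N. (S + (\<Sum>n. \<bar>c (n + N)\<bar>)) ^ 2) \<longlonglongrightarrow> (S + 0) ^ 2"
    by (intro tendsto_intros suminf_exist_split2 sm)
  moreover have "eventually (\<lambda>M. (\<Sum>n<N. c n ^ 2) \<le> (S + (\<Sum>n. \<bar>c (n + M)\<bar>)) ^ 2) sequentially"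
    using eventually_ge_at_top[of N]
  proof eventually_elim
    case (elim M)
    have "(\<Sum>n<N. c n ^ 2) \<le> (\<Sum>n<M. c n ^ 2)" using elim by (intro sum_mono2) auto
    with bd[of M] show ?case by linarith
  qed
  ultimately have "(\<Sum>n<N. c n ^ 2) \<le> (S + 0) ^ 2" by (rule tendsto_lowerbound) simp
  then show ?thesis by (simp add: c_def)
qed

text \<open>At height 1/N the growth bound for f gives a sum of N squared coefficients of order N^k.
  Cauchy-Schwarz, in the termwise form u v at most u^2 + v^2, converts this into absolute
  convergence on the full half-plane Re s > (k+1)/2.\<close>

lemma summable_coeff_powr:
  assumes "\<sigma> > (real k + 1) / 2"
  shows "summable (\<lambda>n. \<bar>a (Suc n)\<bar> * real (Suc n) powr (- \<sigma>))"
proof -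
  obtain C where C: "C > 0" "\<And>\<tau>. Im \<tau> > 0 \<Longrightarrow> norm (f \<tau>) ^ 2 * Im \<tau> ^ k \<le> C"
    using f_growth by blast
  have growth: "(\<Sum>n<N. a (Suc n) ^ 2) \<le> C * exp (4 * pi) * real N ^ k" if N: "N > 0" for N
  proof -
    have "norm (f (Complex x (1 / N))) \<le> sqrt (C * real N ^ k)" for x
      using C(2)[of "Complex x (1 / N)"] N by (intro real_le_rsqrt) (simp add: power_divide field_simps)
    then have "(\<Sum>n<N. (a (Suc n) * exp (- 2 * pi * real (Suc n) * (1 / N))) ^ 2) \<le> (sqrt (C * real N ^ k)) ^ 2"
      by (rule coeff_square_sum_bound) (use N in auto)
    also have "(sqrt (C * real N ^ k)) ^ 2 = C * real N ^ k" using C(1) by simp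
    finally have le: "(\<Sum>n<N. (a (Suc n) * exp (- 2 * pi * real (Suc n) * (1 / N))) ^ 2) \<le> C * real N ^ k" .
    have "(\<Sum>n<N. a (Suc n) ^ 2 * exp (- 4 * pi)) \<le> (\<Sum>n<N. (a (Suc n) * exp (- 2 * pi * real (Suc n) * (1 / N))) ^ 2)"
    proof (rule sum_mono)
      fix n assume n: "n \<in> {..<N}"
      have "pi * real (Suc n) * (1 / N) \<le> pi * 1" using n N unfolding mult.assoc
        by (intro mult_left_mono) (auto simp: field_simps)
      then have "exp (- 4 * pi) \<le> exp (- 2 * pi * real (Suc n) * (1 / N)) ^ 2"
        by (simp add: power2_eq_square flip: exp_add)
      then show "a (Suc n) ^ 2 * exp (- 4 * pi) \<le> (a (Suc n) * exp (- 2 * pi * real (Suc n) * (1 / N))) ^ 2"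
        unfolding power_mult_distrib by (rule mult_left_mono) simp
    qed
    with le have "(\<Sum>n<N. a (Suc n) ^ 2) * exp (- 4 * pi) \<le> C * real N ^ k"
      by (simp add: sum_distrib_right)
    then show ?thesis by (simp add: exp_minus field_simps)
  qed
  \<comment> \<open>The midpoint of k and 2 sigma - 1: above k for the squared coefficients, below 2
    sigma - 1 for the pure power. The hypothesis on sigma says exactly that there is room.\<close>
  define \<beta> where "\<beta> = (2 * \<sigma> - 1 + real k) / 2"
  have \<beta>: "\<beta> > real k" "\<beta> - 2 * \<sigma> < - 1" using assms by (auto simp: \<beta>_def field_simps)
  have "summable (\<lambda>n. real (Suc n) powr (\<beta> - 2 * \<sigma>))"
    using \<beta>(2) by (subst summable_Suc_iff) (simp add: summable_real_powr_iff)
  moreover have "summable (\<lambda>n. a (Suc n) ^ 2 * real (Suc n) powr (- \<beta>))"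
    by (rule summable_of_dyadic_growth[OF _ growth \<beta>(1)]) simp_all
  ultimately have sm: "summable (\<lambda>n. a (Suc n) ^ 2 * real (Suc n) powr (- \<beta>) + real (Suc n) powr (\<beta> - 2 * \<sigma>))"
    by (intro summable_add)
  show ?thesis
  proof (rule summable_comparison_test'[where N = 0, OF sm])
    fix n :: nat
    define u where "u = \<bar>a (Suc n)\<bar> * real (Suc n) powr (- \<beta> / 2)"
    define v where "v = real (Suc n) powr ((\<beta> - 2 * \<sigma>) / 2)"
    have uv: "u * v = \<bar>a (Suc n)\<bar> * real (Suc n) powr (- \<sigma>)"
      unfolding u_def v_def mult.assoc powr_add[symmetric] by (simp add: field_simps)
    have "u ^ 2 = a (Suc n) ^ 2 * real (Suc n) powr (- \<beta>)" "v ^ 2 = real (Suc n) powr (\<beta> - 2 * \<sigma>)"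
      unfolding u_def v_def power_mult_distrib power2_abs
      by (simp_all add: power2_eq_square flip: powr_add)
    moreover have "0 \<le> (u - v) ^ 2 + u ^ 2 + v ^ 2" by simp
    then have "u * v \<le> u ^ 2 + v ^ 2" by (simp add: power2_diff)
    ultimately show "norm (\<bar>a (Suc n)\<bar> * real (Suc n) powr (- \<sigma>)) \<le> a (Suc n) ^ 2 * real (Suc n) powr (- \<beta>) + real (Suc n) powr (\<beta> - 2 * \<sigma>)"
      using uv by simp
  qed
qed

end

section \<open>The completed twisted L-function\<close>

context cusp_form begin

text \<open>Here the realness of the coefficients enters: conjugation becomes reflection in the
  imaginary axis, which exchanges the cusps p/q and -p/q.\<close>

lemma f_reflect:
  assumes "Im \<tau> > 0" shows "f (- cnj \<tau>) = cnj (f \<tau>)"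
proof (rule sums_unique2)
  show "(\<lambda>n. of_real (a (Suc n)) * exp (2 * of_real pi * \<i> * of_nat (Suc n) * (- cnj \<tau>))) sums f (- cnj \<tau>)"
    using assms by (intro fourier_sums) simp
  have "(\<lambda>n. cnj (of_real (a (Suc n)) * exp (2 * of_real pi * \<i> * of_nat (Suc n) * \<tau>))) sums cnj (f \<tau>)"
    using fourier_sums[OF assms] by (simp only: sums_cnj)
  then show "(\<lambda>n. of_real (a (Suc n)) * exp (2 * of_real pi * \<i> * of_nat (Suc n) * (- cnj \<tau>))) sums cnj (f \<tau>)"
    by (simp add: exp_cnj)
qed

end

lemma exp_neg_exp_le:
  fixes c x :: real
  assumes "c > 0" shows "exp (- c * exp x) \<le> fact n / c ^ n * exp (- real n * x)"
proof -
  have "c ^ n * exp (real n * x) \<le> fact n * exp (c * exp x)"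
    using power_le_fact_mult_exp[of "c * exp x" n] assms
    by (simp only: exp_of_nat_mult) (simp add: power_mult_distrib)
  then show ?thesis using assms by (simp add: exp_minus field_simps)
qed

definition strip :: "complex set" where "strip = {y. \<bar>Im y\<bar> < pi / 2}"

lemma open_strip: "open strip" and convex_strip: "convex strip"
proof -
  have eq: "strip = {y. - (pi / 2) < Im y} \<inter> {y. Im y < pi / 2}" by (auto simp: strip_def)
  show "open strip" unfolding eq by (intro open_Int open_halfspace_Im_gt open_halfspace_Im_lt)
  show "convex strip" unfolding eq by (intro convex_Int convex_halfspace_Im_gt convex_halfspace_Im_lt)
qed

lemma Re_exp_pos: "y \<in> strip \<Longrightarrow> Re (exp y) > 0"
  using cos_gt_zero_pi[of "Im y"] by (auto simp: strip_def Re_exp)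

lemma of_real_in_strip [simp]: "of_real v \<in> strip" by (simp add: strip_def)

lemma add_of_real_in_strip_iff [simp]: "of_real v + y \<in> strip \<longleftrightarrow> y \<in> strip" by (simp add: strip_def)

locale twisted_cusp_form = cusp_form +
  fixes p q :: int
  assumes q_pos: "q > 0" and pq: "[p ^ 2 = 1] (mod q)"
begin

definition F :: "complex \<Rightarrow> complex" where
  "F X = f (of_int p / of_int q + \<i> * (X / of_int q))"

text \<open>\<open>F\<close> in a logarithmic coordinate. The right half-plane becomes
  \<open>strip\<close>, the Mellin transform a two-sided Laplace integral, rotation of the ray of
  integration a vertical translation, and inversion of X a change of sign.\<close>

definition G :: "complex \<Rightarrow> complex" where "G y = F (exp y)"

definition Lam :: "complex \<Rightarrow> complex" where
  "Lam s = (LBINT v. G (of_real v) * exp (s * of_real v))"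

lemma Im_F_arg: "Im (of_int p / of_int q + \<i> * (X / of_int q)) = Re X / of_int q"
  by (simp add: Im_divide_of_real[of _ "of_int q", simplified] Re_divide_of_real[of _ "of_int q", simplified])

text \<open>Because p^2 is 1 modulo q, the product (-p) p is -1, so inversion carries the cusp p/q
  to -p/q with the same denominator.\<close>

lemma F_reciprocal:
  assumes "Re X > 0"
  shows "f (of_int (- p) / of_int q + \<i> * (1 / X / of_int q)) = (\<i> * X) ^ k * F X"
proof -
  have "[- p * p = - 1] (mod q)"
    using cong_minus_minus_iff[of "p ^ 2" 1 q] pq by (simp add: power2_eq_square)
  moreover have "Re (X / of_int q) > 0"
    using assms q_pos by (simp add: Re_divide_of_real[of _ "of_int q", simplified])
  ultimately have "f (of_int (- p) / of_int q + \<i> / (of_int q ^ 2 * (X / of_int q)))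
      = (\<i> * of_int q * (X / of_int q)) ^ k * f (of_int p / of_int q + \<i> * (X / of_int q))"
    by (intro modular_at_cusp q_pos)
  moreover have "\<i> / (of_int q ^ 2 * (X / of_int q)) = \<i> * (1 / X / of_int q)"
    using q_pos by (simp add: power2_eq_square)
  moreover have "\<i> * of_int q * (X / of_int q) = \<i> * X" using q_pos by simp
  ultimately show ?thesis unfolding F_def by (simp only:)
qed

text \<open>Inversion moves p/q to -p/q and conjugation moves it back, so a relation of
  \<open>G\<close> with itself results.\<close>

lemma G_reflect: "cnj (G (of_real (- v))) = (\<i> * of_real (exp v)) ^ k * G (of_real v)"
proof -
  have "cnj (G (of_real (- v))) = f (- cnj (of_int p / of_int q + \<i> * (exp (of_real (- v)) / of_int q)))"
    unfolding G_def F_def using q_pos by (subst f_reflect) (auto simp: Im_F_arg Re_exp)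
  also have "- cnj (of_int p / of_int q + \<i> * (exp (of_real (- v)) / of_int q)) = of_int (- p) / of_int q + \<i> * (1 / exp (of_real v) / of_int q)"
    by (simp add: exp_cnj exp_minus field_simps)
  also have "f \<dots> = (\<i> * exp (of_real v)) ^ k * F (exp (of_real v))"
    by (rule F_reciprocal) (simp add: Re_exp)
  finally show ?thesis by (simp add: G_def exp_of_real)
qed

lemma G_holomorphic: "G holomorphic_on strip"
proof -
  have "(f \<circ> (\<lambda>y. of_int p / of_int q + \<i> * (exp y / of_int q))) holomorphic_on strip"
  proof (rule holomorphic_on_compose_gen[OF _ f_holomorphic])
    show "(\<lambda>y. of_int p / of_int q + \<i> * (exp y / of_int q)) holomorphic_on strip"
      using q_pos by (intro holomorphic_intros) auto
    show "(\<lambda>y. of_int p / of_int q + \<i> * (exp y / of_int q)) ` strip \<subseteq> {\<tau>. 0 < Im \<tau>}"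
      using q_pos Re_exp_pos by (auto simp: Im_F_arg)
  qed
  then show ?thesis by (simp add: G_def[abs_def] F_def o_def)
qed

lemma continuous_on_G: "continuous_on strip G"
  using G_holomorphic by (rule holomorphic_on_imp_continuous_on)

text \<open>For Re y nonnegative the height of the argument is at least a constant times exp(Re y),
  uniformly because cos(Im y) is at least cos theta. For Re y negative the reciprocal relation leads
  back to that case at the price of the weight factor.\<close>

lemma G_decay:
  assumes "\<theta> < pi / 2"
  obtains C where "C > 0" "\<And>y. \<bar>Im y\<bar> \<le> \<theta> \<Longrightarrow> norm (G y) \<le> C * exp (- K * \<bar>Re y\<bar>)"
proof (cases "\<theta> \<ge> 0")
  case False
  then show ?thesis by (intro that[of 1]) auto
next
  case True
  define y0 where "y0 = cos \<theta> / real_of_int q"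
  have y0: "y0 > 0" unfolding y0_def using True assms q_pos by (intro divide_pos_pos cos_gt_zero_pi) auto
  obtain C where C: "C > 0" "\<And>\<tau>. Im \<tau> \<ge> y0 \<Longrightarrow> norm (f \<tau>) \<le> C * exp (- 2 * pi * Im \<tau>)"
    using f_exp_bound[OF y0] by auto
  \<comment> \<open>The summand k absorbs the factor exp(-k Re y) that the reciprocal relation
    produces for negative Re y.\<close>
  define n where "n = nat \<lceil>\<bar>K\<bar>\<rceil> + k"
  have n: "real n \<ge> K + real k" unfolding n_def by linarith
  define C2 where "C2 = C * (fact n / (2 * pi * y0) ^ n)"
  have C2: "C2 > 0" using C y0 by (simp add: C2_def)
  have main: "norm (f \<tau>) \<le> C2 * exp (- real n * x)" if "Im \<tau> \<ge> y0 * exp x" "x \<ge> 0" for \<tau> x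
  proof -
    have "y0 * 1 \<le> y0 * exp x" using that y0 by (intro mult_left_mono) auto
    with that have "Im \<tau> \<ge> y0" by linarith
    from C(2)[OF this] have "norm (f \<tau>) \<le> C * exp (- 2 * pi * Im \<tau>)" .
    also have "\<dots> \<le> C * exp (- (2 * pi * y0) * exp x)"
      using C that by (auto simp: mult.assoc)
    also have "\<dots> \<le> C * (fact n / (2 * pi * y0) ^ n * exp (- real n * x))"
      using C y0 by (intro mult_left_mono exp_neg_exp_le) auto
    finally show ?thesis by (simp add: C2_def mult.assoc)
  qed
  have cosle: "y0 * exp x \<le> exp x * cos t / real_of_int q" if "\<bar>t\<bar> \<le> \<theta>" for x t
  proof -
    have "cos \<theta> \<le> cos \<bar>t\<bar>" using that assms by (intro cos_monotone_0_pi_le) auto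
    then have "cos \<theta> * exp x / real_of_int q \<le> cos \<bar>t\<bar> * exp x / real_of_int q"
      using q_pos by (intro divide_right_mono mult_right_mono) auto
    then show ?thesis by (simp add: y0_def mult.commute)
  qed
  show ?thesis
  proof (rule that[OF C2])
    fix y assume y: "\<bar>Im y\<bar> \<le> \<theta>"
    then have ys: "y \<in> strip" using assms by (simp add: strip_def)
    show "norm (G y) \<le> C2 * exp (- K * \<bar>Re y\<bar>)"
    proof (cases "Re y \<ge> 0")
      case True
      have "norm (G y) \<le> C2 * exp (- real n * Re y)"
        unfolding G_def F_def by (rule main) (use True cosle[OF y, of "Re y"] in \<open>auto simp: Im_F_arg Re_exp\<close>)
      also have "\<dots> \<le> C2 * exp (- K * \<bar>Re y\<bar>)"
        using C2 n True by (auto intro!: mult_right_mono)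
      finally show ?thesis .
    next
      case False
      have "norm (f (of_int (- p) / of_int q + \<i> * (1 / exp y / of_int q))) \<le> C2 * exp (- real n * (- Re y))"
      proof (rule main)
        have "Im (of_int (- p) / of_int q + \<i> * (1 / exp y / of_int q)) = exp (- Re y) * cos (- Im y) / of_int q"
          by (simp add: Re_divide_of_real[of _ "of_int q", simplified] Im_divide_of_real[of _ "of_int q", simplified] Re_exp exp_minus[symmetric] divide_inverse[of 1])
        with cosle[of "- Im y" "- Re y"] y show "y0 * exp (- Re y) \<le> Im (of_int (- p) / of_int q + \<i> * (1 / exp y / of_int q))"
          by simp
      qed (use False in auto)
      then have "exp (Re y) ^ k * norm (G y) \<le> C2 * exp (- real n * (- Re y))"
        unfolding F_reciprocal[OF Re_exp_pos[OF ys]] G_def by (simp add: norm_mult norm_power)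
      then have "norm (G y) \<le> C2 * exp (- real n * (- Re y)) * exp (- real k * Re y)"
        by (simp only: mult_minus_left exp_minus exp_of_nat_mult) (simp add: field_simps)
      also have "\<dots> = C2 * exp ((real n - real k) * Re y)"
        by (simp only: mult.assoc flip: exp_add) (simp add: algebra_simps)
      also have "\<dots> \<le> C2 * exp (- K * \<bar>Re y\<bar>)"
        using C2 n False by (auto intro!: mult_right_mono_neg)
      finally show ?thesis .
    qed
  qed
qed

lemma G_exp_bound:
  assumes "\<theta> < pi / 2"
  obtains C where "C > 0" "\<And>y v. \<bar>Im y\<bar> \<le> \<theta> \<Longrightarrow> norm (G (of_real v + y) * exp (s * of_real v)) \<le> C * exp ((\<bar>Re s\<bar> + 1) * \<bar>Re y\<bar>) * exp (- 1 * \<bar>v\<bar>)"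
proof -
  obtain C where C: "C > 0" "\<And>y. \<bar>Im y\<bar> \<le> \<theta> \<Longrightarrow> norm (G y) \<le> C * exp (- (\<bar>Re s\<bar> + 1) * \<bar>Re y\<bar>)"
    using G_decay[OF assms] by metis
  show ?thesis
  proof (rule that[OF C(1)])
    fix y v assume y: "\<bar>Im y\<bar> \<le> \<theta>"
    have "norm (G (of_real v + y) * exp (s * of_real v)) \<le> C * exp (- (\<bar>Re s\<bar> + 1) * \<bar>v + Re y\<bar>) * exp (\<bar>Re s\<bar> * \<bar>v\<bar>)"
      unfolding norm_mult using C(2)[of "of_real v + y"] y norm_exp_mult_of_real_le[of s v] C(1)
      by (intro mult_mono) auto
    also have "\<dots> \<le> C * exp (- (\<bar>Re s\<bar> + 1) * (\<bar>v\<bar> - \<bar>Re y\<bar>)) * exp (\<bar>Re s\<bar> * \<bar>v\<bar>)"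
    proof -
      have "(\<bar>Re s\<bar> + 1) * (\<bar>v\<bar> - \<bar>Re y\<bar>) \<le> (\<bar>Re s\<bar> + 1) * \<bar>v + Re y\<bar>"
        by (intro mult_left_mono) auto
      then have "exp (- (\<bar>Re s\<bar> + 1) * \<bar>v + Re y\<bar>) \<le> exp (- (\<bar>Re s\<bar> + 1) * (\<bar>v\<bar> - \<bar>Re y\<bar>))"
        by (simp only: mult_minus_left exp_le_cancel_iff neg_le_iff_le)
      then show ?thesis using C(1) by (intro mult_right_mono mult_left_mono) auto
    qed
    also have "\<dots> = C * exp ((\<bar>Re s\<bar> + 1) * \<bar>Re y\<bar>) * exp (- 1 * \<bar>v\<bar>)"
      by (simp only: mult.assoc flip: exp_add) (simp add: algebra_simps)
    finally show "norm (G (of_real v + y) * exp (s * of_real v)) \<le> C * exp ((\<bar>Re s\<bar> + 1) * \<bar>Re y\<bar>) * exp (- 1 * \<bar>v\<bar>)" .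
  qed
qed

lemma continuous_on_G_shift: "y \<in> strip \<Longrightarrow> continuous_on A (\<lambda>v. G (of_real v + y) * exp (s * of_real v))"
  by (intro continuous_intros continuous_on_compose2[OF continuous_on_G]) auto

lemma G_shift_integrable:
  assumes "y \<in> strip"
  shows "integrable lborel (\<lambda>v. G (of_real v + y) * exp (s * of_real v))"
proof -
  obtain C where C: "C > 0" "\<And>v. norm (G (of_real v + y) * exp (s * of_real v)) \<le> C * exp ((\<bar>Re s\<bar> + 1) * \<bar>Re y\<bar>) * exp (- 1 * \<bar>v\<bar>)"
    using G_exp_bound[of "\<bar>Im y\<bar>"] assms unfolding strip_def by (metis mem_Collect_eq order_refl)
  show ?thesis
  proof (rule Bochner_Integration.integrable_bound)
    show "integrable lborel (\<lambda>v. C * exp ((\<bar>Re s\<bar> + 1) * \<bar>Re y\<bar>) * exp (- 1 * \<bar>v\<bar>))"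
      by (intro integrable_mult_right integrable_exp_neg_abs) simp
    show "(\<lambda>v. G (of_real v + y) * exp (s * of_real v)) \<in> borel_measurable lborel"
      using continuous_on_G_shift[OF assms] by (simp add: borel_measurable_continuous_onI)
    show "AE v in lborel. norm (G (of_real v + y) * exp (s * of_real v)) \<le> norm (C * exp ((\<bar>Re s\<bar> + 1) * \<bar>Re y\<bar>) * exp (- 1 * \<bar>v\<bar>))"
      using C by (intro AE_I2) (auto intro: order_trans[OF _ abs_ge_self])
  qed
qed

lemma Lam_entire: "Lam holomorphic_on UNIV"
  unfolding Lam_def[abs_def]
proof (rule holomorphic_on_lborel_integral[where g' = "\<lambda>s v. G (of_real v) * (exp (s * of_real v) * of_real v)"])
  have Gc: "continuous_on A (\<lambda>x. G (of_real (snd x)))" for A :: "(complex \<times> real) set"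
    by (intro continuous_on_compose2[OF continuous_on_G] continuous_intros) auto
  show "continuous_on (UNIV \<times> UNIV) (\<lambda>(s, v). G (of_real v) * exp (s * of_real v))"
    "continuous_on (UNIV \<times> UNIV) (\<lambda>(s, v). G (of_real v) * (exp (s * of_real v) * of_real v))"
    unfolding case_prod_beta by (intro continuous_intros Gc)+
  show "((\<lambda>s. G (of_real v) * exp (s * of_real v)) has_field_derivative G (of_real v) * (exp (s * of_real v) * of_real v)) (at s)" for s v
    by (auto intro!: derivative_eq_intros)
  fix s0 :: complex
  obtain C where C: "C > 0" "\<And>y. \<bar>Im y\<bar> \<le> 0 \<Longrightarrow> norm (G y) \<le> C * exp (- (\<bar>Re s0\<bar> + 2) * \<bar>Re y\<bar>)"
    using G_decay[of 0] pi_gt_zero by (metis divide_pos_pos zero_less_numeral)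
  show "\<exists>d>0. cball s0 d \<subseteq> UNIV \<and> (\<exists>M. integrable lborel M \<and>
      (\<forall>s\<in>cball s0 d. \<forall>v. norm (G (of_real v) * exp (s * of_real v)) \<le> M v))"
  proof (intro exI[of _ 1] conjI exI[of _ "\<lambda>v. C * exp (- 1 * \<bar>v\<bar>)"] ballI allI)
    show "integrable lborel (\<lambda>v. C * exp (- 1 * \<bar>v\<bar>))" by (intro integrable_mult_right integrable_exp_neg_abs) simp
    fix s v assume "s \<in> cball s0 1"
    then have "\<bar>Re s\<bar> \<le> \<bar>Re s0\<bar> + 1"
      using abs_Re_le_cmod[of "s0 - s"] by (simp add: dist_norm)
    then have "\<bar>Re s\<bar> * \<bar>v\<bar> \<le> (\<bar>Re s0\<bar> + 1) * \<bar>v\<bar>" by (rule mult_right_mono) simp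
    then have "norm (exp (s * of_real v)) \<le> exp ((\<bar>Re s0\<bar> + 1) * \<bar>v\<bar>)"
      using norm_exp_mult_of_real_le[of s v] by (meson exp_le_cancel_iff order_trans)
    then have "norm (G (of_real v) * exp (s * of_real v)) \<le> C * exp (- (\<bar>Re s0\<bar> + 2) * \<bar>v\<bar>) * exp ((\<bar>Re s0\<bar> + 1) * \<bar>v\<bar>)"
      unfolding norm_mult using C(2)[of "of_real v"] C(1) by (intro mult_mono) auto
    also have "\<dots> = C * exp (- 1 * \<bar>v\<bar>)"
      by (simp only: mult.assoc flip: exp_add) (simp add: algebra_simps)
    finally show "norm (G (of_real v) * exp (s * of_real v)) \<le> C * exp (- 1 * \<bar>v\<bar>)" .
  qed auto
qed auto

text \<open>The shift of contour is obtained without rectangles: the shifted integral is holomorphic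
  in y on the strip and constant for real y, so the identity theorem makes it constant
  throughout.\<close>

lemma Lam_rotate:
  assumes "y \<in> strip"
  shows "Lam s = (LBINT v. G (of_real v + y) * exp (s * (of_real v + y)))"
proof -
  define R where "R y = (LBINT v. G (of_real v + y) * exp (s * (of_real v + y)))" for y
  define G' where "G' = deriv G"
  have G': "(G has_field_derivative G' z) (at z)" if "z \<in> strip" for z
    unfolding G'_def by (rule holomorphic_derivI[OF G_holomorphic open_strip that])
  have G'c: "continuous_on strip G'"
    unfolding G'_def by (intro holomorphic_on_imp_continuous_on holomorphic_deriv G_holomorphic open_strip)
  have hol: "R holomorphic_on strip"
    unfolding R_def[abs_def]
  proof (rule holomorphic_on_lborel_integral[OF open_strip convex_strip,
       where g' = "\<lambda>y v. G' (of_real v + y) * exp (s * (of_real v + y)) + G (of_real v + y) * (exp (s * (of_real v + y)) * s)"])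
    show "continuous_on (strip \<times> UNIV) (\<lambda>(z, v). G (of_real v + z) * exp (s * (of_real v + z)))"
      "continuous_on (strip \<times> UNIV) (\<lambda>(z, v). G' (of_real v + z) * exp (s * (of_real v + z)) + G (of_real v + z) * (exp (s * (of_real v + z)) * s))"
      unfolding case_prod_beta
      by (intro continuous_intros continuous_on_compose2[OF continuous_on_G] continuous_on_compose2[OF G'c]; auto)+
    show "((\<lambda>z. G (of_real v + z) * exp (s * (of_real v + z))) has_field_derivative
        G' (of_real v + z) * exp (s * (of_real v + z)) + G (of_real v + z) * (exp (s * (of_real v + z)) * s)) (at z)"
      if "z \<in> strip" for z v
      using that by (auto intro!: derivative_eq_intros DERIV_chain2[OF G'])
    fix y0 assume y0: "y0 \<in> strip"
    define d where "d = (pi / 2 - \<bar>Im y0\<bar>) / 2"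
    have d: "d > 0" "\<bar>Im y0\<bar> + d < pi / 2" using y0 by (auto simp: d_def strip_def field_simps)
    obtain C where C: "C > 0" "\<And>y v. \<bar>Im y\<bar> \<le> \<bar>Im y0\<bar> + d \<Longrightarrow> norm (G (of_real v + y) * exp (s * of_real v)) \<le> C * exp ((\<bar>Re s\<bar> + 1) * \<bar>Re y\<bar>) * exp (- 1 * \<bar>v\<bar>)"
      using G_exp_bound[OF d(2)] by metis
    define B where "B = C * exp ((\<bar>Re s\<bar> + 1) * (norm y0 + d)) * exp (norm s * (norm y0 + d))"
    show "\<exists>d>0. cball y0 d \<subseteq> strip \<and> (\<exists>M. integrable lborel M \<and>
        (\<forall>z\<in>cball y0 d. \<forall>v. norm (G (of_real v + z) * exp (s * (of_real v + z))) \<le> M v))"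
    proof (intro exI[of _ d] conjI exI[of _ "\<lambda>v. B * exp (- 1 * \<bar>v\<bar>)"] ballI allI)
      have im: "\<bar>Im z\<bar> \<le> \<bar>Im y0\<bar> + d" and nz: "norm z \<le> norm y0 + d" if "z \<in> cball y0 d" for z
        using that abs_Im_le_cmod[of "y0 - z"] norm_triangle_sub[of z y0]
        by (auto simp: dist_norm norm_minus_commute)
      show "cball y0 d \<subseteq> strip" using im d by (fastforce simp: strip_def)
      show "integrable lborel (\<lambda>v. B * exp (- 1 * \<bar>v\<bar>))" by (intro integrable_mult_right integrable_exp_neg_abs) simp
      fix z v assume z: "z \<in> cball y0 d"
      have "norm (G (of_real v + z) * exp (s * (of_real v + z))) = norm (G (of_real v + z) * exp (s * of_real v)) * norm (exp (s * z))"
        by (simp add: algebra_simps exp_add norm_mult del: norm_exp_eq_Re)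
      also have "\<dots> \<le> (C * exp ((\<bar>Re s\<bar> + 1) * (norm y0 + d)) * exp (- 1 * \<bar>v\<bar>)) * exp (norm s * (norm y0 + d))"
      proof (intro mult_mono)
        have "\<bar>Re z\<bar> \<le> norm y0 + d" using nz[OF z] abs_Re_le_cmod[of z] by linarith
        then have "(\<bar>Re s\<bar> + 1) * \<bar>Re z\<bar> \<le> (\<bar>Re s\<bar> + 1) * (norm y0 + d)" by (intro mult_left_mono) auto
        then have "C * exp ((\<bar>Re s\<bar> + 1) * \<bar>Re z\<bar>) * exp (- 1 * \<bar>v\<bar>) \<le> C * exp ((\<bar>Re s\<bar> + 1) * (norm y0 + d)) * exp (- 1 * \<bar>v\<bar>)"
          using C(1) by simp
        then show "norm (G (of_real v + z) * exp (s * of_real v)) \<le> C * exp ((\<bar>Re s\<bar> + 1) * (norm y0 + d)) * exp (- 1 * \<bar>v\<bar>)"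
          using C(2)[OF im[OF z], of v] by linarith
        have "norm (exp (s * z)) \<le> exp (norm (s * z))" by (rule norm_exp)
        also have "\<dots> \<le> exp (norm s * (norm y0 + d))"
          using nz[OF z] by (simp add: norm_mult mult_left_mono)
        finally show "norm (exp (s * z)) \<le> exp (norm s * (norm y0 + d))" .
      qed (use C in auto)
      also have "\<dots> = B * exp (- 1 * \<bar>v\<bar>)" by (simp add: B_def)
      finally show "norm (G (of_real v + z) * exp (s * (of_real v + z))) \<le> B * exp (- 1 * \<bar>v\<bar>)" .
    qed (use d in auto)
  qed
  \<comment> \<open>For a real shift this is translation invariance of Lebesgue measure.\<close>
  have real: "R (of_real x) = Lam s" for x
    using lborel_integral_real_affine[of 1 "\<lambda>v. G (of_real v) * exp (s * of_real v)" x]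
    by (simp add: R_def Lam_def add.commute)
  have "R y - Lam s = 0"
  proof (rule analytic_continuation[where f = "\<lambda>y. R y - Lam s" and S = strip and U = "\<real>" and \<xi> = 0])
    show "(\<lambda>y. R y - Lam s) holomorphic_on strip" by (intro holomorphic_intros hol)
    show "(0::complex) islimpt \<real>"
    proof (rule islimptI)
      fix T :: "complex set" assume "0 \<in> T" "open T"
      then obtain e where e: "e > 0" "ball 0 e \<subseteq> T" using openE by blast
      then have "of_real (e / 2) \<in> T" by (auto simp: subset_iff)
      then show "\<exists>y\<in>\<real>. y \<in> T \<and> y \<noteq> 0" using e(1) by (intro bexI[of _ "of_real (e / 2)"]) auto
    qed
    show "\<real> \<subseteq> strip" by (auto simp: Reals_def)
    show "0 \<in> strip" by (simp add: strip_def)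
    show "R z - Lam s = 0" if "z \<in> \<real>" for z using that real by (auto simp: Reals_def)
  qed (use assms open_strip convex_strip convex_connected in auto)
  then show ?thesis by (simp add: R_def)
qed

lemma Lam_rotate':
  assumes "y \<in> strip"
  shows "Lam s * exp (- s * y) = (LBINT v. G (of_real v + y) * exp (s * of_real v))"
proof -
  have "Lam s = (LBINT v. G (of_real v + y) * exp (s * of_real v) * exp (s * y))"
    unfolding Lam_rotate[OF assms] by (simp add: distrib_left exp_add mult.assoc)
  also have "\<dots> = (LBINT v. G (of_real v + y) * exp (s * of_real v)) * exp (s * y)" by simp
  finally show ?thesis by (simp add: exp_minus)
qed

text \<open>Shifting by y = i theta or -i theta, with the sign of t, puts the factor |exp(s y)| =
  exp(-theta |t|) in front of an integral bounded uniformly in t. A negative theta is reduced to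
  theta = 0.\<close>

lemma Lam_vertical_decay: "exp_decay (\<lambda>t. Lam (of_real \<sigma> + \<i> * of_real t))"
proof -
  have Lc: "continuous_on UNIV Lam" using Lam_entire by (rule holomorphic_on_imp_continuous_on)
  have nonneg: "\<exists>C. \<forall>t. norm (Lam (of_real \<sigma> + \<i> * of_real t)) \<le> C * exp (- \<theta> * \<bar>t\<bar>)" if \<theta>: "0 \<le> \<theta>" "\<theta> < pi / 2" for \<theta>
  proof -
    obtain C where C: "C > 0" "\<And>y v. \<bar>Im y\<bar> \<le> \<theta> \<Longrightarrow> norm (G (of_real v + y) * exp (of_real \<sigma> * of_real v)) \<le> C * exp ((\<bar>Re (of_real \<sigma>)\<bar> + 1) * \<bar>Re y\<bar>) * exp (- 1 * \<bar>v\<bar>)"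
      using G_exp_bound[OF \<theta>(2)] by metis
    define I where "I = (LBINT v. C * exp (- 1 * \<bar>v\<bar>))"
    have Ii: "integrable lborel (\<lambda>v. C * exp (- 1 * \<bar>v\<bar>))" by (intro integrable_mult_right integrable_exp_neg_abs) simp
    have "norm (Lam (of_real \<sigma> + \<i> * of_real t)) \<le> I * exp (- \<theta> * \<bar>t\<bar>)" for t
    proof -
      define y where "y = \<i> * of_real (if t \<ge> 0 then \<theta> else - \<theta>)"
      have y: "\<bar>Im y\<bar> \<le> \<theta>" "Re y = 0" "y \<in> strip" using \<theta> by (auto simp: y_def strip_def)
      let ?s = "of_real \<sigma> + \<i> * of_real t :: complex"
      have "Re (?s * y) = - \<theta> * \<bar>t\<bar>" by (simp add: y_def)
      then have e: "norm (exp (?s * y)) = exp (- \<theta> * \<bar>t\<bar>)" by simp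
      have "norm (Lam ?s) = norm (LBINT v. G (of_real v + y) * exp (?s * of_real v)) * exp (- \<theta> * \<bar>t\<bar>)"
      proof -
        have "exp (- ?s * y) * exp (?s * y) = 1" unfolding mult_minus_left exp_minus by simp
        then have "norm (exp (- ?s * y)) * norm (exp (?s * y)) = 1" by (metis norm_mult norm_one)
        then show ?thesis
          unfolding Lam_rotate'[OF y(3), symmetric] norm_mult e[symmetric] mult.assoc by simp
      qed
      also have "norm (LBINT v. G (of_real v + y) * exp (?s * of_real v)) \<le> (LBINT v. norm (G (of_real v + y) * exp (?s * of_real v)))"
        by (rule integral_norm_bound)
      also have "\<dots> \<le> I" unfolding I_def
      proof (rule integral_mono[OF integrable_norm[OF G_shift_integrable[OF y(3)]] Ii])
        fix v
        have "norm (G (of_real v + y) * exp (?s * of_real v)) = norm (G (of_real v + y) * exp (of_real \<sigma> * of_real v))"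
          by (simp add: norm_mult)
        also have "\<dots> \<le> C * exp (- 1 * \<bar>v\<bar>)" using C(2)[OF y(1), of v] y(2) by simp
        finally show "norm (G (of_real v + y) * exp (?s * of_real v)) \<le> C * exp (- 1 * \<bar>v\<bar>)" .
      qed
      finally show ?thesis by simp
    qed
    then show ?thesis by blast
  qed
  have "\<exists>C. \<forall>t. norm (Lam (of_real \<sigma> + \<i> * of_real t)) \<le> C * exp (- \<theta> * \<bar>t\<bar>)" if "\<theta> < pi / 2" for \<theta>
  proof (cases "\<theta> \<ge> 0")
    case False
    obtain C where C: "\<And>t. norm (Lam (of_real \<sigma> + \<i> * of_real t)) \<le> C * exp (- 0 * \<bar>t\<bar>)"
      using nonneg[of 0] by auto
    have C0: "C \<ge> 0" using order_trans[OF norm_ge_zero C[of 0]] by simp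
    have "norm (Lam (of_real \<sigma> + \<i> * of_real t)) \<le> C * exp (- \<theta> * \<bar>t\<bar>)" for t
    proof -
      have "C * 1 \<le> C * exp (- \<theta> * \<bar>t\<bar>)" using False C0 by (intro mult_left_mono) (auto simp: mult_nonpos_nonneg)
      with C[of t] show ?thesis by simp
    qed
    then show ?thesis by blast
  qed (use nonneg that in auto)
  moreover have "continuous_on UNIV (\<lambda>t. Lam (of_real \<sigma> + \<i> * of_real t))"
    by (intro continuous_on_compose2[OF Lc] continuous_intros) auto
  ultimately show ?thesis unfolding exp_decay_def by blast
qed

text \<open>Mellin inversion at a complex point. Fourier inversion is applied to the line through y;
  the factor exp(-i y t) grows at rate |Im y| < pi/2, which the vertical decay of \<open>Lam\<close>
  outweighs.\<close>

lemma Lam_inversion: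
  assumes y: "y \<in> strip"
  shows "(LBINT t. Lam (of_real \<sigma> + \<i> * of_real t) * exp (- \<i> * y * of_real t)) = of_real (2 * pi) * (G y * exp (of_real \<sigma> * y))"
proof -
  let ?h = "\<lambda>v. G (of_real v + y) * exp (of_real \<sigma> * of_real v)"
  let ?H = "\<lambda>t. Lam (of_real \<sigma> + \<i> * of_real t) * exp (- (of_real \<sigma> + \<i> * of_real t) * y)"
  have H2: "?H t = exp (- of_real \<sigma> * y) * (Lam (of_real \<sigma> + \<i> * of_real t) * of_real t ^ 0 * exp (- \<i> * y * of_real t))" for t
    by (simp add: algebra_simps flip: exp_add)
  obtain C where C: "C > 0" "\<And>v. norm (?h v) \<le> C * exp ((\<bar>Re (of_real \<sigma>)\<bar> + 1) * \<bar>Re y\<bar>) * exp (- 1 * \<bar>v\<bar>)"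
    using G_exp_bound[of "\<bar>Im y\<bar>"] y unfolding strip_def by (metis mem_Collect_eq order_refl)
  have "(LBINT t. ?H t) = of_real (2 * pi) * ?h 0"
  proof (rule fourier_inversion_at_zero)
    show "continuous_on UNIV ?h" by (rule continuous_on_G_shift[OF y])
    show "integrable lborel ?h" by (rule G_shift_integrable[OF y])
    show "norm (?h v) \<le> C * exp ((\<bar>Re (of_real \<sigma>)\<bar> + 1) * \<bar>Re y\<bar>)" for v
    proof -
      have "C * exp ((\<bar>Re (of_real \<sigma>)\<bar> + 1) * \<bar>Re y\<bar>) * exp (- 1 * \<bar>v\<bar>) \<le> C * exp ((\<bar>Re (of_real \<sigma>)\<bar> + 1) * \<bar>Re y\<bar>) * 1"
        using C(1) by (intro mult_left_mono) auto
      with C(2)[of v] show ?thesis by linarith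
    qed
    show "?H t = (LBINT v. ?h v * exp (\<i> * of_real (t * v)))" for t
      unfolding Lam_rotate'[OF y] by (simp add: algebra_simps exp_add)
    show "integrable lborel ?H"
      unfolding H2 using y by (intro integrable_mult_right exp_decay_integrable[OF Lam_vertical_decay]) (simp add: strip_def)
  qed
  then have "exp (- of_real \<sigma> * y) * (LBINT t. Lam (of_real \<sigma> + \<i> * of_real t) * exp (- \<i> * y * of_real t)) = of_real (2 * pi) * G y"
    unfolding H2 by simp
  then show ?thesis by (simp add: exp_minus field_simps)
qed

text \<open>The functional equation joined with conjugation, from v to -v in the integral. On the
  critical line k - conj(s) = s, so it says that \<open>Lam\<close> is real there up to a
  constant.\<close>

lemma Lam_reflect: "cnj (Lam s) = \<i> ^ k * Lam (of_nat k - cnj s)"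
proof -
  have "cnj (Lam s) = (LBINT v. cnj (G (of_real v)) * exp (cnj s * of_real v))"
    unfolding Lam_def by (subst Bochner_Integration.integral_cnj[symmetric]) (simp add: exp_cnj)
  also have "\<dots> = (LBINT v. cnj (G (of_real (- v))) * exp (cnj s * of_real (- v)))"
    using lborel_integral_real_affine[of "-1" "\<lambda>v. cnj (G (of_real v)) * exp (cnj s * of_real v)" 0] by simp
  also have "\<dots> = (LBINT v. \<i> ^ k * (G (of_real v) * exp ((of_nat k - cnj s) * of_real v)))"
  proof (rule Bochner_Integration.integral_cong)
    fix v
    have "of_real (exp v) ^ k = exp (of_nat k * of_real v :: complex)"
      by (simp add: exp_of_nat_mult exp_of_real)
    then show "cnj (G (of_real (- v))) * exp (cnj s * of_real (- v)) = \<i> ^ k * (G (of_real v) * exp ((of_nat k - cnj s) * of_real v))"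
      unfolding G_reflect by (simp add: power_mult_distrib left_diff_distrib exp_diff exp_minus field_simps)
  qed simp
  also have "\<dots> = \<i> ^ k * Lam (of_nat k - cnj s)" unfolding Lam_def by simp
  finally show ?thesis .
qed

end

section \<open>The Gamma integral over the real line and the Dirichlet series\<close>

lemma lborel_integral_eq_of_absolutely_integrable:
  fixes g :: "real \<Rightarrow> real"
  assumes "continuous_on UNIV g" "g absolutely_integrable_on UNIV"
  shows "integrable lborel g" "(LBINT v. g v) = integral UNIV g"
proof -
  have "integrable lebesgue g" using assms(2) by (simp add: set_integrable_def)
  then show int: "integrable lborel g"
    by (subst (asm) integrable_completion) (use assms(1) in \<open>simp_all add: borel_measurable_continuous_onI\<close>)
  show "(LBINT v. g v) = integral UNIV g"
    using has_integral_integral_lborel[OF int] by (simp add: integral_unique)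
qed

text \<open>Euler's integral under t = exp v. The change of variables is made for real-valued
  functions, with \<open>L\<close> standing for the real and then the imaginary part.\<close>

lemma Gamma_integral_log_aux:
  fixes s :: complex
  assumes "Re s > 0"
  defines "g \<equiv> \<lambda>v. of_real (exp (- exp v)) * exp (s * of_real v)"
  shows "integrable lborel g" "(LBINT v. g v) = Gamma s"
proof -
  define h where "h t = of_real t powr (s - 1) / of_real (exp t)" for t :: real
  have abs: "h absolutely_integrable_on {0<..}" and int: "(h has_integral Gamma s) {0<..}"
    unfolding h_def using absolutely_integrable_Gamma_integral'[OF assms(1)] Gamma_integral_complex'[OF assms(1)] by auto
  have gh: "of_real (exp v) * h (exp v) = g v" for v
    unfolding h_def g_def
    by (simp add: powr_def Ln_of_real exp_minus exp_diff left_diff_distrib exp_of_real field_simps)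
  have range: "range exp = {0::real<..}"
  proof -
    have "x \<in> range exp" if "x > 0" for x :: real
      using that by (intro image_eqI[of _ _ "ln x"]) auto
    then show ?thesis by auto
  qed
  have cont: "continuous_on UNIV g" unfolding g_def by (intro continuous_intros)
  have part: "integrable lborel (\<lambda>v. L (g v)) \<and> (LBINT v. L (g v)) = L (Gamma s)"
    if L: "bounded_linear L" for L :: "complex \<Rightarrow> real"
  proof -
    interpret bounded_linear L by (rule L)
    have "(\<lambda>t. L (h t)) absolutely_integrable_on {0<..}"
      using absolutely_integrable_linear[OF abs L] by (simp add: o_def)
    moreover have "integral {0<..} (\<lambda>t. L (h t)) = L (Gamma s)"
      using has_integral_linear[OF int L] by (simp add: o_def integral_unique)
    moreover have "exp v *\<^sub>R L (h (exp v)) = L (g v)" for v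
      unfolding gh[symmetric] by (simp add: scaleR flip: scaleR_conv_of_real)
    ultimately have "(\<lambda>v. L (g v)) absolutely_integrable_on UNIV \<and> integral UNIV (\<lambda>v. L (g v)) = L (Gamma s)"
      using has_absolute_integral_change_of_variables_1'[of UNIV exp exp "\<lambda>t. L (h t)" "L (Gamma s)"]
      by (simp add: range inj_on_def DERIV_exp)
    moreover have "continuous_on UNIV (\<lambda>v. L (g v))" by (intro continuous_on cont)
    ultimately show ?thesis using lborel_integral_eq_of_absolutely_integrable[of "\<lambda>v. L (g v)"] by simp
  qed
  have eq: "g = (\<lambda>v. of_real (Re (g v)) + \<i> * of_real (Im (g v)))" by (intro ext) (rule complex_eq)
  show "integrable lborel g"
    by (subst eq) (use part[OF bounded_linear_Re] part[OF bounded_linear_Im] in auto)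
  then show "(LBINT v. g v) = Gamma s"
    using part[OF bounded_linear_Re] part[OF bounded_linear_Im] by (simp add: complex_eq_iff)
qed

lemma rGamma_mult_Gamma:
  assumes "Re s > 0" shows "rGamma s * Gamma s = 1"
proof -
  have "s \<notin> \<int>\<^sub>\<le>\<^sub>0" using assms by (auto elim!: nonpos_Ints_cases)
  then show ?thesis by (simp add: rGamma_inverse_Gamma Gamma_eq_zero_iff)
qed

lemma powr_of_real_pos: "x > 0 \<Longrightarrow> of_real x powr (s :: complex) = exp (s * of_real (ln x))"
  by (simp add: powr_def Ln_of_real)

lemma Gamma_integral_log:
  fixes s :: complex
  assumes s: "Re s > 0" and c: "c > 0"
  shows "integrable lborel (\<lambda>v. of_real (exp (- c * exp v)) * exp (s * of_real v))"
    "(LBINT v. of_real (exp (- c * exp v)) * exp (s * of_real v)) = Gamma s * of_real c powr (- s)"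
proof -
  define g where "g v = of_real (exp (- exp v)) * exp (s * of_real v)" for v
  have g: "integrable lborel g" "(LBINT v. g v) = Gamma s"
    unfolding g_def[abs_def] by (fact Gamma_integral_log_aux[OF s])+
  have eq: "of_real (exp (- c * exp v)) * exp (s * of_real v) = g (ln c + 1 * v) * of_real c powr (- s)" for v
  proof -
    have "exp (ln c + 1 * v) = c * exp v" using c by (simp add: exp_add)
    moreover have "exp (s * of_real (ln c + 1 * v)) = exp (s * of_real (ln c)) * exp (s * of_real v)"
      by (simp add: distrib_left exp_add)
    moreover have "of_real c powr (- s) = inverse (exp (s * of_real (ln c)))"
      using c by (simp add: powr_of_real_pos exp_minus)
    ultimately show ?thesis unfolding g_def by simp
  qed
  show "integrable lborel (\<lambda>v. of_real (exp (- c * exp v)) * exp (s * of_real v))"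
    unfolding eq by (rule integrable_mult_left[OF lborel_integrable_real_affine[OF g(1), of 1 "ln c"]]) simp
  have "(LBINT v. g (ln c + 1 * v)) = Gamma s"
    using lborel_integral_real_affine[of 1 g "ln c"] g(2) by (simp only: abs_one scaleR_one)
  moreover have "(LBINT v. g (ln c + 1 * v) * of_real c powr (- s)) = (LBINT v. g (ln c + 1 * v)) * of_real c powr (- s)"
    by (rule integral_mult_left_zero)
  moreover have "(LBINT v. of_real (exp (- c * exp v)) * exp (s * of_real v)) = (LBINT v. g (ln c + 1 * v) * of_real c powr (- s))"
    by (rule Bochner_Integration.integral_cong[OF refl eq])
  ultimately show "(LBINT v. of_real (exp (- c * exp v)) * exp (s * of_real v)) = Gamma s * of_real c powr (- s)"
    by metis
qed

context twisted_cusp_form begin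

text \<open>The inverse of the completion. Using the reciprocal Gamma function makes it visibly
  entire, with no poles to cancel.\<close>

definition Lfun :: "complex \<Rightarrow> complex" where
  "Lfun s = rGamma s * exp (s * of_real (ln (2 * pi / of_int q))) * Lam s"

text \<open>The Fourier series of \<open>G\<close> is integrated term by term against exp(s v); each
  term is a Gamma integral and gives one term of the Dirichlet series.\<close>

lemma entire_ext_Lfun: "entire_ext_twisted_L k a (of_int p / of_int q) Lfun"
  unfolding entire_ext_twisted_L_def
proof (intro conjI allI impI)
  show "Lfun holomorphic_on UNIV"
    unfolding Lfun_def[abs_def] by (intro holomorphic_intros Lam_entire)
  fix s :: complex assume Re_s: "(real k + 1) / 2 < Re s"
  then have s: "Re s > 0" by (smt (verit) divide_nonneg_nonneg of_nat_0_le_iff)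
  define x :: real where "x = of_int p / of_int q"
  define d where "d n = of_real (a (Suc n)) * exp (2 * of_real pi * \<i> * of_nat (Suc n) * of_real x)" for n
  define c where "c n = 2 * pi / of_int q * real (Suc n)" for n
  have c: "c n > 0" for n using q_pos by (simp add: c_def)
  have nd: "norm (d n) = \<bar>a (Suc n)\<bar>" for n unfolding d_def norm_fourier_term by simp
  define h where "h n v = d n * (of_real (exp (- c n * exp v)) * exp (s * of_real v))" for n v
  have nh: "norm (h n v) = \<bar>a (Suc n)\<bar> * (exp (- c n * exp v) * exp (Re s * v))" for n v
    by (simp add: h_def norm_mult nd)
  have real_int: "(LBINT v. exp (- c n * exp v) * exp (Re s * v)) = Gamma (Re s) * c n powr (- Re s)" for n
  proof -
    have "complex_of_real (LBINT v. exp (- c n * exp v) * exp (Re s * v)) = (LBINT v. of_real (exp (- c n * exp v)) * exp (of_real (Re s) * of_real v))"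
      by (simp flip: integral_complex_of_real add: exp_of_real[symmetric])
    also have "\<dots> = Gamma (of_real (Re s)) * of_real (c n) powr (- of_real (Re s))"
      by (rule Gamma_integral_log) (use s c in auto)
    also have "\<dots> = of_real (Gamma (Re s) * c n powr (- Re s))"
      using c[of n] by (simp add: Gamma_complex_of_real powr_of_real flip: of_real_minus)
    finally show ?thesis by (simp only: of_real_eq_iff)
  qed
  have hsum: "(\<lambda>n. h n v) sums (G (of_real v) * exp (s * of_real v))" for v
  proof -
    have "(\<lambda>n. of_real (a (Suc n)) * exp (2 * of_real pi * \<i> * of_nat (Suc n) * (of_int p / of_int q + \<i> * (exp (of_real v) / of_int q)))) sums G (of_real v)"
      unfolding G_def F_def using q_pos by (intro fourier_sums) (auto simp: Im_F_arg Re_exp)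
    moreover have "exp (2 * of_real pi * \<i> * of_nat (Suc n) * (of_int p / of_int q + \<i> * (exp (of_real v) / of_int q)))
        = exp (2 * of_real pi * \<i> * of_nat (Suc n) * of_real x) * of_real (exp (- c n * exp v))" for n
    proof -
      have "2 * of_real pi * \<i> * of_nat (Suc n) * (of_int p / of_int q + \<i> * (exp (of_real v) / of_int q))
        = 2 * of_real pi * \<i> * of_nat (Suc n) * of_real x + of_real (- c n * exp v)"
      proof -
        have "of_int p / of_int q + \<i> * (exp (of_real v) / of_int q) = of_real x + \<i> * of_real (exp v / of_int q)"
          by (simp add: x_def exp_of_real)
        moreover have "- c n * exp v = - (2 * pi * real (Suc n) * (exp v / of_int q))" by (simp add: c_def)
        moreover have "2 * of_real pi * \<i> * of_nat (Suc n) * (of_real x + \<i> * of_real y)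
            = 2 * of_real pi * \<i> * of_nat (Suc n) * of_real x + of_real (- (2 * pi * real (Suc n) * y))" for y
          by (simp add: complex_eq_iff)
        ultimately show ?thesis by (simp only:)
      qed
      then show ?thesis by (simp only: exp_add exp_of_real)
    qed
    ultimately have "(\<lambda>n. d n * of_real (exp (- c n * exp v))) sums G (of_real v)"
      by (simp add: d_def mult.assoc)
    from sums_mult2[OF this, of "exp (s * of_real v)"] show ?thesis by (simp add: h_def mult.assoc)
  qed
  \<comment> \<open>The integrals of the norms are a constant times |a(n)| n^(-Re s), so the
    exchange is justified exactly where the mean-square bound gives summability.\<close>
  have "(\<lambda>n. LBINT v. h n v) sums (LBINT v. \<Sum>n. h n v)"
  proof (rule sums_integral)
    show "integrable lborel (h n)" for n
      unfolding h_def by (intro integrable_mult_right Gamma_integral_log s c)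
    have "summable (\<lambda>n. norm (h n v))" for v
    proof -
      have "summable (\<lambda>n. \<bar>a (Suc n)\<bar> * exp (- 2 * pi * real (Suc n) * (exp v / of_int q)))"
        by (rule summable_fourier_abs) (use q_pos in simp)
      then have "summable (\<lambda>n. \<bar>a (Suc n)\<bar> * exp (- 2 * pi * real (Suc n) * (exp v / of_int q)) * exp (Re s * v))"
        by (rule summable_mult2)
      then show ?thesis unfolding nh c_def by (simp add: mult_ac)
    qed
    then show "AE v in lborel. summable (\<lambda>n. norm (h n v))" by simp
    have "summable (\<lambda>n. Gamma (Re s) * (2 * pi / of_int q) powr (- Re s) * (\<bar>a (Suc n)\<bar> * real (Suc n) powr (- Re s)))"
      by (intro summable_mult summable_coeff_powr Re_s)
    moreover have "(LBINT v. norm (h n v)) = Gamma (Re s) * (2 * pi / of_int q) powr (- Re s) * (\<bar>a (Suc n)\<bar> * real (Suc n) powr (- Re s))" for n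
      unfolding nh integral_mult_right_zero real_int unfolding c_def using q_pos
      by (subst powr_mult) (auto simp: mult_ac)
    ultimately show "summable (\<lambda>n. LBINT v. norm (h n v))" by simp
  qed
  also have "(\<lambda>v. \<Sum>n. h n v) = (\<lambda>v. G (of_real v) * exp (s * of_real v))"
    by (intro ext sums_unique[OF hsum, symmetric])
  also have "(LBINT v. G (of_real v) * exp (s * of_real v)) = Lam s" by (simp add: Lam_def)
  finally have "(\<lambda>n. LBINT v. h n v) sums Lam s" .
  then have "(\<lambda>n. rGamma s * exp (s * of_real (ln (2 * pi / of_int q))) * (LBINT v. h n v)) sums Lfun s"
    unfolding Lfun_def by (rule sums_mult)
  moreover have "rGamma s * exp (s * of_real (ln (2 * pi / of_int q))) * (LBINT v. h n v) = d n / of_nat (Suc n) powr s" for n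
  proof -
    have q': "2 * pi / of_int q > 0" using q_pos by simp
    have "(LBINT v. h n v) = d n * (Gamma s * of_real (c n) powr (- s))"
      unfolding h_def integral_mult_right_zero Gamma_integral_log(2)[OF s c] ..
    also have "of_real (c n) powr (- s) = exp (- s * of_real (ln (2 * pi / of_int q))) / of_nat (Suc n) powr s"
    proof -
      have "of_nat (Suc n) powr s = exp (s * of_real (ln (real (Suc n))))"
        using powr_of_real_pos[of "real (Suc n)" s] by simp
      moreover have "ln (c n) = ln (2 * pi / of_int q) + ln (real (Suc n))"
        unfolding c_def by (rule ln_mult_pos) (use q' in auto)
      ultimately show ?thesis using c[of n]
        by (simp only: powr_of_real_pos of_real_add distrib_left exp_add) (simp add: exp_minus divide_inverse)
    qed
    finally have "(LBINT v. h n v) = d n * (Gamma s * (exp (- s * of_real (ln (2 * pi / of_int q))) / of_nat (Suc n) powr s))" .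
    moreover have "rGamma s * Gamma s = 1" by (rule rGamma_mult_Gamma[OF s])
    moreover have "exp (s * of_real (ln (2 * pi / of_int q))) * exp (- s * of_real (ln (2 * pi / of_int q))) = 1"
      by (simp flip: exp_add)
    ultimately show ?thesis by (simp add: field_simps)
  qed
  ultimately show "(\<lambda>n. of_real (a (Suc n)) * exp (2 * of_real pi * \<i> * of_nat (Suc n) * of_real (of_int p / of_int q)) / of_nat (Suc n) powr s) sums Lfun s"
    unfolding d_def x_def by simp
qed

lemma twisted_L_eq: "twisted_L k a s (of_int p / of_int q) = Lfun s"
  unfolding twisted_L_def using entire_ext_Lfun entire_ext_twisted_L_unique by (metis theI)

lemma completed_L_eq:
  assumes "Re s > 0"
  shows "of_real (2 * pi / of_int q) powr (- s) * Gamma s * twisted_L k a s (of_int p / of_int q) = Lam s"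
proof -
  have "rGamma s * Gamma s = 1" by (rule rGamma_mult_Gamma[OF assms])
  moreover have "of_real (2 * pi / of_int q) powr (- s) = exp (- s * of_real (ln (2 * pi / of_int q)))"
    using q_pos by (intro powr_of_real_pos) simp
  moreover have "exp (s * of_real (ln (2 * pi / of_int q))) * exp (- s * of_real (ln (2 * pi / of_int q))) = 1"
    by (simp flip: exp_add)
  ultimately show ?thesis unfolding twisted_L_eq Lfun_def by (simp add: mult_ac)
qed

end

section \<open>Contour integrals for the confluent hypergeometric function\<close>

lemma pochhammer_of_nat_fact:
  assumes "k > 0"
  shows "fact (k - 1) * pochhammer (of_nat k) m = (fact (k + m - 1) :: 'a :: {semiring_char_0, comm_semiring_1})"
proof (induction m)
  case (Suc m)
  have "fact (k - 1) * pochhammer (of_nat k) (Suc m) = (fact (k - 1) * pochhammer (of_nat k) m) * (of_nat (k + m) :: 'a)"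
    by (simp add: pochhammer_Suc mult.assoc)
  also have "\<dots> = fact (k + m - 1) * of_nat (k + m)" by (simp only: Suc)
  also have "\<dots> = fact (k + m)" using assms by (subst fact_reduce[of "k + m"]) (simp_all add: mult.commute)
  finally show ?case by simp
qed simp

lemma has_contour_integral_exp_over_power:
  assumes "n > 0" "R > 0"
  shows "((\<lambda>u. exp u / u ^ n) has_contour_integral 2 * of_real pi * \<i> / fact (n - 1)) (circlepath 0 R)"
proof -
  have "((\<lambda>u. exp (u * 1) / (u - 0) ^ Suc (n - 1)) has_contour_integral
      (2 * pi * \<i>) / fact (n - 1) * (deriv ^^ (n - 1)) (\<lambda>z. exp (z * 1)) 0) (circlepath 0 R)"
    using assms by (intro Cauchy_has_contour_integral_higher_derivative_circlepath continuous_intros holomorphic_intros) auto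
  then show ?thesis unfolding higher_deriv_exp_linear using assms(1) by simp
qed

text \<open>As a function of u, the principal branch of (1 - w/u)^b can be cut only along the
  segment from 0 to w; contours have to go around that segment.\<close>

lemma one_minus_div_notin_nonpos_Reals:
  fixes u w :: complex
  assumes "u \<notin> closed_segment 0 w" shows "1 - w / u \<notin> \<real>\<^sub>\<le>\<^sub>0"
proof
  assume "1 - w / u \<in> \<real>\<^sub>\<le>\<^sub>0"
  then obtain x where x: "x \<le> 0" "1 - w / u = of_real x" by (auto elim!: nonpos_Reals_cases)
  have u: "u \<noteq> 0" using assms by auto
  have "w / u = of_real (1 - x)" using x(2) by (simp add: algebra_simps)
  then have "w = of_real (1 - x) * u" using u by (simp add: divide_eq_eq)
  moreover have "of_real (1 / (1 - x)) * of_real (1 - x) = (1 :: complex)"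
    unfolding of_real_mult[symmetric] using x(1) by simp
  ultimately have "u = (1 / (1 - x)) *\<^sub>R w" by (simp only: scaleR_conv_of_real mult.assoc[symmetric]) simp
  moreover have "0 \<le> 1 / (1 - x)" "1 / (1 - x) \<le> 1" using x(1) by auto
  ultimately have "u \<in> closed_segment 0 w" unfolding in_segment by (intro exI[of _ "1 / (1 - x)"]) auto
  with assms show False by simp
qed

text \<open>Expand (1 - w/u)^b by the binomial series, which converges uniformly on |u| = R > |w|,
  and integrate termwise: e^u / u^(k+m) contributes 2 pi i / (k+m-1)!, the source of the Pochhammer
  symbol in the denominator.\<close>

lemma contour_integral_kummer_circle_0:
  assumes k: "k > 0" and R: "norm w < R"
  shows "summable (\<lambda>m. pochhammer (- b) m / pochhammer (of_nat k) m * w ^ m / fact m)"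
    and "contour_integral (circlepath 0 R) (\<lambda>u. exp u / u ^ k * (1 - w / u) powr b)
    = 2 * of_real pi * \<i> / fact (k - 1) * kummer_1F1 (- b) (of_nat k) w"
proof -
  have R0: "R > 0" using R norm_ge_zero[of w] by linarith
  define co where "co m = pochhammer (- b) m / fact m" for m
  have co: "(b gchoose m) * (- x) ^ m = co m * x ^ m" for m x
  proof -
    have "(b gchoose m) * (- x) ^ m = co m * ((- 1) ^ m * (- x) ^ m)"
      unfolding gbinomial_pochhammer co_def by simp
    also have "(- 1) ^ m * (- x) ^ m = x ^ m" by (simp flip: power_mult_distrib)
    finally show ?thesis .
  qed
  have series: "(\<lambda>m. co m * x ^ m) sums (1 - x) powr b" if "norm x < 1" for x
    using gen_binomial_complex[of "- x" b] that unfolding co by simp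
  have abs: "summable (\<lambda>m. norm (co m * x ^ m))" if x: "norm x < 1" for x
  proof -
    obtain y where y: "norm x < y" "y < 1" using dense[OF x] by blast
    then have "norm (of_real y :: complex) < 1" using order_le_less_trans[OF norm_ge_zero y(1)] by simp
    then show ?thesis using series[THEN sums_summable, of "of_real y"] y
      by (intro powser_insidea[of co "of_real y"]) auto
  qed
  define g where "g m u = exp u / u ^ k * (co m * (w / u) ^ m)" for m and u :: complex
  have unif: "uniform_limit (sphere 0 R) (\<lambda>N u. \<Sum>m<N. g m u) (\<lambda>u. \<Sum>m. g m u) sequentially"
  proof (rule Weierstrass_m_test)
    show "summable (\<lambda>m. exp R / R ^ k * norm (co m * (w / of_real R) ^ m))"
      using R R0 by (intro summable_mult abs) (simp add: norm_divide)
    fix m u assume u: "u \<in> sphere (0::complex) R"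
    have "norm (exp u) \<le> exp R" using u norm_exp[of u] by simp
    then have "norm (exp u) / norm u ^ k \<le> exp R / R ^ k" using u R0 by (simp add: divide_right_mono)
    moreover have "norm ((w / u) ^ m) = norm ((w / of_real R) ^ m)" using u R0 by (simp add: norm_divide norm_power)
    ultimately show "norm (g m u) \<le> exp R / R ^ k * norm (co m * (w / of_real R) ^ m)"
      using R0 unfolding g_def norm_mult norm_divide[of "exp u"] norm_power[of u]
      by (intro mult_mono) (auto simp: norm_mult)
  qed
  have gsum: "(\<Sum>m. g m u) = exp u / u ^ k * (1 - w / u) powr b" if "u \<in> sphere 0 R" for u
  proof -
    have "norm (w / u) < 1" using that R R0 by (simp add: norm_divide)
    from sums_unique[OF sums_mult[OF series[OF this], of "exp u / u ^ k"]] show ?thesis unfolding g_def ..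
  qed
  have gint: "(g m has_contour_integral co m * w ^ m * (2 * of_real pi * \<i> / fact (k + m - 1))) (circlepath 0 R)" for m
  proof -
    have "((\<lambda>u. co m * w ^ m * (exp u / u ^ (k + m))) has_contour_integral co m * w ^ m * (2 * of_real pi * \<i> / fact (k + m - 1))) (circlepath 0 R)"
      using k R0 by (intro has_contour_integral_lmul has_contour_integral_exp_over_power) auto
    then show ?thesis
      by (rule has_contour_integral_eq) (simp add: g_def power_add power_divide)
  qed
  have "((\<lambda>N. contour_integral (circlepath 0 R) (\<lambda>u. \<Sum>m<N. g m u)) \<longlongrightarrow> contour_integral (circlepath 0 R) (\<lambda>u. \<Sum>m. g m u)) sequentially"
  proof (rule contour_integral_uniform_limit_circlepath[OF _ unif])
    have "(\<lambda>u. \<Sum>m<N. g m u) contour_integrable_on circlepath 0 R" for N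
      by (intro contour_integrable_sum has_contour_integral_integrable[OF gint]) simp
    then show "\<forall>\<^sub>F N in sequentially. (\<lambda>u. \<Sum>m<N. g m u) contour_integrable_on circlepath 0 R"
      by (intro always_eventually allI)
  qed (use R0 in auto)
  moreover have "contour_integral (circlepath 0 R) (\<lambda>u. \<Sum>m<N. g m u) = (\<Sum>m<N. co m * w ^ m * (2 * of_real pi * \<i> / fact (k + m - 1)))" for N
    by (intro contour_integral_unique has_contour_integral_sum gint) auto
  ultimately have "(\<lambda>m. co m * w ^ m * (2 * of_real pi * \<i> / fact (k + m - 1))) sums contour_integral (circlepath 0 R) (\<lambda>u. \<Sum>m. g m u)"
    by (simp add: sums_def)
  moreover have "contour_integral (circlepath 0 R) (\<lambda>u. \<Sum>m. g m u) = contour_integral (circlepath 0 R) (\<lambda>u. exp u / u ^ k * (1 - w / u) powr b)"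
    using R0 gsum by (intro contour_integral_cong) (auto simp: path_image_circlepath)
  moreover have "co m * w ^ m * (2 * of_real pi * \<i> / fact (k + m - 1)) = 2 * of_real pi * \<i> / fact (k - 1) * (pochhammer (- b) m / pochhammer (of_nat k) m * w ^ m / fact m)" for m
    unfolding pochhammer_of_nat_fact[OF k, of m, symmetric] co_def by (simp add: mult_ac)
  ultimately have s: "(\<lambda>m. 2 * of_real pi * \<i> / fact (k - 1) * (pochhammer (- b) m / pochhammer (of_nat k) m * w ^ m / fact m)) sums contour_integral (circlepath 0 R) (\<lambda>u. exp u / u ^ k * (1 - w / u) powr b)"
    by simp
  show "summable (\<lambda>m. pochhammer (- b) m / pochhammer (of_nat k) m * w ^ m / fact m)"
    using summable_mult_D[OF sums_summable[OF s]] by simp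
  from suminf_mult[OF this, of "2 * of_real pi * \<i> / fact (k - 1)"] sums_unique[OF s]
  show "contour_integral (circlepath 0 R) (\<lambda>u. exp u / u ^ k * (1 - w / u) powr b)
    = 2 * of_real pi * \<i> / fact (k - 1) * kummer_1F1 (- b) (of_nat k) w"
    unfolding kummer_1F1_def by (simp only:)
qed

lemma kummer_1F1_cnj:
  assumes "k > 0"
  shows "kummer_1F1 (cnj a) (of_nat k) (cnj w) = cnj (kummer_1F1 a (of_nat k) w)"
proof -
  have "summable (\<lambda>m. pochhammer a m / pochhammer (of_nat k) m * w ^ m / fact m)"
    using contour_integral_kummer_circle_0(1)[OF assms, of w "norm w + 1" "- a"] by simp
  then have "(\<lambda>m. cnj (pochhammer a m / pochhammer (of_nat k) m * w ^ m / fact m)) sums cnj (kummer_1F1 a (of_nat k) w)"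
    unfolding sums_cnj kummer_1F1_def by (rule summable_sums)
  moreover have "cnj (pochhammer x m) = pochhammer (cnj x) m" for x m by (simp add: pochhammer_prod)
  ultimately show ?thesis unfolding kummer_1F1_def by (simp add: sums_iff)
qed

text \<open>The circles needed later are not centred at 0. Any circle with 0 and w inside can be
  deformed linearly into a centred one without touching the cut.\<close>

lemma contour_integral_kummer:
  assumes k: "k > 0" and c: "0 \<in> ball c r" "w \<in> ball c r"
  shows "contour_integral (circlepath c r) (\<lambda>u. exp u / u ^ k * (1 - w / u) powr b)
    = 2 * of_real pi * \<i> / fact (k - 1) * kummer_1F1 (- b) (of_nat k) w"
proof -
  define R where "R = norm w + 1"
  have r: "r > 0" using c(1) by (metis ball_eq_empty empty_iff not_le)
  have seg1: "closed_segment 0 w \<subseteq> ball c r" using c by (intro closed_segment_subset) auto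
  have seg2: "closed_segment 0 w \<subseteq> ball 0 R" by (intro closed_segment_subset) (auto simp: R_def intro: add_nonneg_pos)
  have "contour_integral (circlepath c r) (\<lambda>u. exp u / u ^ k * (1 - w / u) powr b) = contour_integral (circlepath 0 R) (\<lambda>u. exp u / u ^ k * (1 - w / u) powr b)"
  proof (rule Cauchy_theorem_homotopic_loops)
    show "open (- closed_segment 0 w)" by (intro open_Compl closed_segment)
    show "(\<lambda>u. exp u / u ^ k * (1 - w / u) powr b) holomorphic_on - closed_segment 0 w"
      using one_minus_div_notin_nonpos_Reals by (intro holomorphic_intros) auto
    show "homotopic_loops (- closed_segment 0 w) (circlepath c r) (circlepath 0 R)"
    proof (rule homotopic_loops_linear)
      fix t :: real assume "t \<in> {0..1}"
      show "closed_segment (circlepath c r t) (circlepath 0 R t) \<subseteq> - closed_segment 0 w"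
      proof (rule subsetI, rule ComplI)
        fix y assume "y \<in> closed_segment (circlepath c r t) (circlepath 0 R t)" and yw: "y \<in> closed_segment 0 w"
        then obtain x where x: "0 \<le> x" "x \<le> 1" "y = (1 - x) *\<^sub>R circlepath c r t + x *\<^sub>R circlepath 0 R t"
          by (auto simp: in_segment)
        define e where "e = exp (2 * of_real pi * \<i> * of_real t)"
        have e: "norm e = 1" by (simp add: e_def)
        \<comment> \<open>A point of the intermediate circle has distance exactly (1-x) r + x R from
          (1-x) c, whereas a point of the segment, being inside both end circles, is strictly closer
          by convexity of the norm.\<close>
        have "y = of_real (1 - x) * c + of_real ((1 - x) * r + x * R) * e"
          unfolding x(3) circlepath e_def[symmetric] by (simp add: scaleR_conv_of_real algebra_simps)
        then have "norm (y - of_real (1 - x) * c) = norm (of_real ((1 - x) * r + x * R) * e)" by simp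
        also have "\<dots> = (1 - x) * r + x * R"
          unfolding norm_mult e norm_of_real using x r by (simp add: R_def)
        finally have eq: "norm (y - of_real (1 - x) * c) = (1 - x) * r + x * R" .
        have "y - of_real (1 - x) * c = of_real (1 - x) * (y - c) + of_real x * y" by (simp add: algebra_simps)
        then have "norm (y - of_real (1 - x) * c) \<le> norm (of_real (1 - x) * (y - c)) + norm (of_real x * y)"
          by (simp only: norm_triangle_ineq)
        also have "\<dots> = (1 - x) * norm (y - c) + x * norm y" unfolding norm_mult norm_of_real using x by simp
        also have "\<dots> < (1 - x) * r + x * R"
        proof -
          have "norm (y - c) < r" "norm y < R" using seg1 seg2 yw by (auto simp: dist_norm norm_minus_commute)
          moreover have "(1 - x) * norm (y - c) \<le> (1 - x) * r" "x * norm y \<le> x * R"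
            using calculation x by (auto intro!: mult_left_mono)
          moreover have "x * norm y < x * R" if "x \<noteq> 0"
            using that x(1) calculation(2) by (intro mult_strict_left_mono) auto
          ultimately show ?thesis by (cases "x = 0") (simp, linarith)
        qed
        finally show False using eq by simp
      qed
    qed auto
  qed auto
  also have "\<dots> = 2 * of_real pi * \<i> / fact (k - 1) * kummer_1F1 (- b) (of_nat k) w"
    by (rule contour_integral_kummer_circle_0(2)[OF k]) (simp add: R_def)
  finally show ?thesis .
qed

lemma circ_notin_segment:
  assumes "0 \<in> ball c r" "w \<in> ball c r" shows "c + circ r x \<notin> closed_segment 0 w"
proof
  have r: "r > 0" using assms(1) by (metis ball_eq_empty empty_iff not_le)
  assume "c + circ r x \<in> closed_segment 0 w"
  moreover have "closed_segment 0 w \<subseteq> ball c r" using assms by (intro closed_segment_subset) auto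
  ultimately have "norm (circ r x) < r" by (auto simp: dist_norm)
  then show False using norm_circ[of r x] r by simp
qed

text \<open>The power is written as exp(b Ln(...)) so that its dependence on b is exponential and
  can be merged with the kernel of a Laplace transform.\<close>

lemma kummer_eq_integral:
  assumes k: "k > 0" and c: "0 \<in> ball c r" "w \<in> ball c r"
  shows "kummer_1F1 (- b) (of_nat k) w = integral {0..1} (\<lambda>x. fact (k - 1) *
    (exp (c + circ r x) / (c + circ r x) ^ k * exp (b * Ln (1 - w / (c + circ r x))) * circ r x))"
proof -
  have pw: "exp (b * Ln (1 - w / (c + circ r x))) = (1 - w / (c + circ r x)) powr b" for x
    using one_minus_div_notin_nonpos_Reals[OF circ_notin_segment[OF c, of x]] by (auto simp: powr_def)
  have "2 * of_real pi * \<i> / fact (k - 1) * kummer_1F1 (- b) (of_nat k) w = 2 * of_real pi * \<i> *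
      integral {0..1} (\<lambda>x. exp (c + circ r x) / (c + circ r x) ^ k * (1 - w / (c + circ r x)) powr b * circ r x)"
    using contour_integral_kummer[OF assms, of b]
    unfolding contour_integral_circ Henstock_Kurzweil_Integration.integral_mult_right by (simp only:)
  then show ?thesis unfolding pw Henstock_Kurzweil_Integration.integral_mult_right by (simp add: field_simps)
qed

text \<open>On a circle of large radius Ln(1 - w/u) is uniformly small, so the factor exp(i t
  Ln(...)) grows at an arbitrarily small exponential rate.\<close>

lemma kummer_vertical:
  fixes \<beta> :: real
  assumes k: "k > 0"
  shows "continuous_on UNIV (\<lambda>t. kummer_1F1 (of_real \<beta> - \<i> * of_real t) (of_nat k) w)"
    and "\<epsilon> > 0 \<Longrightarrow> \<exists>C. \<forall>t. norm (kummer_1F1 (of_real \<beta> - \<i> * of_real t) (of_nat k) w) \<le> C * exp (\<epsilon> * \<bar>t\<bar>)"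
proof -
  define b where "b t = - (of_real \<beta> - \<i> * of_real t)" for t
  define h where "h R t x = fact (k - 1) * (exp (0 + circ R x) / (0 + circ R x) ^ k * exp (b t * Ln (1 - w / (0 + circ R x))) * circ R x)" for R t x
  have rep: "kummer_1F1 (of_real \<beta> - \<i> * of_real t) (of_nat k) w = integral {0..1} (h R t)" if "norm w < R" for R t
    using kummer_eq_integral[OF k, of 0 R w "b t"] that order_le_less_trans[OF norm_ge_zero that] unfolding h_def b_def by simp
  have nz: "0 + circ R x \<notin> closed_segment 0 w" if "norm w < R" for R x
    using that order_le_less_trans[OF norm_ge_zero that] by (intro circ_notin_segment) auto
  have cont: "continuous_on (UNIV \<times> {0..1}) (\<lambda>(t, x). h R t x)" if "norm w < R" for R
  proof -
    have cc: "continuous_on A (\<lambda>z. circ R (snd z))" for A :: "(real \<times> real) set"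
      by (intro continuous_on_compose2[OF continuous_on_circ[of UNIV]] continuous_intros) auto
    have ne: "circ R x \<noteq> 0" for x using nz[OF that, of x] by auto
    show ?thesis
      unfolding h_def b_def case_prod_beta
      using one_minus_div_notin_nonpos_Reals[OF nz[OF that]] ne
      by (intro continuous_intros cc) (simp_all del: complex_nonpos_Reals_iff)
  qed
  show "continuous_on UNIV (\<lambda>t. kummer_1F1 (of_real \<beta> - \<i> * of_real t) (of_nat k) w)"
    using integral_continuous_on_param[of UNIV 0 1 "h (norm w + 1)"] cont[of "norm w + 1"] rep[of "norm w + 1"] by simp
  assume \<epsilon>: "\<epsilon> > 0"
  \<comment> \<open>The summand 2|w| + 1 keeps |w/u| below 1/2, where |Ln(1 - w/u)| is at most
    2|w/u|; the summand 2|w|/epsilon makes that at most epsilon.\<close>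
  define R where "R = 2 * norm w / \<epsilon> + 2 * norm w + 1"
  have "0 \<le> 2 * norm w / \<epsilon>" using \<epsilon> by simp
  then have R: "norm w < R" "2 * norm w < R" "2 * norm w / \<epsilon> \<le> R" "R > 0"
    using norm_ge_zero[of w] unfolding R_def by linarith+
  define C where "C = fact (k - 1) * (exp R / R ^ k * exp (\<bar>\<beta>\<bar> * \<epsilon>) * R)"
  have bd: "norm (h R t x) \<le> C * exp (\<epsilon> * \<bar>t\<bar>)" for t x
  proof -
    define u where "u = circ R x"
    have nu: "norm u = R" using R by (simp add: u_def norm_circ)
    define L where "L = Ln (1 - w / u)"
    have "norm (- (w / u)) < 1/2" using R(2,4) by (simp add: norm_divide nu field_simps)
    then have "norm L \<le> 2 * norm (- (w / u))" unfolding L_def using norm_Ln_le[of "- (w / u)"] by simp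
    also have "\<dots> \<le> \<epsilon>" using R(3,4) \<epsilon> by (simp add: norm_divide nu field_simps)
    finally have L: "norm L \<le> \<epsilon>" .
    have "Re (b t * L) = - \<beta> * Re L - t * Im L" by (simp add: b_def)
    also have "\<dots> \<le> \<bar>\<beta>\<bar> * \<epsilon> + \<bar>t\<bar> * \<epsilon>"
    proof -
      have "\<bar>\<beta> * Re L\<bar> \<le> \<bar>\<beta>\<bar> * \<epsilon>" "\<bar>t * Im L\<bar> \<le> \<bar>t\<bar> * \<epsilon>"
        unfolding abs_mult using L abs_Re_le_cmod[of L] abs_Im_le_cmod[of L] by (auto intro!: mult_left_mono)
      then show ?thesis by linarith
    qed
    finally have "norm (exp (b t * Ln (1 - w / u))) \<le> exp (\<bar>\<beta>\<bar> * \<epsilon> + \<bar>t\<bar> * \<epsilon>)"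
      unfolding L_def by simp
    moreover have "norm (exp u) \<le> exp R" using norm_exp[of u] nu by simp
    ultimately have "norm (h R t x) \<le> fact (k - 1) * (exp R / R ^ k * exp (\<bar>\<beta>\<bar> * \<epsilon> + \<bar>t\<bar> * \<epsilon>) * R)"
      unfolding h_def add_0 u_def[symmetric] norm_mult norm_divide norm_power nu norm_fact
      using R by (intro mult_mono divide_right_mono) auto
    also have "\<dots> = C * exp (\<epsilon> * \<bar>t\<bar>)" unfolding C_def exp_add by (simp add: mult_ac)
    finally show ?thesis .
  qed
  have "norm (kummer_1F1 (of_real \<beta> - \<i> * of_real t) (of_nat k) w) \<le> C * exp (\<epsilon> * \<bar>t\<bar>)" for t
  proof -
    have "continuous_on {0..1} (h R t)"
      using continuous_on_Times_slice(1)[OF cont[OF R(1)], of t] by simp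
    then have "norm (integral {0..1} (h R t)) \<le> (C * exp (\<epsilon> * \<bar>t\<bar>)) * (1 - 0)"
      by (intro integral_bound) (auto intro: bd)
    then show ?thesis using rep[OF R(1), of t] by simp
  qed
  then show "\<exists>C. \<forall>t. norm (kummer_1F1 (of_real \<beta> - \<i> * of_real t) (of_nat k) w) \<le> C * exp (\<epsilon> * \<bar>t\<bar>)" by blast
qed

section \<open>Flatness of the critical product\<close>

text \<open>In a narrow cone 1/delta is nearly a positive real number. The cross term of the
  imaginary parts costs at most half of the real part, by kappa C at most c/2, and a further factor
  2 comes from |delta| at most 2 Re delta.\<close>

lemma Re_divide_ge_in_cone:
  fixes Z \<delta> :: complex
  assumes Z: "Re Z \<ge> c" "norm Z \<le> C" and c: "c > 0"
    and \<delta>: "Re \<delta> > 0" "\<bar>Im \<delta>\<bar> \<le> \<kappa> * Re \<delta>" and \<kappa>: "0 \<le> \<kappa>" "\<kappa> \<le> 1" "\<kappa> * C \<le> c / 2"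
  shows "Re (Z / \<delta>) \<ge> c / (4 * norm \<delta>)"
proof -
  have n: "norm \<delta> > 0" "norm \<delta> \<le> 2 * Re \<delta>"
  proof -
    show "norm \<delta> > 0" using \<delta>(1) by auto
    have "\<kappa> * Re \<delta> \<le> 1 * Re \<delta>" using \<kappa> \<delta> by (intro mult_right_mono) auto
    then show "norm \<delta> \<le> 2 * Re \<delta>" using cmod_le[of \<delta>] \<delta> by linarith
  qed
  have "\<bar>Im Z * Im \<delta>\<bar> \<le> C * (\<kappa> * Re \<delta>)"
    unfolding abs_mult using Z(2) abs_Im_le_cmod[of Z] \<delta>(2) norm_ge_zero[of Z] by (intro mult_mono) linarith+
  also have "C * (\<kappa> * Re \<delta>) = \<kappa> * C * Re \<delta>" by simp
  also have "\<dots> \<le> c / 2 * Re \<delta>" using \<kappa>(3) \<delta>(1) by (intro mult_right_mono) auto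
  finally have "Re Z * Re \<delta> + Im Z * Im \<delta> \<ge> c * Re \<delta> - c / 2 * Re \<delta>"
    using mult_right_mono[OF Z(1), of "Re \<delta>"] \<delta>(1) by linarith
  also have "c * Re \<delta> - c / 2 * Re \<delta> = c / 2 * Re \<delta>" by simp
  finally have ge: "Re Z * Re \<delta> + Im Z * Im \<delta> \<ge> c / 2 * Re \<delta>" .
  have "c / (4 * norm \<delta>) = c / 4 * norm \<delta> / norm \<delta> ^ 2" using n by (simp add: power2_eq_square)
  also have "\<dots> \<le> (c / 2 * Re \<delta>) / norm \<delta> ^ 2" using n c by (intro divide_right_mono) auto
  also have "\<dots> \<le> (Re Z * Re \<delta> + Im Z * Im \<delta>) / norm \<delta> ^ 2" using ge by (intro divide_right_mono) auto
  also have "\<dots> = Re (Z / \<delta>)" by (simp add: Re_divide cmod_power2)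
  finally show ?thesis .
qed

text \<open>The saddle points of v + N iota w / v are v = sqrt(N) zeta and its negative, where
  zeta^2 = iota w; the circle passes through both. With zeta = a + i b the real part there is at
  most -((sqrt N - |a|)^2 - b^2), which is negative once |a| + |b| < sqrt N. The square of |a| + |b|
  is |w| + |Re w|.\<close>

lemma saddle_circle:
  fixes \<iota> w :: complex
  assumes \<iota>: "\<iota> = \<i> \<or> \<iota> = - \<i>" and w: "norm w + \<bar>Re w\<bar> < N"
  obtains \<rho> c where "norm w < \<rho>" "c > 0"
    "\<And>v. norm v = \<rho> \<Longrightarrow> Re (v - \<iota> * w - of_real N + of_real N * \<iota> * w / v) \<le> - c"
proof (cases "w = 0")
  case True
  then have N: "N > 0" using w by simp
  show ?thesis
  \<comment> \<open>For w = 0 the saddle circle degenerates to a point; any positive radius below N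
    serves.\<close>
  proof (rule that[of "N / 2" "N / 2"])
    fix v :: complex assume "norm v = N / 2"
    then show "Re (v - \<iota> * w - of_real N + of_real N * \<iota> * w / v) \<le> - (N / 2)"
      using complex_Re_le_cmod[of v] True by simp
  qed (use N True in auto)
next
  case False
  have wN: "norm w < N" using w by linarith
  then have N: "N > 0" using norm_ge_zero[of w] by linarith
  define \<zeta> where "\<zeta> = csqrt (\<iota> * w)"
  define a b where "a = Re \<zeta>" and "b = Im \<zeta>"
  have z2: "\<zeta> ^ 2 = \<iota> * w" by (simp add: \<zeta>_def)
  have ni: "norm \<iota> = 1" using \<iota> by auto
  have nz: "norm \<zeta> ^ 2 = norm w" using arg_cong[OF z2, of norm] by (simp add: norm_power norm_mult ni)
  have z0: "\<zeta> \<noteq> 0" using nz False by auto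
  have ab: "a ^ 2 + b ^ 2 = norm w" using nz by (simp add: cmod_power2 a_def b_def)
  have Re2: "Re (\<iota> * w) = a ^ 2 - b ^ 2" using arg_cong[OF z2, of Re] by (simp add: power2_eq_square a_def b_def)
  \<comment> \<open>Multiplication by i or -i turns the real part of w into an imaginary part up to
    sign, hence 2|a b| = |Re w|.\<close>
  have "Im (\<iota> * w) = 2 * a * b" using arg_cong[OF z2, of Im] by (simp add: power2_eq_square a_def b_def algebra_simps)
  moreover have "\<bar>Im (\<iota> * w)\<bar> = \<bar>Re w\<bar>" using \<iota> by auto
  ultimately have "(\<bar>a\<bar> + \<bar>b\<bar>) ^ 2 = norm w + \<bar>Re w\<bar>"
    unfolding power2_sum power2_abs ab[symmetric] by (simp add: abs_mult)
  then have "(\<bar>a\<bar> + \<bar>b\<bar>) ^ 2 < (sqrt N) ^ 2" using w N by simp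
  then have lt: "\<bar>a\<bar> + \<bar>b\<bar> < sqrt N" by (rule power2_less_imp_less) (use N in simp)
  define \<rho> where "\<rho> = sqrt N * norm \<zeta>"
  define c where "c = (sqrt N - \<bar>a\<bar>) ^ 2 - b ^ 2"
  show ?thesis
  proof (rule that[of \<rho> c])
    have "norm \<zeta> ^ 2 < (sqrt N) ^ 2" using nz wN N by simp
    then have "norm \<zeta> < sqrt N" by (rule power2_less_imp_less) (use N in simp)
    then have "norm \<zeta> * norm \<zeta> < sqrt N * norm \<zeta>" using z0 by (intro mult_strict_right_mono) auto
    then show "norm w < \<rho>" by (simp add: \<rho>_def nz[symmetric] power2_eq_square)
    have "\<bar>b\<bar> ^ 2 < (sqrt N - \<bar>a\<bar>) ^ 2" using lt by (intro power_strict_mono) auto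
    then show "c > 0" by (simp add: c_def)
    fix v :: complex assume v: "norm v = \<rho>"
    have sN: "sqrt N > 0" using N by simp
    \<comment> \<open>A unit number locating v on the circle relative to the saddle; since 1/e is
      the conjugate of e, the two moving terms add up to a real multiple of zeta.\<close>
    define e where "e = v / (of_real (sqrt N) * \<zeta>)"
    have ne: "norm e = 1" using v sN z0 by (simp add: e_def \<rho>_def norm_divide norm_mult)
    have e0: "e \<noteq> 0" using ne by auto
    have ve: "v = of_real (sqrt N) * \<zeta> * e" using sN z0 by (simp add: e_def)
    have inv: "1 / e = cnj e" using complex_norm_square[of e] ne e0 by (simp add: nonzero_divide_eq_eq mult.commute)
    have NN: "of_real N = of_real (sqrt N) * (of_real (sqrt N) :: complex)"
      using N by (simp flip: of_real_mult)
    have "of_real N * \<iota> * w / v = of_real (sqrt N) * \<zeta> * (1 / e)"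
      unfolding mult.assoc z2[symmetric] NN ve using sN z0 e0 by (simp add: power2_eq_square)
    then have "v + of_real N * \<iota> * w / v = of_real (sqrt N) * \<zeta> * (e + cnj e)"
      unfolding inv ve by (simp add: distrib_left)
    also have "\<dots> = of_real (2 * sqrt N * Re e) * \<zeta>" by (simp add: complex_add_cnj)
    finally have sum: "Re (v + of_real N * \<iota> * w / v) = 2 * sqrt N * Re e * a" by (simp add: a_def)
    have "Re e * a \<le> \<bar>Re e\<bar> * \<bar>a\<bar>" by (metis abs_ge_self abs_mult)
    also have "\<dots> \<le> 1 * \<bar>a\<bar>" using abs_Re_le_cmod[of e] ne by (intro mult_right_mono) auto
    finally have "2 * sqrt N * (Re e * a) \<le> 2 * sqrt N * \<bar>a\<bar>" using sN by (intro mult_left_mono) auto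
    then have "Re (v + of_real N * \<iota> * w / v) - Re (\<iota> * w) - N \<le> 2 * sqrt N * \<bar>a\<bar> - (a ^ 2 - b ^ 2) - N"
      unfolding sum Re2 by simp
    also have "\<dots> = - c" using N by (simp add: c_def power2_diff)
    finally show "Re (v - \<iota> * w - of_real N + of_real N * \<iota> * w / v) \<le> - c" by simp
  qed
qed

text \<open>For w = z^2/4 the sum |w| + |Re w| is half the larger of (Re z)^2 and (Im z)^2, so the
  parabolic region in w is the image of a square in z.\<close>

lemma domain_D_parabolic:
  assumes "z \<in> domain_D q" "q > 0"
  shows "norm (z ^ 2 / 4) + \<bar>Re (z ^ 2 / 4)\<bar> < 2 * pi / of_int q"
proof -
  have q: "real_of_int q > 0" using assms(2) by simp
  have sq: "t ^ 2 < 4 * (pi / of_int q)" if "\<bar>t\<bar> < 2 * sqrt (pi / of_int q)" for t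
  proof -
    have "\<bar>t\<bar> ^ 2 < (2 * sqrt (pi / of_int q)) ^ 2" using that by (intro power_strict_mono) auto
    then show ?thesis using q by (simp add: power_mult_distrib)
  qed
  have "Re z ^ 2 < 4 * (pi / of_int q)" "Im z ^ 2 < 4 * (pi / of_int q)"
    using assms(1) sq by (auto simp: domain_D_def)
  moreover have "norm (z ^ 2 / 4) = (Re z ^ 2 + Im z ^ 2) / 4" by (simp add: norm_power norm_divide cmod_power2)
  moreover have "Re (z ^ 2 / 4) = (Re z ^ 2 - Im z ^ 2) / 4" by (simp add: power2_eq_square)
  moreover have "n + \<bar>m\<bar> < 2 * t" if "A < 4 * t" "B < 4 * t" "n = (A + B) / 4" "m = (A - B) / 4" for A B m n t :: real
    using that by (simp add: abs_if)
  ultimately have "norm (z ^ 2 / 4) + \<bar>Re (z ^ 2 / 4)\<bar> < 2 * (pi / of_int q)" by blast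
  then show ?thesis by simp
qed

lemma norm_exp_minus_linear_le:
  fixes z :: complex
  assumes "norm z \<le> 1" shows "norm (exp z - 1 - z) \<le> 3 * norm z ^ 2"
proof -
  have "norm (exp z - (\<Sum>k\<le>1. z ^ k / fact k)) \<le> exp \<bar>Re z\<bar> * norm z ^ Suc 1 / fact 1"
    by (rule Taylor_exp)
  moreover have "exp \<bar>Re z\<bar> \<le> 3"
    using abs_Re_le_cmod[of z] assms exp_le by (meson exp_le_cancel_iff order_trans)
  then have "exp \<bar>Re z\<bar> * norm z ^ 2 \<le> 3 * norm z ^ 2" by (rule mult_right_mono) simp
  ultimately show ?thesis by (simp add: diff_diff_eq power2_eq_square)
qed

context twisted_cusp_form begin

text \<open>One half of the terms of the theorem at s = k/2 + i t, before shifting: k - s becomes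
  k/2 - i t. The other half is its conjugate up to a constant.\<close>

definition critical_product :: "complex \<Rightarrow> real \<Rightarrow> complex" where
  "critical_product w t = Lam (of_real (real k / 2) + \<i> * of_real t) * kummer_1F1 (of_real (real k / 2) - \<i> * of_real t) (of_nat k) w"

lemma exp_decay_critical_product:
  assumes k: "k > 0" shows "exp_decay (critical_product w)"
  unfolding exp_decay_def
proof (intro conjI allI impI)
  have L: "exp_decay (\<lambda>t. Lam (of_real (real k / 2) + \<i> * of_real t))" by (rule Lam_vertical_decay)
  show "continuous_on UNIV (critical_product w)"
    unfolding critical_product_def[abs_def] using L kummer_vertical(1)[OF k, of "real k / 2" w]
    unfolding exp_decay_def by (intro continuous_intros) auto
  fix \<theta> :: real assume \<theta>: "\<theta> < pi / 2"
  define \<epsilon> where "\<epsilon> = (pi / 2 - \<theta>) / 2"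
  have \<epsilon>: "\<epsilon> > 0" "\<theta> + \<epsilon> < pi / 2" using \<theta> by (auto simp: \<epsilon>_def field_simps)
  obtain C1 where C1: "\<And>t. norm (Lam (of_real (real k / 2) + \<i> * of_real t)) \<le> C1 * exp (- (\<theta> + \<epsilon>) * \<bar>t\<bar>)"
    using L \<epsilon>(2) unfolding exp_decay_def by blast
  obtain C2 where C2: "\<And>t. norm (kummer_1F1 (of_real (real k / 2) - \<i> * of_real t) (of_nat k) w) \<le> C2 * exp (\<epsilon> * \<bar>t\<bar>)"
    using kummer_vertical(2)[OF k \<epsilon>(1), of "real k / 2" w] by blast
  show "\<exists>C. \<forall>t. norm (critical_product w t) \<le> C * exp (- \<theta> * \<bar>t\<bar>)"
  proof (intro exI[of _ "C1 * C2"] allI)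
    fix t
    have "norm (critical_product w t) \<le> (C1 * exp (- (\<theta> + \<epsilon>) * \<bar>t\<bar>)) * (C2 * exp (\<epsilon> * \<bar>t\<bar>))"
      unfolding critical_product_def norm_mult using C1[of t] C2[of t]
      by (intro mult_mono) (auto intro: order_trans[OF norm_ge_zero])
    also have "\<dots> = C1 * C2 * exp (- (\<theta> + \<epsilon>) * \<bar>t\<bar> + \<epsilon> * \<bar>t\<bar>)" by (simp add: exp_add)
    also have "- (\<theta> + \<epsilon>) * \<bar>t\<bar> + \<epsilon> * \<bar>t\<bar> = - \<theta> * \<bar>t\<bar>" by (simp add: algebra_simps)
    finally show "norm (critical_product w t) \<le> C1 * C2 * exp (- \<theta> * \<bar>t\<bar>)" .
  qed
qed

text \<open>With L = Ln(1 - w/u), the factor exp(i t L) of the Kummer integrand merges with exp(xi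
  t) into exp(-i y t) for y = i xi - L. The integral over t is then an inversion of
  \<open>Lam\<close> at y, and exp y is the argument of \<open>F\<close>.\<close>

lemma laplace_critical_product:
  assumes k: "k > 0" and \<xi>: "\<bar>Re \<xi>\<bar> < pi / 2" and c: "0 \<in> ball c r" "w \<in> ball c r"
    and pos: "\<And>x. Re (exp (\<i> * \<xi>) * ((c + circ r x) / (c + circ r x - w))) > 0"
  shows "laplace (critical_product w) \<xi> = integral {0..1} (\<lambda>x. fact (k - 1) * of_real (2 * pi) * exp (\<i> * of_nat k * \<xi> / 2) *
     (exp (c + circ r x) / (c + circ r x - w) ^ k * F (exp (\<i> * \<xi>) * ((c + circ r x) / (c + circ r x - w))) * circ r x))"
proof -
  define U where "U x = c + circ r x" for x
  define L where "L x = Ln (1 - w / U x)" for x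
  define y where "y x = \<i> * \<xi> - L x" for x
  define P where "P x = fact (k - 1) * (exp (U x) / U x ^ k * exp (- of_real (real k / 2) * L x) * circ r x)" for x
  have nseg: "U x \<notin> closed_segment 0 w" for x unfolding U_def by (rule circ_notin_segment[OF c])
  have U0: "U x \<noteq> 0" and Uw: "U x \<noteq> w" for x using nseg[of x] by auto
  have nR: "1 - w / U x \<notin> \<real>\<^sub>\<le>\<^sub>0" for x by (rule one_minus_div_notin_nonpos_Reals[OF nseg])
  have n0: "1 - w / U x \<noteq> 0" for x using nR[of x] by auto
  have Uc: "continuous_on A U" for A unfolding U_def by (intro continuous_intros)
  have Lc: "continuous_on A L" for A unfolding L_def
    by (intro continuous_intros Uc) (use U0 nR in \<open>simp_all del: complex_nonpos_Reals_iff\<close>)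
  have expL: "exp (L x) = 1 - w / U x" for x unfolding L_def using n0 by (rule exp_Ln)
  have expy: "exp (y x) = exp (\<i> * \<xi>) * (U x / (U x - w))" for x
    unfolding y_def exp_diff expL using U0[of x] Uw[of x] by (simp add: field_simps)
  \<comment> \<open>Positivity of Re(exp y) places Im y in the strip modulo 2 pi; the bound 3 pi/2,
    from |Re xi| < pi/2 and the principal logarithm, excludes all other branches.\<close>
  have ystrip: "y x \<in> strip" for x
  proof -
    have "exp (Re (y x)) * cos (Im (y x)) > 0"
      using pos[of x] unfolding U_def[symmetric] expy[symmetric] by (simp add: Re_exp)
    then have cos: "cos (Im (y x)) > 0" by (simp add: zero_less_mult_iff)
    have "\<bar>Im (L x)\<bar> \<le> pi" unfolding L_def using mpi_less_Im_Ln[OF n0[of x]] Im_Ln_le_pi[OF n0[of x]] by (intro abs_leI) linarith+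
    then have "\<bar>Im (y x)\<bar> < 3 * pi / 2" using \<xi> abs_triangle_ineq4[of "Re \<xi>" "Im (L x)"] by (simp add: y_def)
    then have "\<bar>Im (y x)\<bar> < pi / 2"
    proof (rule contrapos_pp)
      assume "\<not> \<bar>Im (y x)\<bar> < pi / 2"
      show "\<not> \<bar>Im (y x)\<bar> < 3 * pi / 2"
      proof
        assume "\<bar>Im (y x)\<bar> < 3 * pi / 2"
        with \<open>\<not> \<bar>Im (y x)\<bar> < pi / 2\<close> have "cos (\<bar>Im (y x)\<bar> - pi) \<ge> 0" by (intro cos_ge_zero) auto
        then have "cos \<bar>Im (y x)\<bar> \<le> 0" by (simp add: cos_diff)
        with cos show False by simp
      qed
    qed
    then show ?thesis by (simp add: strip_def)
  qed
  have yc: "continuous_on A y" for A unfolding y_def by (intro continuous_intros Lc)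
  \<comment> \<open>Compactness gives one theta < pi/2 valid on the whole contour, so a single
    majorant serves in the interchange.\<close>
  obtain x1 where x1: "\<And>x. x \<in> {0..1} \<Longrightarrow> \<bar>Im (y x)\<bar> \<le> \<bar>Im (y x1)\<bar>"
  proof -
    have "continuous_on {0..1} (\<lambda>x. \<bar>Im (y x)\<bar>)" by (intro continuous_intros yc)
    from continuous_attains_sup[OF compact_Icc _ this] show ?thesis using that by fastforce
  qed
  define \<theta> where "\<theta> = \<bar>Im (y x1)\<bar>"
  have \<theta>: "\<theta> < pi / 2" using ystrip[of x1] by (simp add: \<theta>_def strip_def)
  have Pc: "continuous_on A P" for A unfolding P_def by (intro continuous_intros Uc Lc) (use U0 in auto)
  obtain M where M: "\<And>x. x \<in> {0..1} \<Longrightarrow> norm (P x) \<le> M"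
    using compact_imp_bounded[OF compact_continuous_image[OF Pc compact_Icc]] unfolding bounded_iff by blast
  define \<Lambda> where "\<Lambda> t = Lam (of_real (real k / 2) + \<i> * of_real t)" for t
  have \<Lambda>: "exp_decay \<Lambda>" unfolding \<Lambda>_def by (rule Lam_vertical_decay)
  then have \<Lambda>c: "continuous_on UNIV \<Lambda>" by (simp add: exp_decay_def)
  have pt: "critical_product w t * exp (\<xi> * of_real t) = integral {0..1} (\<lambda>x. P x * (\<Lambda> t * exp (- \<i> * y x * of_real t)))" for t
  proof -
    have "kummer_1F1 (of_real (real k / 2) - \<i> * of_real t) (of_nat k) w = kummer_1F1 (- (- of_real (real k / 2) + \<i> * of_real t)) (of_nat k) w"
      by simp
    also have "\<dots> = integral {0..1} (\<lambda>x. fact (k - 1) * (exp (U x) / U x ^ k * exp ((- of_real (real k / 2) + \<i> * of_real t) * L x) * circ r x))"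
      unfolding U_def L_def by (rule kummer_eq_integral[OF k c])
    finally have "critical_product w t * exp (\<xi> * of_real t) = integral {0..1} (\<lambda>x. (\<Lambda> t * exp (\<xi> * of_real t)) *
        (fact (k - 1) * (exp (U x) / U x ^ k * exp ((- of_real (real k / 2) + \<i> * of_real t) * L x) * circ r x)))"
      unfolding critical_product_def \<Lambda>_def[symmetric] Henstock_Kurzweil_Integration.integral_mult_right by (simp only: mult_ac)
    also have "(\<lambda>x. (\<Lambda> t * exp (\<xi> * of_real t)) * (fact (k - 1) * (exp (U x) / U x ^ k * exp ((- of_real (real k / 2) + \<i> * of_real t) * L x) * circ r x)))
       = (\<lambda>x. P x * (\<Lambda> t * exp (- \<i> * y x * of_real t)))"
    proof
      fix x
      have "(- of_real (real k / 2) + \<i> * of_real t) * L x = - of_real (real k / 2) * L x + (\<i> * of_real t) * L x"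
        by (simp only: distrib_right)
      then have 1: "exp ((- of_real (real k / 2) + \<i> * of_real t) * L x) = exp (- of_real (real k / 2) * L x) * exp ((\<i> * of_real t) * L x)"
        by (simp only: exp_add)
      have "- \<i> * y x * of_real t = \<xi> * of_real t + (\<i> * of_real t) * L x"
        by (simp add: y_def algebra_simps)
      then have 2: "exp (- \<i> * y x * of_real t) = exp (\<xi> * of_real t) * exp ((\<i> * of_real t) * L x)"
        by (simp only: exp_add)
      show "(\<Lambda> t * exp (\<xi> * of_real t)) * (fact (k - 1) * (exp (U x) / U x ^ k * exp ((- of_real (real k / 2) + \<i> * of_real t) * L x) * circ r x))
         = P x * (\<Lambda> t * exp (- \<i> * y x * of_real t))"
        unfolding 1 2 P_def by (simp only: mult_ac divide_inverse)
    qed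
    finally show ?thesis .
  qed
  have "laplace (critical_product w) \<xi> = (LBINT t. integral {0..1} (\<lambda>x. P x * (\<Lambda> t * exp (- \<i> * y x * of_real t))))"
    unfolding laplace_def pt ..
  also have "\<dots> = integral {0..1} (\<lambda>x. LBINT t. P x * (\<Lambda> t * exp (- \<i> * y x * of_real t)))"
  proof (rule lborel_integral_swap_unit_interval)
    show "continuous_on ({0..1} \<times> UNIV) (\<lambda>(x, t). P x * (\<Lambda> t * exp (- \<i> * y x * of_real t)))"
      unfolding case_prod_beta
      by (intro continuous_intros continuous_on_compose2[OF \<Lambda>c] continuous_on_compose2[OF Pc[of UNIV]] continuous_on_compose2[OF yc[of UNIV]]) auto
    show "integrable lborel (\<lambda>t. M * (norm (\<Lambda> t) * \<bar>t\<bar> ^ 0 * exp (\<theta> * \<bar>t\<bar>)))"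
      by (intro integrable_mult_right exp_decay_integrable_norm \<Lambda> \<theta>)
    fix x t :: real assume x: "x \<in> {0..1}"
    have "norm (exp (- \<i> * y x * of_real t)) \<le> exp (\<bar>Re (- \<i> * y x)\<bar> * \<bar>t\<bar>)" by (rule norm_exp_mult_of_real_le)
    also have "\<dots> \<le> exp (\<theta> * \<bar>t\<bar>)" using x1[OF x] by (simp add: \<theta>_def mult_right_mono)
    finally have "norm (exp (- \<i> * y x * of_real t)) \<le> exp (\<theta> * \<bar>t\<bar>)" .
    then show "norm (P x * (\<Lambda> t * exp (- \<i> * y x * of_real t))) \<le> M * (norm (\<Lambda> t) * \<bar>t\<bar> ^ 0 * exp (\<theta> * \<bar>t\<bar>))"
      unfolding norm_mult[of "P x"] norm_mult[of "\<Lambda> t"] using M[OF x] order_trans[OF norm_ge_zero M[OF x]]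
      by (intro mult_mono) (auto intro: mult_left_mono)
  qed
  also have "(\<lambda>x. LBINT t. P x * (\<Lambda> t * exp (- \<i> * y x * of_real t))) = (\<lambda>x. fact (k - 1) * of_real (2 * pi) * exp (\<i> * of_nat k * \<xi> / 2) *
     (exp (U x) / (U x - w) ^ k * F (exp (\<i> * \<xi>) * (U x / (U x - w))) * circ r x))"
  proof
    fix x
    have "(LBINT t. P x * (\<Lambda> t * exp (- \<i> * y x * of_real t))) = P x * (of_real (2 * pi) * (G (y x) * exp (of_real (real k / 2) * y x)))"
      unfolding integral_mult_right_zero \<Lambda>_def Lam_inversion[OF ystrip] ..
    also have "G (y x) = F (exp (\<i> * \<xi>) * (U x / (U x - w)))" unfolding G_def expy ..
    also have "exp (of_real (real k / 2) * y x) = exp (\<i> * of_nat k * \<xi> / 2) * exp (- of_real (real k / 2) * L x)"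
    proof -
      have "of_real (real k / 2) * y x = \<i> * of_nat k * \<xi> / 2 + - of_real (real k / 2) * L x"
        by (simp add: y_def field_simps)
      then show ?thesis by (simp only: exp_add)
    qed
    finally have eq: "(LBINT t. P x * (\<Lambda> t * exp (- \<i> * y x * of_real t))) =
       fact (k - 1) * of_real (2 * pi) * exp (\<i> * of_nat k * \<xi> / 2) * (exp (U x) * (exp (- of_real (real k / 2) * L x) * exp (- of_real (real k / 2) * L x) / U x ^ k)
         * F (exp (\<i> * \<xi>) * (U x / (U x - w))) * circ r x)"
      by (simp only: P_def mult_ac divide_inverse)
    \<comment> \<open>One half power comes from the Kummer exponent and one from the inversion
      formula; together with u^(-k) they make (u - w)^(-k).\<close>
    have "exp (- of_real (real k / 2) * L x) * exp (- of_real (real k / 2) * L x) = inverse (exp (L x) ^ k)"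
    proof -
      have "- of_real (real k / 2) * L x + - of_real (real k / 2) * L x = - (of_nat k * L x)" by simp
      then show ?thesis unfolding exp_add[symmetric] exp_of_nat_mult[symmetric] exp_minus[symmetric] by (rule arg_cong)
    qed
    then have "exp (- of_real (real k / 2) * L x) * exp (- of_real (real k / 2) * L x) / U x ^ k = inverse ((exp (L x) * U x) ^ k)"
      by (simp only: power_mult_distrib inverse_mult_distrib divide_inverse)
    also have "exp (L x) * U x = U x - w" unfolding expL using U0[of x] by (simp add: left_diff_distrib)
    finally show "(LBINT t. P x * (\<Lambda> t * exp (- \<i> * y x * of_real t))) = fact (k - 1) * of_real (2 * pi) * exp (\<i> * of_nat k * \<xi> / 2) *
     (exp (U x) / (U x - w) ^ k * F (exp (\<i> * \<xi>) * (U x / (U x - w))) * circ r x)"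
      unfolding eq by (simp only: divide_inverse)
  qed
  finally show ?thesis unfolding U_def .
qed

end

context twisted_cusp_form begin

text \<open>At X = iota the argument of f is the rational number (p - sigma)/q, with lowest terms
  h/r. Sending this cusp to infinity turns iota + eta into a point of height (q/r^2) Re(1/eta), so
  the rate is N = 2 pi q/r^2; it is smallest, namely 2 pi/q, when r = q.\<close>

lemma F_near_cusp:
  fixes \<iota> :: complex
  assumes \<iota>: "\<iota> = \<i> \<or> \<iota> = - \<i>"
  obtains N C where "N \<ge> 2 * pi / of_int q" "C > 0"
    "\<And>\<eta>. Re (1 / \<eta>) \<ge> 1 \<Longrightarrow> norm \<eta> ^ k * norm (F (\<iota> + \<eta>)) \<le> C * exp (- N * Re (1 / \<eta>))"
proof -
  obtain \<sigma> :: int where \<sigma>: "\<iota> = of_int \<sigma> * \<i>" "\<sigma> * \<sigma> = 1"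
    using \<iota> that by (metis minus_mult_minus mult_1 mult_minus_left of_int_1 of_int_minus)
  define g where "g = gcd (p - \<sigma>) q"
  define h where "h = (p - \<sigma>) div g"
  define r where "r = q div g"
  have g: "g > 0" unfolding g_def using q_pos by (simp add: gcd_pos_int)
  have hr: "p - \<sigma> = g * h" "q = g * r" by (simp_all add: h_def r_def g_def)
  have r: "r > 0" using hr(2) g q_pos by (simp add: zero_less_mult_iff)
  have rq: "r \<le> q" using hr(2) g r by (metis int_one_le_iff_zero_less mult_le_cancel_right1 not_less order_less_imp_le)
  have "coprime h r" unfolding h_def r_def g_def using q_pos by (intro div_gcd_coprime) auto
  then obtain b0 where "[h * b0 = 1] (mod r)" using cong_solve_coprime_int by blast
  then have "[- (h * b0) = - 1] (mod r)" by (simp add: cong_minus_minus_iff)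
  then have b: "[(- b0) * h = - 1] (mod r)" by (simp add: mult.commute)
  define y0 :: real where "y0 = of_int q / of_int r ^ 2"
  have y0: "y0 > 0" using r q_pos by (simp add: y0_def)
  obtain C where C: "C > 0" "\<And>\<tau>. Im \<tau> \<ge> y0 \<Longrightarrow> norm (f \<tau>) \<le> C * exp (- 2 * pi * Im \<tau>)"
    using f_exp_bound[OF y0] by auto
  show ?thesis
  proof (rule that[of "2 * pi * y0" "C * (of_int q / of_int r) ^ k"])
    have "of_int r ^ 2 \<le> (of_int q ^ 2 :: real)" using rq r by (intro power_mono) auto
    then have "1 / of_int q \<le> y0" using r q_pos by (simp add: y0_def field_simps power2_eq_square)
    then show "2 * pi / of_int q \<le> 2 * pi * y0" using mult_left_mono[of "1 / of_int q" y0 "2 * pi"] by simp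
    show "C * (of_int q / of_int r) ^ k > 0" using C r q_pos by simp
    fix \<eta> :: complex assume \<eta>: "Re (1 / \<eta>) \<ge> 1"
    then have n0: "\<eta> \<noteq> 0" by auto
    have pos: "Re \<eta> > 0"
    proof -
      have "Re (1 / \<eta>) = Re \<eta> / norm \<eta> ^ 2" by (simp add: Re_divide cmod_power2)
      then show ?thesis using \<eta> n0 by (smt (verit) divide_nonpos_nonneg zero_le_power2)
    qed
    have r0: "of_int r \<noteq> (0::complex)" "of_int q \<noteq> (0::complex)" using r q_pos by auto
    have g0: "of_int g \<noteq> (0::complex)" using g by simp
    have hq: "of_int (p - \<sigma>) / of_int q = (of_int h / of_int r :: complex)"
      unfolding hr of_int_mult using g0 by (rule mult_divide_mult_cancel_left)
    have arg: "of_int p / of_int q + \<i> * ((\<iota> + \<eta>) / of_int q) = of_int h / of_int r + \<i> * (\<eta> / of_int q)"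
      unfolding hq[symmetric] \<sigma>(1) using r0 by (simp add: field_simps)
    have "f (of_int (- b0) / of_int r + \<i> / (of_int r ^ 2 * (\<eta> / of_int q))) = (\<i> * of_int r * (\<eta> / of_int q)) ^ k * f (of_int h / of_int r + \<i> * (\<eta> / of_int q))"
      using pos q_pos by (intro modular_at_cusp r b) (simp add: Re_divide_of_real[of _ "of_int q", simplified])
    then have fF: "f (of_int (- b0) / of_int r + \<i> / (of_int r ^ 2 * (\<eta> / of_int q))) = (\<i> * of_int r * (\<eta> / of_int q)) ^ k * F (\<iota> + \<eta>)"
      unfolding F_def arg .
    have im: "Im (of_int (- b0) / of_int r + \<i> / (of_int r ^ 2 * (\<eta> / of_int q))) = y0 * Re (1 / \<eta>)"
    proof -
      have "\<i> / (of_int r ^ 2 * (\<eta> / of_int q)) = of_real y0 * (\<i> * (1 / \<eta>))" by (simp add: y0_def)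
      moreover have "of_int (- b0) / of_int r = (of_real (of_int (- b0) / of_int r) :: complex)" by simp
      moreover have "Im (of_real y0 * (\<i> * z)) = y0 * Re z" for z by simp
      ultimately show ?thesis by (simp only: plus_complex.sel Im_complex_of_real add_0)
    qed
    have "y0 * 1 \<le> y0 * Re (1 / \<eta>)" using \<eta> y0 by (intro mult_left_mono) auto
    then have "norm ((\<i> * of_int r * (\<eta> / of_int q)) ^ k * F (\<iota> + \<eta>)) \<le> C * exp (- 2 * pi * (y0 * Re (1 / \<eta>)))"
      unfolding fF[symmetric] using C(2) im by (metis mult.right_neutral)
    moreover have "norm ((\<i> * of_int r * (\<eta> / of_int q)) ^ k * F (\<iota> + \<eta>)) = (of_int r / of_int q) ^ k * (norm \<eta> ^ k * norm (F (\<iota> + \<eta>)))"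
      using r q_pos by (simp add: norm_mult norm_power norm_divide power_mult_distrib power_divide)
    moreover have "- 2 * pi * (y0 * Re (1 / \<eta>)) = - (2 * pi * y0) * Re (1 / \<eta>)" by simp
    ultimately have "(of_int r / of_int q) ^ k * (norm \<eta> ^ k * norm (F (\<iota> + \<eta>))) \<le> C * exp (- (2 * pi * y0) * Re (1 / \<eta>))" by (simp only:)
    then have "(of_int q / of_int r) ^ k * ((of_int r / of_int q) ^ k * (norm \<eta> ^ k * norm (F (\<iota> + \<eta>)))) \<le> (of_int q / of_int r) ^ k * (C * exp (- (2 * pi * y0) * Re (1 / \<eta>)))"
      using r q_pos by (intro mult_left_mono) auto
    moreover have "(of_int q / of_int r) ^ k * (of_int r / of_int q) ^ k = (1::real)"
      using r q_pos by (simp flip: power_mult_distrib)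
    ultimately show "norm \<eta> ^ k * norm (F (\<iota> + \<eta>)) \<le> C * (of_int q / of_int r) ^ k * exp (- (2 * pi * y0) * Re (1 / \<eta>))"
      by (simp only: mult.assoc[symmetric]) (simp only: mult_ac mult_1)
  qed
qed

text \<open>The saddle point circle for the contour variable encloses the branch cut of the Kummer
  integrand, and on it the exponential growth of the integrand is beaten by the decay of the cusp
  form at the cusp $(p - \<sigma>)/q$; this is where the shape of the domain enters.\<close>

lemma flat_critical_product:
  fixes \<sigma> :: real
  assumes k: "k > 0" and \<sigma>: "\<bar>\<sigma>\<bar> = 1" and w: "norm w + \<bar>Re w\<bar> < 2 * pi / of_int q"
  shows "flat_at_edge (critical_product w) (of_real \<sigma>)"
proof -
  \<comment> \<open>The limit of exp(i xi) at the edge selected by sigma.\<close>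
  define \<iota> where "\<iota> = \<i> * of_real \<sigma>"
  have \<iota>: "\<iota> = \<i> \<or> \<iota> = - \<i>" using \<sigma> by (auto simp: \<iota>_def abs_if split: if_splits)
  have ii: "\<iota> * \<iota> = - 1" and ni: "norm \<iota> = 1" using \<iota> by auto
  obtain N C where N: "N \<ge> 2 * pi / of_int q" and C: "C > 0"
    and Fb: "\<And>\<eta>. Re (1 / \<eta>) \<ge> 1 \<Longrightarrow> norm \<eta> ^ k * norm (F (\<iota> + \<eta>)) \<le> C * exp (- N * Re (1 / \<eta>))"
    using F_near_cusp[OF \<iota>] by metis
  have N0: "N > 0" using N q_pos by (smt (verit) divide_pos_pos of_int_0_less_iff pi_gt_zero)
  obtain \<rho> c where \<rho>: "norm w < \<rho>" and c: "c > 0"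
    and E: "\<And>v. norm v = \<rho> \<Longrightarrow> Re (v - \<iota> * w - of_real N + of_real N * \<iota> * w / v) \<le> - c"
    using saddle_circle[OF \<iota>, of w N] w N by (metis order_less_le_trans)
  have \<rho>0: "\<rho> > 0" using \<rho> norm_ge_zero[of w] by linarith
  define CE where "CE = \<rho> + norm w + N + N * norm w / \<rho>"
  define cA where "cA = (1 - norm w / \<rho>) / 2"
  have cA: "0 < cA" using \<rho> \<rho>0 by (simp add: cA_def)
  have CE: "CE > 0" using \<rho>0 N0 by (simp add: CE_def add_pos_nonneg)
  \<comment> \<open>Narrow enough for two uses of the cone estimate: with bounds c and
    \<open>CE\<close> for the phase on the circle, and with bounds \<open>cA\<close> and 2 for 1 - x
    w / v.\<close>
  define \<kappa> where "\<kappa> = min 1 (min (c / (2 * CE)) (cA / 4))"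
  have \<kappa>: "0 < \<kappa>" "\<kappa> \<le> 1" "\<kappa> * CE \<le> c / 2" "\<kappa> * 2 \<le> cA / 2"
  proof -
    show "0 < \<kappa>" "\<kappa> \<le> 1" "\<kappa> * 2 \<le> cA / 2" using c CE cA by (auto simp: \<kappa>_def)
    have "\<kappa> \<le> c / (2 * CE)" by (simp add: \<kappa>_def)
    then show "\<kappa> * CE \<le> c / 2" using CE by (simp add: field_simps)
  qed
  \<comment> \<open>In order: 1/4 for the Taylor estimate and |delta| at most 2|e|; kappa/24 to keep
    delta in its cone; the quotient so that |x w| stays below rho and the circle encloses w;
    \<open>cA\<close>/8 to ensure Re(1/eta) is at least 1.\<close>
  define \<epsilon> where "\<epsilon> = min (1/4) (min (\<kappa> / 24) (min ((\<rho> - norm w) / (4 * (norm w + 1))) (cA / 8)))"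
  have \<epsilon>: "0 < \<epsilon>" "\<epsilon> \<le> 1/4" "\<epsilon> \<le> \<kappa> / 24" "\<epsilon> \<le> cA / 8" "\<epsilon> \<le> (\<rho> - norm w) / (4 * (norm w + 1))"
  proof -
    have "0 < (\<rho> - norm w) / (4 * (norm w + 1))" using \<rho> by (intro divide_pos_pos) (simp_all add: add_nonneg_pos)
    then show "0 < \<epsilon>" using \<kappa> cA by (simp add: \<epsilon>_def)
    show "\<epsilon> \<le> 1/4" unfolding \<epsilon>_def by (rule min.cobounded1)
    show "\<epsilon> \<le> \<kappa> / 24" unfolding \<epsilon>_def by (rule min.coboundedI2, rule min.cobounded1)
    show "\<epsilon> \<le> (\<rho> - norm w) / (4 * (norm w + 1))"
      unfolding \<epsilon>_def by (rule min.coboundedI2, rule min.coboundedI2, rule min.cobounded1)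
    show "\<epsilon> \<le> cA / 8"
      unfolding \<epsilon>_def by (rule min.coboundedI2, rule min.coboundedI2, rule min.cobounded2)
  qed
  have \<epsilon>w: "norm w * (1 + 2 * \<epsilon>) \<le> (\<rho> + norm w) / 2"
  proof -
    have "\<epsilon> * (4 * (norm w + 1)) \<le> \<rho> - norm w" using \<epsilon>(5) by (simp add: pos_le_divide_eq add_nonneg_pos)
    moreover have "\<epsilon> * (4 * norm w) \<le> \<epsilon> * (4 * (norm w + 1))" using \<epsilon>(1) by (intro mult_left_mono) auto
    ultimately show ?thesis by (simp add: algebra_simps)
  qed
  define K where "K = fact (k - 1) * (2 * pi) * exp (real k) * (exp (N * norm w / \<rho>) * (C / \<rho> ^ k) * \<rho>) * (8 / c)"
  have bound: "norm (laplace (critical_product w) (of_real \<sigma> * (of_real (pi / 2) - e))) \<le> K * exp (- (c / 16) / norm e)"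
    if e: "0 < Re e" "\<bar>Im e\<bar> \<le> \<kappa> / 4 * Re e" "norm e < \<epsilon>" for e
  proof -
    define \<xi> where "\<xi> = of_real \<sigma> * (of_real (pi / 2) - e)"
    define x where "x = exp (\<i> * \<xi>)"
    define \<delta> where "\<delta> = x - \<iota>"
    have ne: "norm e > 0" using e(1) by auto
    have x_eq: "x = \<iota> * exp (- \<iota> * e)"
    proof -
      have "\<i> * \<xi> = \<iota> * of_real (pi / 2) + - \<iota> * e" by (simp add: \<xi>_def \<iota>_def algebra_simps)
      moreover have "exp (\<iota> * of_real (pi / 2)) = \<iota>"
        using \<iota> by (auto simp: exp_eq_polar cis_pi_half exp_minus simp flip: cis_conv_exp)
      ultimately show ?thesis unfolding x_def by (simp only: exp_add)
    qed
    \<comment> \<open>Since -iota^2 = 1, delta agrees with e to first order. The quadratic error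
      widens the cone, which is why e is confined to slope kappa/4 while delta gets slope
      kappa.\<close>
    have "\<delta> - e = \<iota> * (exp (- \<iota> * e) - 1 - (- \<iota> * e))"
      unfolding \<delta>_def x_eq using ii by (simp add: algebra_simps flip: mult.assoc)
    then have "norm (\<delta> - e) = norm (exp (- \<iota> * e) - 1 - (- \<iota> * e))" using ni by (simp add: norm_mult)
    also have "\<dots> \<le> 3 * norm (- \<iota> * e) ^ 2"
      using e(3) \<epsilon>(2) ni by (intro norm_exp_minus_linear_le) (simp add: norm_mult)
    also have "\<dots> \<le> 3 * \<epsilon> * norm e"
      using ni e(3) ne by (simp add: norm_mult power2_eq_square)
    finally have de: "norm (\<delta> - e) \<le> 3 * \<epsilon> * norm e" .
    have e2: "norm e \<le> 2 * Re e"
    proof -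
      have "\<kappa> / 4 * Re e \<le> 1 * Re e" using \<kappa>(2) e(1) by (intro mult_right_mono) auto
      then show ?thesis using cmod_le[of e] e by linarith
    qed
    have de': "norm (\<delta> - e) \<le> 6 * \<epsilon> * Re e"
      using de mult_left_mono[OF e2, of "3 * \<epsilon>"] \<epsilon>(1) by linarith
    have "6 * \<epsilon> * Re e \<le> 1/2 * Re e"
      using \<epsilon>(3) \<kappa>(2) e(1) by (intro mult_right_mono) linarith+
    then have Re_d: "Re \<delta> \<ge> Re e / 2"
      using de' abs_Re_le_cmod[of "\<delta> - e"] by simp
    have Re_d0: "Re \<delta> > 0" using Re_d e(1) by linarith
    have Im_d: "\<bar>Im \<delta>\<bar> \<le> \<kappa> * Re \<delta>"
    proof -
      have "\<bar>Im \<delta>\<bar> \<le> \<kappa> / 4 * Re e + 6 * \<epsilon> * Re e" using de' abs_Im_le_cmod[of "\<delta> - e"] e(2) by simp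
      also have "6 * \<epsilon> * Re e \<le> \<kappa> / 4 * Re e" using \<epsilon>(3) e(1) by (intro mult_right_mono) auto
      also have "\<kappa> / 4 * Re e + \<kappa> / 4 * Re e = \<kappa> * (Re e / 2)" by simp
      also have "\<dots> \<le> \<kappa> * Re \<delta>" using Re_d \<kappa>(1) by (intro mult_left_mono) auto
      finally show ?thesis by simp
    qed
    have nd: "norm \<delta> > 0" using Re_d0 by auto
    then have d0: "\<delta> \<noteq> 0" by auto
    have nd2: "norm \<delta> \<le> 2 * norm e"
    proof -
      have "norm \<delta> \<le> norm e + norm (\<delta> - e)" by (rule norm_triangle_sub)
      also have "3 * \<epsilon> * norm e \<le> 1 * norm e" using \<epsilon>(2) by (intro mult_right_mono) auto
      then have "norm (\<delta> - e) \<le> norm e" using de by linarith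
      finally show ?thesis by simp
    qed
    have nx: "norm x \<le> 1 + 2 * \<epsilon>"
      using norm_triangle_ineq[of \<iota> \<delta>] ni nd2 e(3) by (simp add: \<delta>_def)
    have xw: "norm (x * w) \<le> (\<rho> + norm w) / 2"
      using mult_left_mono[OF nx norm_ge_zero[of w]] \<epsilon>w by (simp add: norm_mult mult.commute)
    also have "(\<rho> + norm w) / 2 < \<rho>" using \<rho> by simp
    finally have xw': "norm (x * w) < \<rho>" .
    \<comment> \<open>The circle for u is the preimage of |v| = rho under v = delta u + iota w, so
      its radius grows like 1/|delta|.\<close>
    define r where "r = \<rho> / norm \<delta>"
    define ctr where "ctr = - \<iota> * w / \<delta>"
    have r0: "r > 0" using \<rho>0 nd by (simp add: r_def)
    define U where "U s = ctr + circ r s" for s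
    define v where "v s = \<delta> * circ r s" for s
    have nv: "norm (v s) = \<rho>" for s using r0 nd by (simp add: v_def norm_mult norm_circ r_def)
    have v0: "v s \<noteq> 0" for s using nv[of s] \<rho>0 by auto
    have U_eq: "U s = (v s - \<iota> * w) / \<delta>" for s using d0 by (simp add: U_def v_def ctr_def field_simps)
    have Uw_eq: "U s - w = (v s - x * w) / \<delta>" for s using d0 by (simp add: U_eq \<delta>_def field_simps)
    have vx0: "v s - x * w \<noteq> 0" for s using nv[of s] xw' by auto
    \<comment> \<open>Since x u - iota (u - w) = delta u + iota w = v, this is exactly the
      displacement of the argument of \<open>F\<close> from iota; the choice of v was made for this
      identity.\<close>
    define \<eta> where "\<eta> s = v s / (U s - w)" for s
    have arg: "x * (U s / (U s - w)) = \<iota> + \<eta> s" for s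
    proof -
      have "x * U s - \<iota> * (U s - w) = \<delta> * U s + \<iota> * w" by (simp add: \<delta>_def algebra_simps)
      also have "\<dots> = v s" unfolding U_eq using d0 by simp
      finally have "x * U s = \<iota> * (U s - w) + v s" by (simp add: algebra_simps)
      moreover have "U s - w \<noteq> 0" unfolding Uw_eq using vx0 d0 by simp
      ultimately show ?thesis by (simp add: \<eta>_def add_divide_distrib)
    qed
    have inv_eta: "1 / \<eta> s = (1 - x * w / v s) / \<delta>" for s
      unfolding \<eta>_def Uw_eq using v0[of s] d0 by (simp add: field_simps)
    have nxwv: "norm (x * w / v s) \<le> 1 - cA" for s
    proof -
      have "norm (x * w / v s) = norm (x * w) / \<rho>" by (simp add: norm_divide nv)
      also have "\<dots> \<le> (\<rho> + norm w) / 2 / \<rho>" using xw \<rho>0 by (intro divide_right_mono) auto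
      also have "\<dots> = 1 - cA" using \<rho>0 by (simp add: cA_def field_simps)
      finally show ?thesis .
    qed
    have Re_inv_eta: "Re (1 / \<eta> s) \<ge> 1" for s
    proof -
      have "Re (1 - x * w / v s) \<ge> cA" using nxwv[of s] complex_Re_le_cmod[of "x * w / v s"] by simp
      moreover have "norm (1 - x * w / v s) \<le> 2"
        using nxwv[of s] norm_triangle_ineq4[of 1 "x * w / v s"] cA by simp
      ultimately have "Re ((1 - x * w / v s) / \<delta>) \<ge> cA / (4 * norm \<delta>)"
        using cA Re_d0 Im_d \<kappa> by (intro Re_divide_ge_in_cone[where \<kappa> = \<kappa>]) auto
      moreover have "cA / (4 * norm \<delta>) \<ge> 1" using nd nd2 e(3) \<epsilon>(4) by (simp add: field_simps)
      ultimately show ?thesis unfolding inv_eta by linarith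
    qed
    have \<xi>: "\<bar>Re \<xi>\<bar> < pi / 2"
    proof -
      have "Re e < pi / 2" using complex_Re_le_cmod[of e] e(3) \<epsilon>(2) pi_gt3 by linarith
      then have "\<bar>pi / 2 - Re e\<bar> < pi / 2" using e(1) by linarith
      moreover have "Re \<xi> = \<sigma> * (pi / 2 - Re e)" by (simp add: \<xi>_def)
      ultimately show ?thesis using \<sigma> by (simp add: abs_mult)
    qed
    have ball0: "0 \<in> ball ctr r"
      using \<rho> nd ni by (simp add: ctr_def r_def dist_norm norm_mult norm_divide divide_strict_right_mono)
    have ballw: "w \<in> ball ctr r"
    proof -
      have "ctr - w = - (x * w) / \<delta>" using d0 by (simp add: ctr_def \<delta>_def field_simps)
      then have "norm (ctr - w) = norm (x * w) / norm \<delta>" by (simp only: norm_divide norm_minus_cancel)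
      also have "\<dots> < r" unfolding r_def using xw' nd by (rule divide_strict_right_mono)
      finally show ?thesis by (simp add: dist_norm)
    qed
    have posX: "Re (exp (\<i> * \<xi>) * ((ctr + circ r s) / (ctr + circ r s - w))) > 0" for s
    proof -
      have "Re (1 / \<eta> s) = Re (\<eta> s) / norm (\<eta> s) ^ 2" by (simp add: Re_divide cmod_power2)
      then have "Re (\<eta> s) > 0" using Re_inv_eta[of s] by (smt (verit) divide_nonpos_nonneg zero_le_power2)
      moreover have "Re \<iota> = 0" using \<iota> by auto
      ultimately show ?thesis unfolding x_def[symmetric] U_def[symmetric] arg by simp
    qed
    have integrand: "norm (fact (k - 1) * of_real (2 * pi) * exp (\<i> * of_nat k * \<xi> / 2) *
         (exp (U s) / (U s - w) ^ k * F (x * (U s / (U s - w))) * circ r s)) \<le> K * exp (- (c / 16) / norm e)" for s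
    proof -
      define Q where "Q = v s - \<iota> * w - of_real N + of_real N * \<iota> * w / v s"
      have Re_Q: "Re (- Q) \<ge> c" using E[OF nv[of s]] by (simp add: Q_def)
      have nQ: "norm (- Q) \<le> CE"
      proof -
        have "norm Q \<le> norm (v s) + norm (\<iota> * w) + norm (of_real N :: complex) + norm (of_real N * \<iota> * w / v s)"
          unfolding Q_def by (meson add_mono norm_triangle_ineq norm_triangle_ineq4 order_refl order_trans)
        then show ?thesis using N0 ni by (simp add: CE_def norm_mult norm_divide nv)
      qed
      have "Re (- Q / \<delta>) \<ge> c / (4 * norm \<delta>)"
        using Re_Q nQ c Re_d0 Im_d \<kappa> by (intro Re_divide_ge_in_cone[where \<kappa> = \<kappa>]) auto
      then have ReQ: "Re (Q / \<delta>) \<le> - (c / (4 * norm \<delta>))" by simp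
      \<comment> \<open>The growth exponent u and the decay exponent N/eta combine into the saddle
        phase divided by delta; the leftover N w / v is bounded on the circle.\<close>
      have "U s - of_real N * (1 / \<eta> s) = Q / \<delta> + of_real N * (w / v s)"
      proof -
        have xd: "x = \<iota> + \<delta>" by (simp add: \<delta>_def)
        show ?thesis unfolding inv_eta U_eq Q_def xd using d0 v0[of s]
          by (simp add: divide_simps) (simp add: algebra_simps)
      qed
      moreover have "Re (a - of_real N * b) = Re a - N * Re b" "Re (a + of_real N * b) = Re a + N * Re b" for a b
        by simp_all
      ultimately have "Re (U s) - N * Re (1 / \<eta> s) = Re (Q / \<delta>) + N * Re (w / v s)" by metis
      also have "N * Re (w / v s) \<le> N * norm w / \<rho>"
      proof -
        have "Re (w / v s) \<le> norm w / \<rho>" using complex_Re_le_cmod[of "w / v s"] by (simp add: norm_divide nv)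
        then show ?thesis using mult_left_mono[of "Re (w / v s)" "norm w / \<rho>" N] N0 by simp
      qed
      finally have expo: "Re (U s) - N * Re (1 / \<eta> s) \<le> - (c / (4 * norm \<delta>)) + N * norm w / \<rho>" using ReQ by linarith
      \<comment> \<open>As eta = v/(u - w) with |v| = rho, the kernel (u - w)^(-k) supplies just the
        factor eta^k that the bound near the cusp requires.\<close>
      have "norm (F (\<iota> + \<eta> s)) / norm (U s - w) ^ k = norm (\<eta> s) ^ k * norm (F (\<iota> + \<eta> s)) / \<rho> ^ k"
        using \<rho>0 by (simp add: \<eta>_def norm_divide power_divide nv)
      also have "\<dots> \<le> C * exp (- N * Re (1 / \<eta> s)) / \<rho> ^ k"
        using Fb[OF Re_inv_eta] \<rho>0 by (intro divide_right_mono) auto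
      finally have "exp (Re (U s)) * (norm (F (\<iota> + \<eta> s)) / norm (U s - w) ^ k) \<le> exp (Re (U s)) * (C * exp (- N * Re (1 / \<eta> s)) / \<rho> ^ k)"
        by (intro mult_left_mono) auto
      also have "\<dots> = exp (Re (U s) - N * Re (1 / \<eta> s)) * (C / \<rho> ^ k)" by (simp add: exp_diff exp_minus field_simps)
      also have "\<dots> \<le> exp (- (c / (4 * norm \<delta>)) + N * norm w / \<rho>) * (C / \<rho> ^ k)"
        using expo C \<rho>0 by (intro mult_right_mono) auto
      finally have main: "exp (Re (U s)) * (norm (F (\<iota> + \<eta> s)) / norm (U s - w) ^ k) \<le> exp (- (c / (4 * norm \<delta>)) + N * norm w / \<rho>) * (C / \<rho> ^ k)" .
      \<comment> \<open>Half of the exponent is sacrificed to absorb the factor 1/|delta| from the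
        length of the contour; then |delta| at most 2|e| turns c/8 into c/16.\<close>
      have "c / (8 * norm \<delta>) \<le> exp (c / (8 * norm \<delta>))" using exp_ge_add_one_self[of "c / (8 * norm \<delta>)"] by linarith
      then have "exp (- (c / (4 * norm \<delta>))) * (c / (8 * norm \<delta>)) \<le> exp (- (c / (4 * norm \<delta>))) * exp (c / (8 * norm \<delta>))"
        by (rule mult_left_mono) simp
      also have "\<dots> = exp (- (c / (8 * norm \<delta>)))" by (simp flip: exp_add)
      also have "\<dots> \<le> exp (- (c / 16) / norm e)" using nd2 nd ne c by (simp add: field_simps)
      finally have "(8 / c) * (exp (- (c / (4 * norm \<delta>))) * (c / (8 * norm \<delta>))) \<le> (8 / c) * exp (- (c / 16) / norm e)"
        using c by (intro mult_left_mono) auto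
      then have small: "exp (- (c / (4 * norm \<delta>))) / norm \<delta> \<le> (8 / c) * exp (- (c / 16) / norm e)" using c by simp
      have pre: "norm (exp (\<i> * of_nat k * \<xi> / 2)) \<le> exp (real k)"
      proof -
        have "\<bar>Im \<xi>\<bar> \<le> 1" using \<sigma> abs_Im_le_cmod[of e] e(3) \<epsilon>(2) by (simp add: \<xi>_def abs_mult)
        then have "real k * (- Im \<xi> / 2) \<le> real k * 1" by (intro mult_left_mono) auto
        then show ?thesis by (simp add: Re_divide_numeral)
      qed
      have "norm (fact (k - 1) * of_real (2 * pi) * exp (\<i> * of_nat k * \<xi> / 2) *
         (exp (U s) / (U s - w) ^ k * F (x * (U s / (U s - w))) * circ r s))
         = fact (k - 1) * (2 * pi) * norm (exp (\<i> * of_nat k * \<xi> / 2)) * ((exp (Re (U s)) * (norm (F (\<iota> + \<eta> s)) / norm (U s - w) ^ k)) * r)"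
        unfolding arg norm_mult norm_divide norm_power norm_fact using r0 by (simp add: norm_circ)
      also have "\<dots> \<le> fact (k - 1) * (2 * pi) * exp (real k) * ((exp (- (c / (4 * norm \<delta>)) + N * norm w / \<rho>) * (C / \<rho> ^ k)) * r)"
        by (rule mult_mono[OF mult_left_mono[OF pre] mult_right_mono[OF main]])
           (use r0 in \<open>auto intro!: mult_nonneg_nonneg divide_nonneg_nonneg\<close>)
      also have "\<dots> = fact (k - 1) * (2 * pi) * exp (real k) * (exp (N * norm w / \<rho>) * (C / \<rho> ^ k) * \<rho>) * (exp (- (c / (4 * norm \<delta>))) / norm \<delta>)"
        unfolding exp_add r_def by (simp only: mult_ac divide_inverse)
      also have "\<dots> \<le> fact (k - 1) * (2 * pi) * exp (real k) * (exp (N * norm w / \<rho>) * (C / \<rho> ^ k) * \<rho>) * ((8 / c) * exp (- (c / 16) / norm e))"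
        using small C \<rho>0 by (intro mult_left_mono) auto
      also have "\<dots> = K * exp (- (c / 16) / norm e)" by (simp add: K_def)
      finally show ?thesis .
    qed
    let ?g = "\<lambda>s. fact (k - 1) * of_real (2 * pi) * exp (\<i> * of_nat k * \<xi> / 2) *
         (exp (U s) / (U s - w) ^ k * F (x * (U s / (U s - w))) * circ r s)"
    have lap: "laplace (critical_product w) \<xi> = integral {0..1} ?g"
      using laplace_critical_product[OF k \<xi> ball0 ballw posX] unfolding x_def[symmetric] U_def[symmetric] .
    have "norm (integral {0..1} ?g) \<le> K * exp (- (c / 16) / norm e)"
    proof (cases "?g integrable_on {0..1}")
      case True
      from integral_norm_bound_integral[OF this integrable_const_ivl integrand] show ?thesis by simp
    next
      case False
      have "K \<ge> 0" using C c \<rho>0 by (simp add: K_def)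
      with False show ?thesis by (simp add: not_integrable_integral)
    qed
    then have "norm (laplace (critical_product w) \<xi>) \<le> K * exp (- (c / 16) / norm e)" unfolding lap .
    then show ?thesis by (simp only: \<xi>_def)
  qed
  have "0 < \<kappa> / 4" "0 < c / 16" using \<kappa>(1) c by auto
  then show ?thesis
    unfolding flat_at_edge_def using \<epsilon>(1) bound by blast
qed

end

section \<open>Bounded vertical shifts\<close>

lemma exp_decay_bounded:
  assumes "exp_decay A"
  obtains C where "C \<ge> 0" "\<And>t. norm (A t) \<le> C"
proof -
  obtain C where C: "\<And>t. norm (A t) \<le> C * exp (- 0 * \<bar>t\<bar>)"
    using assms pi_half_gt_zero unfolding exp_decay_def by blast
  then have "norm (A t) \<le> C" for t using C[of t] by simp
  then show ?thesis using that order_trans[OF norm_ge_zero] by blast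
qed

lemma exp_decay_add: "exp_decay A \<Longrightarrow> exp_decay B \<Longrightarrow> exp_decay (\<lambda>t. A t + B t)"
  unfolding exp_decay_def
proof (intro conjI allI impI; elim conjE)
  fix \<theta> :: real assume \<theta>: "\<theta> < pi / 2"
  assume "\<forall>\<theta><pi/2. \<exists>C. \<forall>t. norm (A t) \<le> C * exp (- \<theta> * \<bar>t\<bar>)" "\<forall>\<theta><pi/2. \<exists>C. \<forall>t. norm (B t) \<le> C * exp (- \<theta> * \<bar>t\<bar>)"
  with \<theta> obtain C D where "\<And>t. norm (A t) \<le> C * exp (- \<theta> * \<bar>t\<bar>)" "\<And>t. norm (B t) \<le> D * exp (- \<theta> * \<bar>t\<bar>)" by meson
  then have "norm (A t + B t) \<le> (C + D) * exp (- \<theta> * \<bar>t\<bar>)" for t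
    unfolding distrib_right by (rule norm_triangle_mono)
  then show "\<exists>C. \<forall>t. norm (A t + B t) \<le> C * exp (- \<theta> * \<bar>t\<bar>)" by blast
qed (intro continuous_intros)

lemma exp_decay_cnj: "exp_decay A \<Longrightarrow> exp_decay (\<lambda>t. cnj (A t))"
  unfolding exp_decay_def by (auto intro!: continuous_intros)

lemma exp_decay_cmult: "exp_decay A \<Longrightarrow> exp_decay (\<lambda>t. \<mu> * A t)"
  unfolding exp_decay_def
proof (intro conjI allI impI; elim conjE)
  fix \<theta> :: real assume \<theta>: "\<theta> < pi / 2"
  assume "\<forall>\<theta><pi/2. \<exists>C. \<forall>t. norm (A t) \<le> C * exp (- \<theta> * \<bar>t\<bar>)"
  with \<theta> obtain C where "\<And>t. norm (A t) \<le> C * exp (- \<theta> * \<bar>t\<bar>)" by meson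
  then have "norm (\<mu> * A t) \<le> (norm \<mu> * C) * exp (- \<theta> * \<bar>t\<bar>)" for t
    unfolding norm_mult mult.assoc by (rule mult_left_mono) simp
  then show "\<exists>C. \<forall>t. norm (\<mu> * A t) \<le> C * exp (- \<theta> * \<bar>t\<bar>)" by blast
qed (intro continuous_intros)

lemma laplace_add:
  assumes "exp_decay A" "exp_decay B" "\<bar>Re \<xi>\<bar> < pi / 2"
  shows "laplace (\<lambda>t. A t + B t) \<xi> = laplace A \<xi> + laplace B \<xi>"
  unfolding laplace_def distrib_right
  using exp_decay_integrable[OF assms(1,3), of 0] exp_decay_integrable[OF assms(2,3), of 0]
  by (intro Bochner_Integration.integral_add) simp_all

lemma laplace_cnj: "laplace (\<lambda>t. cnj (A t)) \<xi> = cnj (laplace A (cnj \<xi>))"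
  unfolding laplace_def Bochner_Integration.integral_cnj[symmetric] by (simp add: exp_cnj)

lemma laplace_cmult: "laplace (\<lambda>t. \<mu> * A t) \<xi> = \<mu> * laplace A \<xi>"
  unfolding laplace_def mult.assoc by (rule integral_mult_right_zero)

lemma abs_Re_near_edge:
  fixes \<sigma> :: real
  assumes "\<bar>\<sigma>\<bar> = 1" "0 < Re e" "norm e < 1"
  shows "\<bar>Re (of_real \<sigma> * (of_real (pi / 2) - e))\<bar> < pi / 2"
proof -
  have "Re e < pi / 2" using complex_Re_le_cmod[of e] assms(3) pi_gt3 by linarith
  then have "\<bar>pi / 2 - Re e\<bar> < pi / 2" using assms(2) by linarith
  moreover have "Re (of_real \<sigma> * (of_real (pi / 2) - e)) = \<sigma> * (pi / 2 - Re e)" by simp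
  ultimately show ?thesis using assms(1) by (simp add: abs_mult)
qed

text \<open>The switch \<open>P\<close> covers conjugation as well, because the cone is symmetric
  about the real axis. The bound |xi| at most pi may be assumed since only points near the edge
  matter.\<close>

lemma flat_at_edge_transfer:
  fixes \<sigma> :: real
  assumes "flat_at_edge A (of_real \<sigma>)" "\<bar>\<sigma>\<bar> = 1" "M \<ge> 0"
    and le: "\<And>\<xi>. \<bar>Re \<xi>\<bar> < pi / 2 \<Longrightarrow> norm \<xi> \<le> pi \<Longrightarrow> norm (laplace B \<xi>) \<le> M * norm (laplace A (if P then \<xi> else cnj \<xi>))"
  shows "flat_at_edge B (of_real \<sigma>)"
proof -
  obtain \<kappa> \<epsilon> c C where *: "\<kappa> > 0" "\<epsilon> > 0" "c > 0"
    "\<And>e. 0 < Re e \<Longrightarrow> \<bar>Im e\<bar> \<le> \<kappa> * Re e \<Longrightarrow> norm e < \<epsilon> \<Longrightarrow> norm (laplace A (of_real \<sigma> * (of_real (pi / 2) - e))) \<le> C * exp (- c / norm e)"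
    using assms(1) unfolding flat_at_edge_def by blast
  have "norm (laplace B (of_real \<sigma> * (of_real (pi / 2) - e))) \<le> M * C * exp (- c / norm e)"
    if e: "0 < Re e" "\<bar>Im e\<bar> \<le> \<kappa> * Re e" "norm e < min \<epsilon> 1" for e
  proof -
    define e' where "e' = (if P then e else cnj e)"
    have "norm (of_real \<sigma> * (of_real (pi / 2) - e)) \<le> pi / 2 + norm e"
      using assms(2) norm_triangle_ineq4[of "of_real (pi / 2)" e] by (simp add: norm_mult)
    also have "\<dots> \<le> pi" using e(3) pi_gt3 by simp
    finally have "norm (laplace B (of_real \<sigma> * (of_real (pi / 2) - e))) \<le> M * norm (laplace A (if P then of_real \<sigma> * (of_real (pi / 2) - e) else cnj (of_real \<sigma> * (of_real (pi / 2) - e))))"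
      using e by (intro le abs_Re_near_edge assms(2)) auto
    also have "(if P then of_real \<sigma> * (of_real (pi / 2) - e) else cnj (of_real \<sigma> * (of_real (pi / 2) - e))) = of_real \<sigma> * (of_real (pi / 2) - e')"
      by (simp add: e'_def)
    also have "M * norm (laplace A (of_real \<sigma> * (of_real (pi / 2) - e'))) \<le> M * (C * exp (- c / norm e'))"
      using e assms(3) by (intro mult_left_mono *(4)) (auto simp: e'_def)
    also have "norm e' = norm e" by (simp add: e'_def)
    finally show ?thesis by (simp only: mult.assoc)
  qed
  moreover have "min \<epsilon> 1 > 0" using *(2) by simp
  ultimately show ?thesis unfolding flat_at_edge_def using *(1,3) by blast
qed

lemma flat_at_edge_add:
  fixes \<sigma> :: real
  assumes "exp_decay A" "exp_decay B" "flat_at_edge A (of_real \<sigma>)" "flat_at_edge B (of_real \<sigma>)" "\<bar>\<sigma>\<bar> = 1"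
  shows "flat_at_edge (\<lambda>t. A t + B t) (of_real \<sigma>)"
proof -
  obtain \<kappa>1 \<epsilon>1 c1 C1 where 1: "\<kappa>1 > 0" "\<epsilon>1 > 0" "c1 > 0"
    "\<And>e. 0 < Re e \<Longrightarrow> \<bar>Im e\<bar> \<le> \<kappa>1 * Re e \<Longrightarrow> norm e < \<epsilon>1 \<Longrightarrow> norm (laplace A (of_real \<sigma> * (of_real (pi / 2) - e))) \<le> C1 * exp (- c1 / norm e)"
    using assms(3) unfolding flat_at_edge_def by blast
  obtain \<kappa>2 \<epsilon>2 c2 C2 where 2: "\<kappa>2 > 0" "\<epsilon>2 > 0" "c2 > 0"
    "\<And>e. 0 < Re e \<Longrightarrow> \<bar>Im e\<bar> \<le> \<kappa>2 * Re e \<Longrightarrow> norm e < \<epsilon>2 \<Longrightarrow> norm (laplace B (of_real \<sigma> * (of_real (pi / 2) - e))) \<le> C2 * exp (- c2 / norm e)"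
    using assms(4) unfolding flat_at_edge_def by blast
  define \<kappa> \<epsilon> c where "\<kappa> = min \<kappa>1 \<kappa>2" and "\<epsilon> = min 1 (min \<epsilon>1 \<epsilon>2)" and "c = min c1 c2"
  have "norm (laplace (\<lambda>t. A t + B t) (of_real \<sigma> * (of_real (pi / 2) - e))) \<le> (\<bar>C1\<bar> + \<bar>C2\<bar>) * exp (- c / norm e)"
    if e: "0 < Re e" "\<bar>Im e\<bar> \<le> \<kappa> * Re e" "norm e < \<epsilon>" for e
  proof -
    have "\<kappa> * Re e \<le> \<kappa>1 * Re e" "\<kappa> * Re e \<le> \<kappa>2 * Re e" using e(1) by (auto simp: \<kappa>_def intro!: mult_right_mono)
    then have im: "\<bar>Im e\<bar> \<le> \<kappa>1 * Re e" "\<bar>Im e\<bar> \<le> \<kappa>2 * Re e" using e(2) by linarith+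
    have ne: "norm e > 0" using e(1) by auto
    have x: "X * exp (- d / norm e) \<le> \<bar>X\<bar> * exp (- c / norm e)" if "c \<le> d" for X d
    proof (rule mult_mono)
      have "c / norm e \<le> d / norm e" using that ne by (intro divide_right_mono) auto
      then show "exp (- d / norm e) \<le> exp (- c / norm e)" by simp
    qed auto
    have lt: "norm e < \<epsilon>1" "norm e < \<epsilon>2" "norm e < 1" and cc: "c \<le> c1" "c \<le> c2"
      using e(3) by (simp_all add: \<epsilon>_def c_def)
    have "norm (laplace A (of_real \<sigma> * (of_real (pi / 2) - e))) \<le> \<bar>C1\<bar> * exp (- c / norm e)"
      by (rule order_trans[OF 1(4)[OF e(1) im(1) lt(1)] x[OF cc(1)]])
    moreover have "norm (laplace B (of_real \<sigma> * (of_real (pi / 2) - e))) \<le> \<bar>C2\<bar> * exp (- c / norm e)"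
      by (rule order_trans[OF 2(4)[OF e(1) im(2) lt(2)] x[OF cc(2)]])
    moreover have "laplace (\<lambda>t. A t + B t) (of_real \<sigma> * (of_real (pi / 2) - e)) = laplace A (of_real \<sigma> * (of_real (pi / 2) - e)) + laplace B (of_real \<sigma> * (of_real (pi / 2) - e))"
      by (rule laplace_add[OF assms(1,2) abs_Re_near_edge[OF assms(5) e(1) lt(3)]])
    ultimately show ?thesis unfolding distrib_right by (simp only: norm_triangle_mono)
  qed
  moreover have "\<kappa> > 0" "\<epsilon> > 0" "c > 0" using 1 2 by (auto simp: \<kappa>_def \<epsilon>_def c_def)
  ultimately show ?thesis unfolding flat_at_edge_def by blast
qed

locale bounded_shifts =
  fixes c l :: "nat \<Rightarrow> real" and M :: real and H :: "real \<Rightarrow> complex"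
  assumes summable_c: "summable (\<lambda>j. \<bar>c j\<bar>)" and l_le: "\<And>j. \<bar>l j\<bar> \<le> M" and H: "exp_decay H"
begin

definition shift_sum :: "real \<Rightarrow> complex" where
  "shift_sum t = (\<Sum>j. of_real (c j) * H (t + l j))"

lemma summable_norm_shifts: "summable (\<lambda>j. norm (of_real (c j) * H (t + l j)))"
proof -
  obtain C where C: "C \<ge> 0" "\<And>t. norm (H t) \<le> C" using exp_decay_bounded[OF H] by metis
  show ?thesis
  proof (rule summable_comparison_test'[OF summable_mult2[OF summable_c, of C]])
    show "norm (norm (of_real (c j) * H (t + l j))) \<le> \<bar>c j\<bar> * C" for j
      using C(2)[of "t + l j"] by (simp add: norm_mult mult_left_mono)
  qed
qed

lemma continuous_on_H: "continuous_on UNIV H" using H by (simp add: exp_decay_def)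

lemma exp_decay_shift_sum: "exp_decay shift_sum"
  unfolding exp_decay_def
proof (intro conjI allI impI)
  obtain C where C: "C \<ge> 0" "\<And>t. norm (H t) \<le> C" using exp_decay_bounded[OF H] by metis
  have "uniform_limit UNIV (\<lambda>n t. \<Sum>j<n. of_real (c j) * H (t + l j)) (\<lambda>t. \<Sum>j. of_real (c j) * H (t + l j)) sequentially"
  proof (rule Weierstrass_m_test[OF _ summable_mult2[OF summable_c, of C]])
    show "norm (of_real (c j) * H (t + l j)) \<le> \<bar>c j\<bar> * C" for j t
      using C(2)[of "t + l j"] by (simp add: norm_mult mult_left_mono)
  qed
  moreover have "continuous_on UNIV (\<lambda>t. \<Sum>j<n. of_real (c j) * H (t + l j))" for n
    by (intro continuous_intros continuous_on_compose2[OF continuous_on_H]) auto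
  ultimately show "continuous_on UNIV shift_sum"
    unfolding shift_sum_def[abs_def]
    by (intro uniform_limit_theorem[where F = sequentially] always_eventually) auto
  fix \<theta> :: real assume \<theta>: "\<theta> < pi / 2"
  obtain D where D: "\<And>t. norm (H t) \<le> D * exp (- \<theta> * \<bar>t\<bar>)" using H \<theta> unfolding exp_decay_def by blast
  have D0: "D \<ge> 0" using order_trans[OF norm_ge_zero D[of 0]] by simp
  have "norm (shift_sum t) \<le> (\<Sum>j. \<bar>c j\<bar>) * (D * exp (\<bar>\<theta>\<bar> * M)) * exp (- \<theta> * \<bar>t\<bar>)" for t
  proof -
    have "norm (of_real (c j) * H (t + l j)) \<le> \<bar>c j\<bar> * (D * exp (\<bar>\<theta>\<bar> * M) * exp (- \<theta> * \<bar>t\<bar>))" for j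
    proof -
      have "\<theta> * (\<bar>t\<bar> - \<bar>t + l j\<bar>) \<le> \<bar>\<theta>\<bar> * \<bar>\<bar>t\<bar> - \<bar>t + l j\<bar>\<bar>" by (metis abs_ge_self abs_mult)
      also have "\<dots> \<le> \<bar>\<theta>\<bar> * M" using l_le[of j] by (intro mult_left_mono) auto
      finally have "exp (- \<theta> * \<bar>t + l j\<bar>) \<le> exp (\<bar>\<theta>\<bar> * M) * exp (- \<theta> * \<bar>t\<bar>)"
        unfolding exp_add[symmetric] by (simp add: algebra_simps)
      then have "D * exp (- \<theta> * \<bar>t + l j\<bar>) \<le> D * exp (\<bar>\<theta>\<bar> * M) * exp (- \<theta> * \<bar>t\<bar>)"
        unfolding mult.assoc using D0 by (rule mult_left_mono)
      then show ?thesis using D[of "t + l j"] by (simp add: norm_mult mult_left_mono)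
    qed
    then have "norm (shift_sum t) \<le> (\<Sum>j. \<bar>c j\<bar> * (D * exp (\<bar>\<theta>\<bar> * M) * exp (- \<theta> * \<bar>t\<bar>)))"
      unfolding shift_sum_def by (rule norm_suminf_le) (rule summable_mult2[OF summable_c])
    also have "\<dots> = (\<Sum>j. \<bar>c j\<bar>) * (D * exp (\<bar>\<theta>\<bar> * M) * exp (- \<theta> * \<bar>t\<bar>))"
      by (rule suminf_mult2[OF summable_c, symmetric])
    finally show ?thesis by (simp only: mult.assoc)
  qed
  then show "\<exists>C. \<forall>t. norm (shift_sum t) \<le> C * exp (- \<theta> * \<bar>t\<bar>)" by blast
qed

text \<open>A shift by l multiplies the transform by exp(-xi l), of modulus at most exp(pi M).
  Summing, the transform of the series is that of \<open>H\<close> times an absolutely convergent,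
  uniformly bounded factor.\<close>

lemma norm_laplace_shift_sum_le:
  assumes \<xi>: "\<bar>Re \<xi>\<bar> < pi / 2" "norm \<xi> \<le> pi"
  shows "norm (laplace shift_sum \<xi>) \<le> (\<Sum>j. \<bar>c j\<bar> * exp (pi * M)) * norm (laplace H \<xi>)"
proof -
  define g where "g j t = of_real (c j) * H (t + l j) * exp (\<xi> * of_real t)" for j t
  define h where "h t = H t * exp (\<xi> * of_real t)" for t
  have hI: "integrable lborel h"
    using exp_decay_integrable[OF H \<xi>(1), of 0] unfolding h_def[abs_def] by simp
  have e: "norm (exp (- \<xi> * of_real (l j))) \<le> exp (pi * M)" for j
  proof -
    have "norm (- \<xi> * of_real (l j)) \<le> pi * M"
      unfolding norm_mult using \<xi>(2) l_le[of j] by (intro mult_mono) auto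
    then show ?thesis using norm_exp[of "- \<xi> * of_real (l j)"] by (meson exp_le_cancel_iff order_trans)
  qed
  have g_eq: "g j t = of_real (c j) * exp (- \<xi> * of_real (l j)) * h (l j + 1 * t)" for j t
  proof -
    have "\<xi> * of_real t = - \<xi> * of_real (l j) + \<xi> * of_real (l j + 1 * t)" by (simp add: algebra_simps)
    then have e2: "exp (\<xi> * of_real t) = exp (- \<xi> * of_real (l j)) * exp (\<xi> * of_real (l j + 1 * t))"
      unfolding exp_add[symmetric] by (rule arg_cong)
    have "t + l j = l j + 1 * t" by simp
    then show ?thesis unfolding g_def h_def e2 by (simp only: mult_ac)
  qed
  have gi: "integrable lborel (g j)" for j
    unfolding g_eq[abs_def] by (rule integrable_mult_right[OF lborel_integrable_real_affine[OF hI, of 1 "l j"]]) simp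
  have aff: "(LBINT t. h (l j + 1 * t)) = laplace H \<xi>" "(LBINT t. norm (h (l j + 1 * t))) = (LBINT t. norm (h t))" for j
    using lborel_integral_real_affine[of 1 h "l j"] lborel_integral_real_affine[of 1 "\<lambda>t. norm (h t)" "l j"]
    by (simp_all only: laplace_def h_def[abs_def, symmetric] abs_one scaleR_one)
  have gI: "(LBINT t. g j t) = of_real (c j) * exp (- \<xi> * of_real (l j)) * laplace H \<xi>" for j
    unfolding g_eq aff(1)[symmetric, of j] by (rule integral_mult_right_zero)
  define I where "I = (LBINT t. norm (h t))"
  have gn: "(LBINT t. norm (g j t)) = \<bar>c j\<bar> * norm (exp (- \<xi> * of_real (l j))) * I" for j
  proof -
    have "(LBINT t. norm (g j t)) = (LBINT t. \<bar>c j\<bar> * norm (exp (- \<xi> * of_real (l j))) * norm (h (l j + 1 * t)))"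
      unfolding g_eq norm_mult norm_of_real ..
    also have "\<dots> = \<bar>c j\<bar> * norm (exp (- \<xi> * of_real (l j))) * (LBINT t. norm (h (l j + 1 * t)))"
      by (rule integral_mult_right_zero)
    finally show ?thesis unfolding aff(2) I_def .
  qed
  have "I \<ge> 0" by (simp add: I_def)
  have "(\<lambda>j. LBINT t. g j t) sums (LBINT t. \<Sum>j. g j t)"
  proof (rule sums_integral[OF gi])
    show "AE t in lborel. summable (\<lambda>j. norm (g j t))"
    proof (rule AE_I2)
      fix t
      show "summable (\<lambda>j. norm (g j t))"
        unfolding g_def norm_mult[of "_ * H _"] by (rule summable_mult2[OF summable_norm_shifts])
    qed
    show "summable (\<lambda>j. LBINT t. norm (g j t))"
    proof (rule summable_comparison_test'[OF summable_mult2[OF summable_c, of "exp (pi * M) * I"]])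
      show "norm (LBINT t. norm (g j t)) \<le> \<bar>c j\<bar> * (exp (pi * M) * I)" for j
      proof -
        have "\<bar>c j\<bar> * norm (exp (- \<xi> * of_real (l j))) * I \<le> \<bar>c j\<bar> * (exp (pi * M) * I)"
          unfolding mult.assoc using e[of j] \<open>I \<ge> 0\<close> by (intro mult_left_mono mult_right_mono) auto
        moreover have "0 \<le> (LBINT t. norm (g j t))" by simp
        ultimately show ?thesis unfolding gn[symmetric] by simp
      qed
    qed
  qed
  moreover have "(\<Sum>j. g j t) = shift_sum t * exp (\<xi> * of_real t)" for t
    unfolding g_def shift_sum_def
    by (rule suminf_mult2[symmetric]) (rule summable_norm_cancel[OF summable_norm_shifts])
  ultimately have s: "(\<lambda>j. of_real (c j) * exp (- \<xi> * of_real (l j)) * laplace H \<xi>) sums laplace shift_sum \<xi>"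
    unfolding gI by (simp only: laplace_def[of shift_sum])
  have le: "norm (of_real (c j) * exp (- \<xi> * of_real (l j)) * laplace H \<xi>) \<le> \<bar>c j\<bar> * exp (pi * M) * norm (laplace H \<xi>)" for j
    unfolding norm_mult norm_of_real using e[of j] by (intro mult_right_mono mult_left_mono) auto
  have sm: "summable (\<lambda>j. \<bar>c j\<bar> * exp (pi * M))" by (rule summable_mult2[OF summable_c])
  have "norm (laplace shift_sum \<xi>) \<le> (\<Sum>j. \<bar>c j\<bar> * exp (pi * M) * norm (laplace H \<xi>))"
    unfolding sums_unique[OF s] by (rule norm_suminf_le[OF le summable_mult2[OF sm]])
  also have "\<dots> = (\<Sum>j. \<bar>c j\<bar> * exp (pi * M)) * norm (laplace H \<xi>)"
    by (rule suminf_mult2[OF sm, symmetric])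
  finally show ?thesis .
qed

lemma flat_shift_sum:
  fixes \<sigma> :: real
  assumes "flat_at_edge H (of_real \<sigma>)" "\<bar>\<sigma>\<bar> = 1"
  shows "flat_at_edge shift_sum (of_real \<sigma>)"
proof (rule flat_at_edge_transfer[OF assms, where P = True])
  show "0 \<le> (\<Sum>j. \<bar>c j\<bar> * exp (pi * M))" by (intro suminf_nonneg summable_mult2[OF summable_c]) auto
qed (simp add: norm_laplace_shift_sum_le)

end

section \<open>Realness on the critical line and the final assembly\<close>

context twisted_cusp_form begin

text \<open>For even k the constant i^k is 1 or -1, so \<open>Lam\<close> is real or purely
  imaginary on the line and \<open>\<mu>\<close> is 1 or i.\<close>

lemma Lam_real_on_critical_line:
  assumes "even k"
  obtains \<mu> where "\<mu> \<noteq> 0" "\<And>t. cnj (\<mu> * Lam (of_real (real k / 2) + \<i> * of_real t)) = \<mu> * Lam (of_real (real k / 2) + \<i> * of_real t)"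
proof -
  have refl: "cnj (Lam (of_real (real k / 2) + \<i> * of_real t)) = \<i> ^ k * Lam (of_real (real k / 2) + \<i> * of_real t)" for t
  proof -
    have "of_nat k - cnj (of_real (real k / 2) + \<i> * of_real t) = of_real (real k / 2) + \<i> * of_real t"
      by (simp add: complex_eq_iff)
    then show ?thesis using Lam_reflect[of "of_real (real k / 2) + \<i> * of_real t"] by simp
  qed
  obtain m where m: "k = 2 * m" using assms by blast
  have "\<i> ^ k = (- 1) ^ m" by (simp add: m power_mult)
  then consider "\<i> ^ k = 1" | "\<i> ^ k = - 1" by (cases "even m") auto
  then show ?thesis
  proof cases
    case 1
    then show ?thesis using refl by (intro that[of 1]) auto
  next
    case 2
    then show ?thesis using refl by (intro that[of \<i>]) auto
  qed
qed

lemma Lam_eq_0_if_f_eq_0: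
  assumes "\<And>\<tau>. Im \<tau> > 0 \<Longrightarrow> f \<tau> = 0" shows "Lam s = 0"
proof -
  have "G (of_real v) = 0" for v
    unfolding G_def F_def using q_pos by (intro assms) (auto simp: Im_F_arg Re_exp)
  then show ?thesis by (simp add: Lam_def)
qed

end

theorem theorem1p4:
  fixes f :: "complex \<Rightarrow> complex" and k :: nat and a :: "nat \<Rightarrow> real"
    and p q :: int and c l :: "nat \<Rightarrow> real" and z :: complex
  assumes "cusp_form_SL2Z k f"
    and "has_fourier_coeffs f a"
    and "q > 0"
    and "[p ^ 2 = 1] (mod q)"
    and "\<And>j. c j \<noteq> 0"
    and "summable (\<lambda>j. \<bar>c j\<bar>)"
    and "inj l"
    and "bounded (range l)"
    and "Sup (range l) \<in> range l"
    and "Inf (range l) \<in> range l"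
    and "z \<in> domain_D q"
  shows "infinite {s. Re s = real k / 2 \<and>
    (\<lambda>j. of_real (c j)
          * of_real (2 * pi / of_int q) powr (- s - \<i> * of_real (l j))
          * Gamma (s + \<i> * of_real (l j))
          * twisted_L k a (s + \<i> * of_real (l j)) (of_int p / of_int q)
          * (kummer_1F1 (of_nat k - s - \<i> * of_real (l j)) (of_nat k) (z ^ 2 / 4)
             + kummer_1F1 (of_nat k - cnj s + \<i> * of_real (l j)) (of_nat k) ((cnj z) ^ 2 / 4)))
      sums 0}" (is "infinite {s. _ \<and> ?T s sums 0}")
proof -
  interpret twisted_cusp_form k f a p q by unfold_locales fact+
  define \<s> where "\<s> t = of_real (real k / 2) + \<i> * of_real t" for t
  have inj: "inj \<s>" by (rule injI) (simp add: \<s>_def complex_eq_iff)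
  have reduce: "infinite {s. Re s = real k / 2 \<and> ?T s sums 0}" if "infinite Z" "\<And>t. t \<in> Z \<Longrightarrow> ?T (\<s> t) sums 0" for Z
  proof (rule infinite_super)
    show "\<s> ` Z \<subseteq> {s. Re s = real k / 2 \<and> ?T s sums 0}" using that(2) by (auto simp: \<s>_def)
    show "infinite (\<s> ` Z)" using that(1) inj by (simp add: finite_image_iff inj_on_subset)
  qed
  show ?thesis
  proof (cases "k = 0 \<or> odd k")
    \<comment> \<open>Here f vanishes identically, every term of the series is 0, and each point of
      the line is a zero.\<close>
    case True
    have "Lam s = 0" for s by (rule Lam_eq_0_if_f_eq_0) (rule f_eq_0_of_weight_0_or_odd[OF True])
    then have "twisted_L k a s (of_int p / of_int q) = 0" for s by (simp add: twisted_L_eq Lfun_def)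
    then show ?thesis by (intro reduce[of UNIV]) (simp_all add: infinite_UNIV_char_0)
  next
    case False
    then have k: "k > 0" "even k" by auto
    define w where "w = z ^ 2 / 4"
    have w: "norm w + \<bar>Re w\<bar> < 2 * pi / of_int q"
      unfolding w_def by (rule domain_D_parabolic) fact+
    obtain \<mu> where \<mu>: "\<mu> \<noteq> 0" "\<And>t. cnj (\<mu> * Lam (\<s> t)) = \<mu> * Lam (\<s> t)"
      using Lam_real_on_critical_line[OF k(2)] unfolding \<s>_def by metis
    \<comment> \<open>Since \<open>\<mu>\<close> times \<open>Lam\<close> is real on the line, the
      conjugate of \<open>B\<close> is the same multiple of the second Kummer function; their sum is
      thus real and is \<open>\<mu>\<close> times a term of the series without its
      coefficient.\<close>
    define B where "B t = \<mu> * critical_product w t" for t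
    define h where "h t = 2 * Re (B t)" for t
    define H where "H t = B t + cnj (B t)" for t
    have hH: "of_real (h t) = H t" for t by (simp add: h_def H_def complex_add_cnj)
    have H_eq: "H t = \<mu> * (Lam (\<s> t) * (kummer_1F1 (of_real (real k / 2) - \<i> * of_real t) (of_nat k) w
        + kummer_1F1 (of_real (real k / 2) + \<i> * of_real t) (of_nat k) (cnj w)))" for t
    proof -
      let ?K = "kummer_1F1 (of_real (real k / 2) - \<i> * of_real t) (of_nat k) w"
      have "kummer_1F1 (of_real (real k / 2) + \<i> * of_real t) (of_nat k) (cnj w) = cnj ?K"
        using kummer_1F1_cnj[OF k(1), of "of_real (real k / 2) - \<i> * of_real t" w] by simp
      moreover have "B t = (\<mu> * Lam (\<s> t)) * ?K" by (simp add: B_def critical_product_def \<s>_def)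
      moreover from this have "cnj (B t) = (\<mu> * Lam (\<s> t)) * cnj ?K"
        using \<mu>(2)[of t] by (simp only: complex_cnj_mult[of "\<mu> * Lam (\<s> t)"])
      ultimately show ?thesis unfolding H_def by (simp only: distrib_left mult.assoc)
    qed
    have Bd: "exp_decay B" unfolding B_def by (intro exp_decay_cmult exp_decay_critical_product k)
    have Hd: "exp_decay H" unfolding H_def by (intro exp_decay_add exp_decay_cnj Bd)
    have Hflat: "flat_at_edge H (of_real \<sigma>)" if \<sigma>: "\<bar>\<sigma>\<bar> = 1" for \<sigma> :: real
    proof -
      have lB: "laplace B \<xi> = \<mu> * laplace (critical_product w) \<xi>" for \<xi>
        unfolding B_def[abs_def] by (rule laplace_cmult)
      have "flat_at_edge B (of_real \<sigma>)"
        by (rule flat_at_edge_transfer[OF flat_critical_product[OF k(1) \<sigma> w] \<sigma>, of "norm \<mu>" B True])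
           (simp_all add: lB norm_mult)
      moreover from this have "flat_at_edge (\<lambda>t. cnj (B t)) (of_real \<sigma>)"
        by (rule flat_at_edge_transfer[OF _ \<sigma>, of _ 1 _ False]) (simp_all add: laplace_cnj)
      ultimately show ?thesis unfolding H_def by (intro flat_at_edge_add Bd exp_decay_cnj \<sigma>)
    qed
    obtain M where M: "\<And>j. \<bar>l j\<bar> \<le> M" using assms(8) by (auto simp: bounded_iff)
    interpret bounded_shifts c l M H by unfold_locales (use assms(6) M Hd in auto)
    define A where "A t = (\<Sum>j. c j * h (t + l j))" for t
    have sm: "summable (\<lambda>j. c j * h (t + l j))" for t
    proof (rule summable_norm_cancel)
      have "norm (of_real (c j) * H (t + l j)) = norm (c j * h (t + l j))" for j
        unfolding hH[symmetric] norm_mult norm_of_real by (simp only: real_norm_def)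
      then show "summable (\<lambda>j. norm (c j * h (t + l j)))"
        using summable_norm_shifts[of t] by (simp only:)
    qed
    have AS: "(\<lambda>t. of_real (A t)) = shift_sum"
    proof
      fix t
      have "(\<lambda>j. of_real (c j * h (t + l j)) :: complex) sums of_real (A t)"
        unfolding A_def by (rule sums_of_real[OF summable_sums[OF sm]])
      then have "(\<lambda>j. of_real (c j) * H (t + l j)) sums of_real (A t)" by (simp only: of_real_mult hH)
      then show "of_real (A t) = shift_sum t" unfolding shift_sum_def by (rule sums_unique)
    qed
    have "infinite {t. A t = 0}"
    proof (rule infinitely_many_zeros_if_flat)
      show "exp_decay (\<lambda>t. of_real (A t))" unfolding AS by (rule exp_decay_shift_sum)
      have "flat_at_edge shift_sum (of_real \<sigma>)" if "\<bar>\<sigma>\<bar> = 1" for \<sigma> :: real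
        by (rule flat_shift_sum[OF Hflat[OF that] that])
      from this[of 1] this[of "- 1"]
      show "flat_at_edge (\<lambda>t. of_real (A t)) 1" "flat_at_edge (\<lambda>t. of_real (A t)) (- 1)"
        unfolding AS by simp_all
    qed
    then show ?thesis
    proof (rule reduce)
      fix t assume "t \<in> {t. A t = 0}"
      then have "(\<lambda>j. c j * h (t + l j)) sums 0" using summable_sums[OF sm[of t]] by (simp add: A_def)
      then have "(\<lambda>j. (1 / \<mu>) * of_real (c j * h (t + l j))) sums ((1 / \<mu>) * of_real 0)"
        by (intro sums_mult sums_of_real)
      \<comment> \<open>Adding i l(j) to s means replacing t by t + l(j), also in both Kummer
        parameters, and the Gamma factor is regular because Re s = k/2 is positive.\<close>
      moreover have "?T (\<s> t) = (\<lambda>j. (1 / \<mu>) * of_real (c j * h (t + l j)))"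
      proof
        fix j
        have s: "\<s> t + \<i> * of_real (l j) = \<s> (t + l j)" by (simp add: \<s>_def algebra_simps)
        have m: "- \<s> t - \<i> * of_real (l j) = - \<s> (t + l j)" by (simp add: \<s>_def algebra_simps)
        have k1: "of_nat k - \<s> t - \<i> * of_real (l j) = of_real (real k / 2) - \<i> * of_real (t + l j)"
          by (simp add: \<s>_def complex_eq_iff)
        have k2: "of_nat k - cnj (\<s> t) + \<i> * of_real (l j) = of_real (real k / 2) + \<i> * of_real (t + l j)"
          by (simp add: \<s>_def complex_eq_iff)
        have cw: "(cnj z) ^ 2 / 4 = cnj w" by (simp add: w_def)
        have "Re (\<s> (t + l j)) > 0" using k(1) by (simp add: \<s>_def)
        note L = completed_L_eq[OF this]
        have "?T (\<s> t) j = of_real (c j) * (of_real (2 * pi / of_int q) powr (- \<s> (t + l j)) * Gamma (\<s> (t + l j)) * twisted_L k a (\<s> (t + l j)) (of_int p / of_int q))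
           * (kummer_1F1 (of_real (real k / 2) - \<i> * of_real (t + l j)) (of_nat k) w
             + kummer_1F1 (of_real (real k / 2) + \<i> * of_real (t + l j)) (of_nat k) (cnj w))"
          unfolding s m k1 k2 cw w_def[symmetric] by (simp only: mult.assoc)
        also have "\<dots> = of_real (c j) * ((1 / \<mu>) * H (t + l j))"
          unfolding L H_eq using \<mu>(1) by simp
        finally show "?T (\<s> t) j = (1 / \<mu>) * of_real (c j * h (t + l j))"
          unfolding of_real_mult hH by (simp only: mult.left_commute)
      qed
      ultimately show "?T (\<s> t) sums 0" by simp
    qed
  qed
qed

end
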